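(* Let $r\in[0,\pi)$. Define an equivalence relation $\sim$ on $\mathrm{VR}^m_\leq(S^1;r)$ by setting $\mu_1\sim\mu_2$ if and only if for some $k\ge0$, $\mu_1$ and $\mu_2$ are in $V_{2k+1}(r)$ and $\widetilde F_{2k+1}(\mu_1,1)=\widetilde F_{2k+1}(\mu_2,1)$. Then $\mathrm{VR}^m_\leq(S^1;r)$ is homotopy equivalent to the quotient space $\mathrm{VR}^m_\leq(S^1;r)/\!\sim$.
   Context: Spaces of measures. $S^1$ is the unit circle with the geodesic (arc length) metric $d_{S^1}$, of total circumference $2\pi$; $[\theta]$ denotes the point $(\cos\theta,\sin\theta)$. $\mathcal{P}^{\mathrm{fin}}(S^1)$ is the set of finitely supported probability measures $\sum_{i=1}^n a_i\delta_{x_i}$ on $S^1$ with the 1-Wasserstein metric $d_W$: the distance between $\sum_i a_i\delta_{x_i}$ and $\sum_j a'_j\delta_{x'_j}$ is the infimum of $\sum_{i,j}\kappa_{i,j}d_{S^1}(x_i,x'_j)$ over nonnegative $\kappa_{i,j}$ with $\sum_j\kappa_{i,j}=a_i$ and $\sum_i\kappa_{i,j}=a'_j$. The support $\mathrm{supp}(\mu)$ is the set of points of positive mass. $\mathrm{VR}^m_\leq(S^1;r)$ is the subspace of $\mathcal{P}^{\mathrm{fin}}(S^1)$ of all $\mu$ with $\mathrm{diam}(\mathrm{supp}(\mu))\le r$. Arcs. Let $r\in[0,\pi)$. For a nonempty finite $\Theta\subset S^1$ with $\mathrm{diam}(\Theta)\le r$, a point is excluded by $\Theta$ if it is at distance greater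 than $r$ from some point of $\Theta$. A $(\Theta,r)$-arc is a closed arc (possibly a single point), maximal, containing at least one point of $\Theta$ and no point excluded by $\Theta$. For $\mu\in\mathrm{VR}^m_\leq(S^1;r)$, the $\mu$-arcs are the $(\mathrm{supp}(\mu),r)$-arcs, and points excluded by $\mu$ are those excluded by $\mathrm{supp}(\mu)$. $V_{2k+1}(r)$ is the set of $\mu\in\mathrm{VR}^m_\leq(S^1;r)$ having exactly $2k+1$ $\mu$-arcs. The maps $\widetilde F_{2k+1}$. For $\theta_0,y_0\in\mathbb{R}$, the coordinate system $(x,\tau)$ excluding $[\theta_0]$ consists of $x\colon S^1\setminus\{[\theta_0]\}\to\mathbb{R}$, $x([\theta])=y_0+\theta-\theta_0$ with representative $\theta\in(\theta_0,\theta_0+2\pi)$, and $\tau\colon\mathbb{R}\to S^1$, $\tau(z)=[z+\theta_0-y_0]$. For $\mu\in V_{2k+1}(r)$, choose such a system as follows: if $k=0$, let $[\theta_0]$ be any point excluded by $\mu$ and $A_0$ the single $\mu$-arc; if $k\ge1$, let $A_0,\dots,A_{2k}$ be the $\mu$-arcs in counterclockwise order, with $[\theta_0]$ strictly between the two closest support points of $A_{2k}$ and $A_0$. Put $m(\mu)=\sum_{i=0}^{2k}\int_{A_i}\big(x-\frac{2i\pi}{2k+1}\big)\,d\mu$. For $[\theta]\in\mathrm{supp}(\mu)\cap A_i$ and $t\in[0,1]$ set $F_{2k+1}([\theta],\mu,t)=\tau\big((1-t)x([\theta])+t(\frac{2i\pi}{2k+1}+m(\mu))\big)$ (this is independent of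 the choice of coordinate system), and for $\mu=\sum_i a_i\delta_{[\theta_i]}$ with all $a_i>0$ set $\widetilde F_{2k+1}(\mu,t)=\sum_i a_i\delta_{F_{2k+1}([\theta_i],\mu,t)}$. *)

theory Defs
  imports "HOL-Analysis.Analysis" "HOL-Probability.Probability_Mass_Function"
begin

section \<open>The circle\<close>

text \<open>The circle is the unit circle of the complex plane; the point \<open>[\<theta>]\<close> is \<^term>\<open>cis \<theta>\<close>.\<close>

abbreviation circle :: "complex set" where
  "circle \<equiv> sphere 0 1"

text \<open>Geodesic distance: the least length of an arc joining the two points.\<close>

definition dist_circle :: "complex \<Rightarrow> complex \<Rightarrow> real" where
  "dist_circle p q = Inf {\<bar>\<alpha> - \<beta>\<bar> | \<alpha> \<beta>. cis \<alpha> = p \<and> cis \<beta> = q}"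

definition diam_circle :: "complex set \<Rightarrow> real" where
  "diam_circle \<Theta> = Sup {dist_circle p q | p q. p \<in> \<Theta> \<and> q \<in> \<Theta>}"


section \<open>Finitely supported measures and the Vietoris--Rips metric thickening\<close>

text \<open>A finitely supported probability measure is a \<open>pmf\<close> with finite support
  \<^term>\<open>set_pmf \<mu>\<close>, the set of points of positive mass.\<close>

definition Pfin :: "complex pmf set" where
  "Pfin = {\<mu>. finite (set_pmf \<mu>) \<and> set_pmf \<mu> \<subseteq> circle}"

definition transport_plan :: "complex pmf \<Rightarrow> complex pmf \<Rightarrow> (complex \<Rightarrow> complex \<Rightarrow> real) \<Rightarrow> bool" where
  "transport_plan \<mu> \<nu> \<kappa> \<longleftrightarrow>
     (\<forall>p\<in>set_pmf \<mu>. \<forall>q\<in>set_pmf \<nu>. 0 \<le> \<kappa> p q) \<and>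
     (\<forall>p\<in>set_pmf \<mu>. (\<Sum>q\<in>set_pmf \<nu>. \<kappa> p q) = pmf \<mu> p) \<and>
     (\<forall>q\<in>set_pmf \<nu>. (\<Sum>p\<in>set_pmf \<mu>. \<kappa> p q) = pmf \<nu> q)"

definition transport_cost :: "complex pmf \<Rightarrow> complex pmf \<Rightarrow> (complex \<Rightarrow> complex \<Rightarrow> real) \<Rightarrow> real" where
  "transport_cost \<mu> \<nu> \<kappa> = (\<Sum>p\<in>set_pmf \<mu>. \<Sum>q\<in>set_pmf \<nu>. \<kappa> p q * dist_circle p q)"

text \<open>The value outside \<^term>\<open>Pfin\<close>, where the infimum can be meaningless, is a dummy:
  the locale \<^locale>\<open>Metric_space\<close> asks for nonnegativity and symmetry on the whole type.\<close>

definition wasserstein :: "complex pmf \<Rightarrow> complex pmf \<Rightarrow> real" where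
  "wasserstein \<mu> \<nu> =
     (if \<mu> \<in> Pfin \<and> \<nu> \<in> Pfin then Inf {transport_cost \<mu> \<nu> \<kappa> | \<kappa>. transport_plan \<mu> \<nu> \<kappa>} else 0)"

definition Pfin_topology :: "complex pmf topology" where
  "Pfin_topology = Metric_space.mtopology Pfin wasserstein"

definition VR :: "real \<Rightarrow> complex pmf set" where
  "VR r = {\<mu> \<in> Pfin. diam_circle (set_pmf \<mu>) \<le> r}"

definition VR_topology :: "real \<Rightarrow> complex pmf topology" where
  "VR_topology r = subtopology Pfin_topology (VR r)"


section \<open>Arcs\<close>

definition excluded :: "real \<Rightarrow> complex set \<Rightarrow> complex \<Rightarrow> bool" where
  "excluded r \<Theta> p \<longleftrightarrow> p \<in> circle \<and> (\<exists>q\<in>\<Theta>. dist_circle p q > r)"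

definition closed_arc :: "complex set \<Rightarrow> bool" where
  "closed_arc A \<longleftrightarrow> (\<exists>\<alpha> \<beta>. \<alpha> \<le> \<beta> \<and> \<beta> < \<alpha> + 2 * pi \<and> A = cis ` {\<alpha>..\<beta>})"

definition admissible_arc :: "real \<Rightarrow> complex set \<Rightarrow> complex set \<Rightarrow> bool" where
  "admissible_arc r \<Theta> A \<longleftrightarrow>
     closed_arc A \<and> A \<inter> \<Theta> \<noteq> {} \<and> (\<forall>p\<in>A. \<not> excluded r \<Theta> p)"

definition arcs :: "real \<Rightarrow> complex set \<Rightarrow> complex set set" where
  "arcs r \<Theta> = {A. admissible_arc r \<Theta> A \<and> (\<forall>B. admissible_arc r \<Theta> B \<and> A \<subseteq> B \<longrightarrow> B = A)}"

text \<open>\<open>V r k\<close> is the stratum of measures with exactly \<open>2 k + 1\<close> arcs.\<close>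

definition V :: "real \<Rightarrow> nat \<Rightarrow> complex pmf set" where
  "V r k = {\<mu> \<in> VR r. card (arcs r (set_pmf \<mu>)) = 2 * k + 1}"


section \<open>The collapsing maps\<close>

definition coord_x :: "real \<Rightarrow> real \<Rightarrow> complex \<Rightarrow> real" where
  "coord_x \<theta>0 y0 p = y0 + (THE \<theta>. \<theta>0 < \<theta> \<and> \<theta> < \<theta>0 + 2 * pi \<and> cis \<theta> = p) - \<theta>0"

definition coord_tau :: "real \<Rightarrow> real \<Rightarrow> real \<Rightarrow> complex" where
  "coord_tau \<theta>0 y0 z = cis (z + \<theta>0 - y0)"

text \<open>Distinct arcs in \<^term>\<open>arcs r \<Theta>\<close> are disjoint, so their cyclic order is that of any choice of
  one point from each; the points are lifted to a single turn of the real line.\<close>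

definition ccw_enumeration :: "real \<Rightarrow> nat \<Rightarrow> complex set \<Rightarrow> (nat \<Rightarrow> complex set) \<Rightarrow> bool" where
  "ccw_enumeration r k \<Theta> A \<longleftrightarrow>
     bij_betw A {..2 * k} (arcs r \<Theta>) \<and>
     (\<exists>c :: nat \<Rightarrow> real. (\<forall>i\<le>2 * k. cis (c i) \<in> A i) \<and>
        strict_mono_on {..2 * k} c \<and> c (2 * k) < c 0 + 2 * pi)"

text \<open>\<open>strictly_between_closest \<Theta> A B \<theta>0\<close>: some closest pair \<open>p \<in> \<Theta> \<inter> A\<close>, \<open>q \<in> \<Theta> \<inter> B\<close> has
  \<^term>\<open>cis \<theta>0\<close> in the interior of the shortest arc from \<open>p\<close> counterclockwise to \<open>q\<close>; here
  \<open>\<alpha>\<close>, \<open>\<beta>\<close> are the lifts of \<open>p\<close>, \<open>q\<close> on either side of \<open>\<theta>0\<close>.\<close>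

definition strictly_between_closest ::
    "complex set \<Rightarrow> complex set \<Rightarrow> complex set \<Rightarrow> real \<Rightarrow> bool" where
  "strictly_between_closest \<Theta> A B \<theta>0 \<longleftrightarrow>
     (\<exists>\<alpha> \<beta>. \<alpha> < \<theta>0 \<and> \<theta>0 < \<beta> \<and> \<beta> - \<alpha> = dist_circle (cis \<alpha>) (cis \<beta>) \<and>
        cis \<alpha> \<in> \<Theta> \<inter> A \<and> cis \<beta> \<in> \<Theta> \<inter> B \<and>
        (\<forall>p\<in>\<Theta> \<inter> A. \<forall>q\<in>\<Theta> \<inter> B. dist_circle (cis \<alpha>) (cis \<beta>) \<le> dist_circle p q))"

definition coord_choice ::
    "real \<Rightarrow> nat \<Rightarrow> complex pmf \<Rightarrow> real \<Rightarrow> real \<Rightarrow> (nat \<Rightarrow> complex set) \<Rightarrow> bool" where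
  "coord_choice r k \<mu> \<theta>0 y0 A \<longleftrightarrow>
     ccw_enumeration r k (set_pmf \<mu>) A \<and>
     (if k = 0 then excluded r (set_pmf \<mu>) (cis \<theta>0)
      else strictly_between_closest (set_pmf \<mu>) (A (2 * k)) (A 0) \<theta>0)"

definition mean :: "nat \<Rightarrow> complex pmf \<Rightarrow> real \<Rightarrow> real \<Rightarrow> (nat \<Rightarrow> complex set) \<Rightarrow> real" where
  "mean k \<mu> \<theta>0 y0 A =
     (\<Sum>i\<le>2 * k. LINT p:A i|measure_pmf \<mu>. coord_x \<theta>0 y0 p - 2 * real i * pi / real (2 * k + 1))"

definition F_coord ::
    "nat \<Rightarrow> complex pmf \<Rightarrow> real \<Rightarrow> real \<Rightarrow> (nat \<Rightarrow> complex set) \<Rightarrow> complex \<Rightarrow> real \<Rightarrow> complex" where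
  "F_coord k \<mu> \<theta>0 y0 A p t =
     (let i = (THE i. i \<le> 2 * k \<and> p \<in> A i) in
      coord_tau \<theta>0 y0
        ((1 - t) * coord_x \<theta>0 y0 p
         + t * (2 * real i * pi / real (2 * k + 1) + mean k \<mu> \<theta>0 y0 A)))"

definition F :: "real \<Rightarrow> nat \<Rightarrow> complex \<Rightarrow> complex pmf \<Rightarrow> real \<Rightarrow> complex" where
  "F r k p \<mu> t =
     (case (SOME (\<theta>0, y0, A). coord_choice r k \<mu> \<theta>0 y0 A) of
        (\<theta>0, y0, A) \<Rightarrow> F_coord k \<mu> \<theta>0 y0 A p t)"

definition F_tilde :: "real \<Rightarrow> nat \<Rightarrow> complex pmf \<Rightarrow> real \<Rightarrow> complex pmf" where
  "F_tilde r k \<mu> t = map_pmf (\<lambda>p. F r k p \<mu> t) \<mu>"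


section \<open>The quotient\<close>

definition collapse_rel :: "real \<Rightarrow> (complex pmf \<times> complex pmf) set" where
  "collapse_rel r =
     {(\<mu>1, \<mu>2). \<exists>k. \<mu>1 \<in> V r k \<and> \<mu>2 \<in> V r k \<and> F_tilde r k \<mu>1 1 = F_tilde r k \<mu>2 1}"

definition quotient_topology :: "'a topology \<Rightarrow> ('a \<times> 'a) set \<Rightarrow> 'a set topology" where
  "quotient_topology X R =
     topology (\<lambda>U. U \<subseteq> topspace X // R \<and> openin X {x \<in> topspace X. R `` {x} \<in> U})"

lemma openin_quotient_topology:
  "openin (quotient_topology X R) U \<longleftrightarrow>
     U \<subseteq> topspace X // R \<and> openin X {x \<in> topspace X. R `` {x} \<in> U}"
proof -
  have "istopology (\<lambda>U. U \<subseteq> topspace X // R \<and> openin X {x \<in> topspace X. R `` {x} \<in> U})"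
    unfolding istopology_def
  proof (intro conjI allI impI)
    fix S T
    assume S: "S \<subseteq> topspace X // R \<and> openin X {x \<in> topspace X. R `` {x} \<in> S}"
      and T: "T \<subseteq> topspace X // R \<and> openin X {x \<in> topspace X. R `` {x} \<in> T}"
    then show "S \<inter> T \<subseteq> topspace X // R" by blast
    have "{x \<in> topspace X. R `` {x} \<in> S \<inter> T} =
        {x \<in> topspace X. R `` {x} \<in> S} \<inter> {x \<in> topspace X. R `` {x} \<in> T}" by blast
    then show "openin X {x \<in> topspace X. R `` {x} \<in> S \<inter> T}"
      using S T by (simp add: openin_Int)
  next
    fix K
    assume K: "\<forall>S\<in>K. S \<subseteq> topspace X // R \<and> openin X {x \<in> topspace X. R `` {x} \<in> S}"
    then show "\<Union>K \<subseteq> topspace X // R" by blast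
    have "{x \<in> topspace X. R `` {x} \<in> \<Union>K} = (\<Union>S\<in>K. {x \<in> topspace X. R `` {x} \<in> S})" by blast
    then show "openin X {x \<in> topspace X. R `` {x} \<in> \<Union>K}"
      using K by auto
  qed
  then show ?thesis
    unfolding quotient_topology_def by simp
qed

lemma quotient_map_quotient_topology:
  "quotient_map X (quotient_topology X R) (\<lambda>x. R `` {x})"
proof -
  have "topspace (quotient_topology X R) = topspace X // R"
  proof (rule antisym)
    show "topspace (quotient_topology X R) \<subseteq> topspace X // R"
      using openin_quotient_topology[of X R] openin_topspace by blast
    have "{x \<in> topspace X. R `` {x} \<in> topspace X // R} = topspace X"
      by (auto intro: quotientI)
    then have "openin (quotient_topology X R) (topspace X // R)"
      by (simp add: openin_quotient_topology)
    then show "topspace X // R \<subseteq> topspace (quotient_topology X R)"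
      by (rule openin_subset)
  qed
  then show ?thesis
    unfolding quotient_map_def by (auto simp: openin_quotient_topology quotient_def)
qed


section \<open>The Wasserstein distance is a metric\<close>

lemma dist_circle_le:
  "cis a = p \<Longrightarrow> cis b = q \<Longrightarrow> dist_circle p q \<le> \<bar>a - b\<bar>"
  unfolding dist_circle_def by (rule cInf_lower) (auto intro!: bdd_belowI[of _ 0])

lemma dist_circle_greatest:
  assumes "p \<in> circle" "q \<in> circle"
    and "\<And>a b. cis a = p \<Longrightarrow> cis b = q \<Longrightarrow> c \<le> \<bar>a - b\<bar>"
  shows "c \<le> dist_circle p q"
proof -
  have "cis (Arg p) = p" "cis (Arg q) = q"
    using assms(1,2) rcis_cmod_Arg[of p] rcis_cmod_Arg[of q] by (simp_all add: rcis_def)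
  then show ?thesis
    unfolding dist_circle_def using assms(3) by (intro cInf_greatest) blast+
qed

lemma dist_circle_commute: "dist_circle p q = dist_circle q p"
proof -
  have "{\<bar>a - b\<bar> | a b. cis a = p \<and> cis b = q} \<subseteq> {\<bar>a - b\<bar> | a b. cis a = q \<and> cis b = p}" for p q
  proof
    fix x assume "x \<in> {\<bar>a - b\<bar> | a b. cis a = p \<and> cis b = q}"
    then obtain a b where "x = \<bar>b - a\<bar>" "cis a = p" "cis b = q"
      using abs_minus_commute by blast
    then show "x \<in> {\<bar>a - b\<bar> | a b. cis a = q \<and> cis b = p}" by blast
  qed
  then show ?thesis unfolding dist_circle_def by (intro arg_cong[where f = Inf] subset_antisym)
qed

lemma dist_circle_nonneg: "p \<in> circle \<Longrightarrow> q \<in> circle \<Longrightarrow> 0 \<le> dist_circle p q"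
  by (rule dist_circle_greatest) auto

lemma dist_circle_refl: "p \<in> circle \<Longrightarrow> dist_circle p p = 0"
proof -
  assume p: "p \<in> circle"
  then have "cis (Arg p) = p"
    using rcis_cmod_Arg[of p] by (simp add: rcis_def)
  then have "dist_circle p p \<le> 0" using dist_circle_le[of "Arg p" p "Arg p" p] by simp
  with dist_circle_nonneg[OF p p] show ?thesis by simp
qed

lemma norm_le_dist_circle:
  assumes "p \<in> circle" "q \<in> circle" shows "norm (p - q) \<le> dist_circle p q"
proof (rule dist_circle_greatest[OF assms])
  fix a b assume ab: "cis a = p" "cis b = q"
  have "norm (cis a - cis b) = norm (cis b * (cis (a - b) - 1))"
    by (simp add: algebra_simps cis_mult)
  also have "\<dots> = norm (cis (a - b) - 1)" by (simp add: norm_mult)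
  also have "\<dots> \<le> \<bar>a - b\<bar>"
  proof -
    have "(norm (cis (a - b) - 1))\<^sup>2 = (2 * sin ((a - b) / 2))\<^sup>2"
    proof -
      have c: "cos (a - b) = 1 - 2 * (sin ((a - b) / 2))\<^sup>2"
        using cos_double_sin[of "(a - b) / 2"] by (simp only: mult_2 field_sum_of_halves)
      have "(norm (cis (a - b) - 1))\<^sup>2 = (cos (a - b) - 1)\<^sup>2 + (sin (a - b))\<^sup>2"
        by (simp add: cmod_power2)
      also have "\<dots> = 2 - 2 * cos (a - b)"
        using sin_cos_squared_add[of "a - b"] by (simp add: power2_diff)
      finally show ?thesis using c by (simp add: power_mult_distrib)
    qed
    then have "norm (cis (a - b) - 1) = \<bar>2 * sin ((a - b) / 2)\<bar>"
      by (metis norm_ge_zero real_sqrt_abs real_sqrt_unique)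
    also have "\<dots> \<le> \<bar>a - b\<bar>" using abs_sin_x_le_abs_x[of "(a - b) / 2"] by simp
    finally show ?thesis .
  qed
  finally show "norm (p - q) \<le> \<bar>a - b\<bar>" using ab by simp
qed

lemma dist_circle_triangle:
  assumes "p \<in> circle" "q \<in> circle" "s \<in> circle"
  shows "dist_circle p s \<le> dist_circle p q + dist_circle q s"
proof -
  have "dist_circle p s - dist_circle q s \<le> dist_circle p q"
  proof (rule dist_circle_greatest[OF assms(1,2)])
    fix a b assume ab: "cis a = p" "cis b = q"
    have "dist_circle p s - \<bar>a - b\<bar> \<le> dist_circle q s"
    proof (rule dist_circle_greatest[OF assms(2,3)])
      fix b' c assume bc: "cis b' = q" "cis c = s"
      have "cis (c + (b - b')) = cis c * (cis b / cis b')" by (simp only: cis_mult cis_divide)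
      then have "cis (c + (b - b')) = s"
        using ab bc cis_neq_zero[of b'] by simp
      from dist_circle_le[OF ab(1) this]
      show "dist_circle p s - \<bar>a - b\<bar> \<le> \<bar>b' - c\<bar>" by linarith
    qed
    then show "dist_circle p s - dist_circle q s \<le> \<bar>a - b\<bar>" by linarith
  qed
  then show ?thesis by linarith
qed

lemma Pfin_sum_pmf: "\<mu> \<in> Pfin \<Longrightarrow> (\<Sum>p\<in>set_pmf \<mu>. pmf \<mu> p) = 1"
  by (simp add: Pfin_def sum_pmf_eq_1)

lemma Pfin_D: "\<mu> \<in> Pfin \<Longrightarrow> finite (set_pmf \<mu>)" "\<mu> \<in> Pfin \<Longrightarrow> p \<in> set_pmf \<mu> \<Longrightarrow> p \<in> circle"
  by (auto simp: Pfin_def)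

lemma transport_cost_nonneg:
  assumes "\<mu> \<in> Pfin" "\<nu> \<in> Pfin" "transport_plan \<mu> \<nu> \<kappa>"
  shows "0 \<le> transport_cost \<mu> \<nu> \<kappa>"
  unfolding transport_cost_def
proof (intro sum_nonneg mult_nonneg_nonneg)
  fix p q assume pq: "p \<in> set_pmf \<mu>" "q \<in> set_pmf \<nu>"
  then show "0 \<le> \<kappa> p q" using assms(3) by (simp add: transport_plan_def)
  show "0 \<le> dist_circle p q"
    using Pfin_D(2)[OF assms(1) pq(1)] Pfin_D(2)[OF assms(2) pq(2)] by (rule dist_circle_nonneg)
qed

lemma wasserstein_le:
  assumes "\<mu> \<in> Pfin" "\<nu> \<in> Pfin" "transport_plan \<mu> \<nu> \<kappa>"
  shows "wasserstein \<mu> \<nu> \<le> transport_cost \<mu> \<nu> \<kappa>"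
proof -
  have "bdd_below {transport_cost \<mu> \<nu> \<kappa> | \<kappa>. transport_plan \<mu> \<nu> \<kappa>}"
    using transport_cost_nonneg[OF assms(1,2)] by (auto intro!: bdd_belowI[of _ 0])
  then show ?thesis
    using assms unfolding wasserstein_def
    by (auto intro!: cInf_lower)
qed

lemma wasserstein_greatest:
  assumes "\<mu> \<in> Pfin" "\<nu> \<in> Pfin"
    and "\<And>\<kappa>. transport_plan \<mu> \<nu> \<kappa> \<Longrightarrow> c \<le> transport_cost \<mu> \<nu> \<kappa>"
  shows "c \<le> wasserstein \<mu> \<nu>"
proof -
  have "transport_plan \<mu> \<nu> (\<lambda>p q. pmf \<mu> p * pmf \<nu> q)"
    using assms(1,2) unfolding transport_plan_def
    by (auto simp: sum_distrib_left[symmetric] sum_distrib_right[symmetric] Pfin_sum_pmf)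
  then show ?thesis
    using assms unfolding wasserstein_def
    by (auto intro!: cInf_greatest)
qed

lemma transport_plan_swap:
  "transport_plan \<mu> \<nu> \<kappa> \<Longrightarrow> transport_plan \<nu> \<mu> (\<lambda>p q. \<kappa> q p)"
  by (auto simp: transport_plan_def)

lemma transport_cost_swap:
  "transport_cost \<nu> \<mu> (\<lambda>p q. \<kappa> q p) = transport_cost \<mu> \<nu> \<kappa>"
proof -
  have "transport_cost \<nu> \<mu> (\<lambda>p q. \<kappa> q p)
      = (\<Sum>q\<in>set_pmf \<mu>. \<Sum>p\<in>set_pmf \<nu>. \<kappa> q p * dist_circle p q)"
    unfolding transport_cost_def by (rule sum.swap)
  also have "\<dots> = (\<Sum>q\<in>set_pmf \<mu>. \<Sum>p\<in>set_pmf \<nu>. \<kappa> q p * dist_circle q p)"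
    by (intro sum.cong refl arg_cong2[where f = "(*)"] dist_circle_commute)
  finally show ?thesis unfolding transport_cost_def .
qed

lemma wasserstein_commute_le:
  assumes "\<mu> \<in> Pfin" "\<nu> \<in> Pfin"
  shows "wasserstein \<nu> \<mu> \<le> wasserstein \<mu> \<nu>"
proof (rule wasserstein_greatest[OF assms])
  fix \<kappa> assume "transport_plan \<mu> \<nu> \<kappa>"
  from wasserstein_le[OF assms(2,1) transport_plan_swap[OF this]]
  show "wasserstein \<nu> \<mu> \<le> transport_cost \<mu> \<nu> \<kappa>"
    by (rule order_trans) (rule eq_refl[OF transport_cost_swap])
qed

lemma wasserstein_commute: "wasserstein \<mu> \<nu> = wasserstein \<nu> \<mu>"
proof (cases "\<mu> \<in> Pfin \<and> \<nu> \<in> Pfin")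
  case True
  then show ?thesis using wasserstein_commute_le[of \<mu> \<nu>] wasserstein_commute_le[of \<nu> \<mu>] by simp
qed (auto simp: wasserstein_def)

lemma wasserstein_nonneg: "0 \<le> wasserstein \<mu> \<nu>"
proof (cases "\<mu> \<in> Pfin \<and> \<nu> \<in> Pfin")
  case True
  then show ?thesis using transport_cost_nonneg by (auto intro: wasserstein_greatest)
qed (auto simp: wasserstein_def)

lemma wasserstein_refl:
  assumes "\<mu> \<in> Pfin" shows "wasserstein \<mu> \<mu> = 0"
proof -
  let ?k = "\<lambda>p q. if p = q then pmf \<mu> p else 0"
  have 1: "transport_plan \<mu> \<mu> ?k"
    using Pfin_D[OF assms] by (auto simp: transport_plan_def sum.delta)
  have "transport_cost \<mu> \<mu> ?k = 0"
    unfolding transport_cost_def using Pfin_D[OF assms]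
    by (intro sum.neutral ballI) (auto simp: dist_circle_refl)
  then show ?thesis using wasserstein_le[OF assms assms 1] wasserstein_nonneg[of \<mu> \<mu>] by simp
qed

lemma wasserstein_0_pmf_le:
  assumes "\<mu> \<in> Pfin" "\<nu> \<in> Pfin" "wasserstein \<mu> \<nu> = 0"
  shows "pmf \<mu> z \<le> pmf \<nu> z"
proof (cases "z \<in> set_pmf \<mu>")
  case True
  let ?M = "set_pmf \<mu>" and ?N = "set_pmf \<nu>"
  define D where "D = insert 1 ((\<lambda>q. dist_circle z q) ` (?N - {z}))"
  have zc: "z \<in> circle" using True assms Pfin_D by blast
  have "finite D" "D \<noteq> {}" using Pfin_D[OF assms(2)] by (auto simp: D_def)
  have "x > 0" if "x \<in> D" for x
  proof -
    have "dist_circle z q > 0" if "q \<in> ?N" "q \<noteq> z" for q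
    proof -
      have "0 < norm (z - q)" using that by simp
      also have "\<dots> \<le> dist_circle z q" using norm_le_dist_circle zc that(1) assms Pfin_D by blast
      finally show ?thesis .
    qed
    then show ?thesis using that by (auto simp: D_def)
  qed
  then have d0: "Min D > 0" using \<open>finite D\<close> \<open>D \<noteq> {}\<close> by simp
  have dq: "Min D \<le> dist_circle z q" if "q \<in> ?N" "q \<noteq> z" for q
    using that \<open>finite D\<close> by (intro Min_le) (auto simp: D_def)
  have "Min D * (pmf \<mu> z - pmf \<nu> z) \<le> wasserstein \<mu> \<nu>"
  proof (rule wasserstein_greatest[OF assms(1,2)])
    fix \<kappa> assume k: "transport_plan \<mu> \<nu> \<kappa>"
    have fin: "finite ?M" "finite ?N" using assms Pfin_D by auto
    have kz: "(if z \<in> ?N then \<kappa> z z else 0) \<le> pmf \<nu> z"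
    proof (cases "z \<in> ?N")
      case True
      have "\<kappa> z z \<le> (\<Sum>p\<in>?M. \<kappa> p z)"
        using k True \<open>z \<in> ?M\<close> fin by (intro member_le_sum) (auto simp: transport_plan_def)
      then show ?thesis using k True by (simp add: transport_plan_def)
    qed simp
    have "pmf \<mu> z = (\<Sum>q\<in>?N. \<kappa> z q)" using k True by (simp add: transport_plan_def)
    also have "\<dots> = (\<Sum>q\<in>?N - {z}. \<kappa> z q) + (if z \<in> ?N then \<kappa> z z else 0)"
      using fin by (auto simp: sum.remove)
    finally have "pmf \<mu> z - pmf \<nu> z \<le> (\<Sum>q\<in>?N - {z}. \<kappa> z q)" using kz by linarith
    then have "(pmf \<mu> z - pmf \<nu> z) * Min D \<le> (\<Sum>q\<in>?N - {z}. \<kappa> z q) * Min D"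
      using d0 by (intro mult_right_mono) simp_all
    then have "Min D * (pmf \<mu> z - pmf \<nu> z) \<le> (\<Sum>q\<in>?N - {z}. \<kappa> z q * Min D)"
      by (simp only: sum_distrib_right mult.commute[of "Min D"])
    also have "\<dots> \<le> (\<Sum>q\<in>?N - {z}. \<kappa> z q * dist_circle z q)"
      using k True dq by (intro sum_mono mult_left_mono) (auto simp: transport_plan_def)
    also have "\<dots> \<le> (\<Sum>q\<in>?N. \<kappa> z q * dist_circle z q)"
      using k True fin zc assms Pfin_D
      by (intro sum_mono2) (auto simp: transport_plan_def dist_circle_refl)
    also have "\<dots> \<le> (\<Sum>p\<in>?M. \<Sum>q\<in>?N. \<kappa> p q * dist_circle p q)"
    proof (rule member_le_sum[where f = "\<lambda>p. \<Sum>q\<in>?N. \<kappa> p q * dist_circle p q"])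
      show "0 \<le> (\<Sum>q\<in>?N. \<kappa> p q * dist_circle p q)" if "p \<in> ?M - {z}" for p
        using k that assms Pfin_D
        by (intro sum_nonneg mult_nonneg_nonneg dist_circle_nonneg) (auto simp: transport_plan_def)
    qed (use True fin in auto)
    finally show "Min D * (pmf \<mu> z - pmf \<nu> z) \<le> transport_cost \<mu> \<nu> \<kappa>"
      by (simp add: transport_cost_def)
  qed
  then show ?thesis using d0 assms(3) by (simp add: mult_le_0_iff)
qed (simp add: set_pmf_iff)

lemma wasserstein_triangle:
  assumes M: "\<mu> \<in> Pfin" and N: "\<nu> \<in> Pfin" and R: "\<rho> \<in> Pfin"
  shows "wasserstein \<mu> \<rho> \<le> wasserstein \<mu> \<nu> + wasserstein \<nu> \<rho>"
proof -
  let ?M = "set_pmf \<mu>" and ?N = "set_pmf \<nu>" and ?R = "set_pmf \<rho>"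
  have key: "wasserstein \<mu> \<rho> \<le> transport_cost \<mu> \<nu> \<kappa> + transport_cost \<nu> \<rho> \<kappa>'"
    if k: "transport_plan \<mu> \<nu> \<kappa>" and k': "transport_plan \<nu> \<rho> \<kappa>'" for \<kappa> \<kappa>'
  proof -
    define g where "g = (\<lambda>p s q. \<kappa> p q * \<kappa>' q s / pmf \<nu> q)"
    have pos: "pmf \<nu> q > 0" if "q \<in> ?N" for q using that by (simp add: pmf_positive_iff)
    have g0: "0 \<le> g p s q" if "p \<in> ?M" "q \<in> ?N" "s \<in> ?R" for p q s
      using k k' that pos[of q] by (simp add: g_def transport_plan_def)
    have gR: "(\<Sum>s\<in>?R. g p s q) = \<kappa> p q" if "p \<in> ?M" "q \<in> ?N" for p q
    proof -
      have "(\<Sum>s\<in>?R. g p s q) = \<kappa> p q * (\<Sum>s\<in>?R. \<kappa>' q s) / pmf \<nu> q"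
        by (simp add: g_def sum_distrib_left sum_divide_distrib)
      then show ?thesis using k' that pos[of q] by (simp add: transport_plan_def)
    qed
    have gM: "(\<Sum>p\<in>?M. g p s q) = \<kappa>' q s" if "s \<in> ?R" "q \<in> ?N" for s q
    proof -
      have "(\<Sum>p\<in>?M. g p s q) = (\<Sum>p\<in>?M. \<kappa> p q) * \<kappa>' q s / pmf \<nu> q"
        by (simp add: g_def sum_distrib_right sum_divide_distrib)
      then show ?thesis using k that pos[of q] by (simp add: transport_plan_def)
    qed
    let ?k = "\<lambda>p s. \<Sum>q\<in>?N. g p s q"
    have plan: "transport_plan \<mu> \<rho> ?k"
      unfolding transport_plan_def
    proof (intro conjI ballI)
      fix p s assume "p \<in> ?M" "s \<in> ?R"
      then show "0 \<le> ?k p s" by (intro sum_nonneg g0)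
    next
      fix p assume p: "p \<in> ?M"
      have "(\<Sum>s\<in>?R. ?k p s) = (\<Sum>q\<in>?N. \<Sum>s\<in>?R. g p s q)" by (rule sum.swap)
      also have "\<dots> = (\<Sum>q\<in>?N. \<kappa> p q)" using gR p by simp
      finally show "(\<Sum>s\<in>?R. ?k p s) = pmf \<mu> p" using k p by (simp add: transport_plan_def)
    next
      fix s assume s: "s \<in> ?R"
      have "(\<Sum>p\<in>?M. ?k p s) = (\<Sum>q\<in>?N. \<Sum>p\<in>?M. g p s q)" by (rule sum.swap)
      also have "\<dots> = (\<Sum>q\<in>?N. \<kappa>' q s)" using gM s by simp
      finally show "(\<Sum>p\<in>?M. ?k p s) = pmf \<rho> s" using k' s by (simp add: transport_plan_def)
    qed
    have "transport_cost \<mu> \<rho> ?k = (\<Sum>p\<in>?M. \<Sum>s\<in>?R. \<Sum>q\<in>?N. g p s q * dist_circle p s)"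
      by (simp add: transport_cost_def sum_distrib_right)
    also have "\<dots> \<le> (\<Sum>p\<in>?M. \<Sum>s\<in>?R. \<Sum>q\<in>?N. g p s q * dist_circle p q + g p s q * dist_circle q s)"
    proof (intro sum_mono)
      fix p s q assume pqs: "p \<in> ?M" "s \<in> ?R" "q \<in> ?N"
      then have "dist_circle p s \<le> dist_circle p q + dist_circle q s"
        using dist_circle_triangle M N R Pfin_D(2) by blast
      then show "g p s q * dist_circle p s \<le> g p s q * dist_circle p q + g p s q * dist_circle q s"
        using g0[OF pqs(1,3,2)] by (metis distrib_left mult_left_mono)
    qed
    also have "\<dots> = (\<Sum>p\<in>?M. \<Sum>s\<in>?R. \<Sum>q\<in>?N. g p s q * dist_circle p q)
        + (\<Sum>p\<in>?M. \<Sum>s\<in>?R. \<Sum>q\<in>?N. g p s q * dist_circle q s)"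
      by (simp add: sum.distrib)
    also have "(\<Sum>p\<in>?M. \<Sum>s\<in>?R. \<Sum>q\<in>?N. g p s q * dist_circle p q) = transport_cost \<mu> \<nu> \<kappa>"
    proof -
      have "(\<Sum>s\<in>?R. \<Sum>q\<in>?N. g p s q * dist_circle p q) = (\<Sum>q\<in>?N. \<kappa> p q * dist_circle p q)"
        if "p \<in> ?M" for p
        using that by (subst sum.swap) (simp add: sum_distrib_right[symmetric] gR)
      then show ?thesis by (simp add: transport_cost_def)
    qed
    also have "(\<Sum>p\<in>?M. \<Sum>s\<in>?R. \<Sum>q\<in>?N. g p s q * dist_circle q s) = transport_cost \<nu> \<rho> \<kappa>'"
    proof -
      have "(\<Sum>p\<in>?M. \<Sum>s\<in>?R. \<Sum>q\<in>?N. g p s q * dist_circle q s)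
          = (\<Sum>s\<in>?R. \<Sum>p\<in>?M. \<Sum>q\<in>?N. g p s q * dist_circle q s)" by (rule sum.swap)
      also have "\<dots> = (\<Sum>s\<in>?R. \<Sum>q\<in>?N. \<Sum>p\<in>?M. g p s q * dist_circle q s)"
        by (intro sum.cong refl sum.swap)
      also have "\<dots> = (\<Sum>s\<in>?R. \<Sum>q\<in>?N. \<kappa>' q s * dist_circle q s)"
        by (simp add: sum_distrib_right[symmetric] gM)
      also have "\<dots> = (\<Sum>q\<in>?N. \<Sum>s\<in>?R. \<kappa>' q s * dist_circle q s)" by (rule sum.swap)
      finally show ?thesis by (simp add: transport_cost_def)
    qed
    finally show ?thesis using wasserstein_le[OF M R plan] by linarith
  qed
  have "wasserstein \<mu> \<rho> - wasserstein \<nu> \<rho> \<le> wasserstein \<mu> \<nu>"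
  proof (rule wasserstein_greatest[OF M N])
    fix \<kappa> assume k: "transport_plan \<mu> \<nu> \<kappa>"
    have "wasserstein \<mu> \<rho> - transport_cost \<mu> \<nu> \<kappa> \<le> wasserstein \<nu> \<rho>"
      using key[OF k] by (intro wasserstein_greatest[OF N R]) (simp add: algebra_simps)
    then show "wasserstein \<mu> \<rho> - wasserstein \<nu> \<rho> \<le> transport_cost \<mu> \<nu> \<kappa>" by linarith
  qed
  then show ?thesis by linarith
qed

lemma Metric_space_wasserstein: "Metric_space Pfin wasserstein"
proof
  fix \<mu> \<nu> assume MN: "\<mu> \<in> Pfin" "\<nu> \<in> Pfin"
  show "wasserstein \<mu> \<nu> = 0 \<longleftrightarrow> \<mu> = \<nu>"
  proof
    assume "wasserstein \<mu> \<nu> = 0"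
    then show "\<mu> = \<nu>"
      using wasserstein_0_pmf_le[OF MN] wasserstein_0_pmf_le[OF MN(2,1)] wasserstein_commute[of \<mu> \<nu>]
      by (intro pmf_eqI antisym) auto
  qed (use wasserstein_refl MN in auto)
qed (auto simp: wasserstein_nonneg wasserstein_commute wasserstein_triangle)

end

theory Submission
  imports Defs
begin

text \<open>
  The support of a measure is lifted to a \<open>2 * pi\<close>-periodic set \<open>S\<close> of reals. Its arcs are the runs of
  points of \<open>S\<close> that are not interrupted by a point of \<open>S + pi\<close>; since \<open>S\<close> and \<open>S + pi\<close> exchange their
  roles under a half turn, their number per turn is odd, and numbering the runs gives an index
  \<open>g\<close> from \<open>S\<close> onto the integers with \<open>x < w + pi \<longleftrightarrow> g x \<le> g w + k\<close>. In these terms \<open>F_tilde r k \<mu> 1\<close> is the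
  image of \<open>\<mu>\<close> under \<open>x \<mapsto> cis (2 * pi * g x / (2 * k + 1) + m)\<close>, where \<open>m\<close> is the mean of
  \<open>x - 2 * pi * g x / (2 * k + 1)\<close>. Monotone maps of \<open>S\<close> that commute with
  full turns and keep the bound \<open>r\<close> on the diameter preserve the runs and rotate the collapsed measure
  by the mean displacement.

  A homotopy \<open>H\<close> on the whole space with \<open>H 0 = id\<close> that maps classes into classes, and whose end map is
  constant on classes, makes the quotient map a homotopy equivalence. It is built by induction on the
  number of strata. On the top stratum the points slide towards their collapsed position while the
  smallest arc mass is taken away from every arc. Far from the lower strata only the sliding is completed,
  which makes classes into points; close to them only the thinning is completed, which leads into
  the lower strata, where the induction hypothesis applies; in between both are completed, and there the
  homotopy given by induction is faded out. Deleting mass does not preserve the mean, hence it is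
  accompanied by a rotation.
\<close>

text \<open>Sliding is continuous on each stratum, but the slides do not fit together: a measure
  that loses the mass of some arcs converges to one with fewer arcs, whose collapsed positions are
  different ones. Hence no single formula slides all measures at once, and thinning is what carries
  a measure near the boundary of its stratum continuously across it.

  Thinning scales each arc by a factor that depends only on the masses of the arcs, and equivalent
  measures share these. They may still distribute the mass differently inside an arc, so thinning
  changes their means by different amounts; without the rotation the thinned measures need not stay
  equivalent.

  An index needs no cut point, is unique up to a constant, and restricts to smaller supports, where
  a missing value reveals that a whole arc is gone. The assumption \<open>r < pi\<close> enters as
  the gap \<open>pi - r\<close>: it makes indices stable under small perturbations and the number of
  strata finite.\<close>

section \<open>Indices of periodic sets of reals\<close>

definition periodic :: "real set \<Rightarrow> bool" where
  "periodic S \<longleftrightarrow> (\<forall>x\<in>S. x + 2 * pi \<in> S \<and> x - 2 * pi \<in> S)"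

text \<open>Every condition survives restriction to a periodic subset of \<open>S\<close>, whereas
  the surjectivity asked for in \<open>run_index\<close> does not. The last one says that the
  antipode \<open>w + pi\<close> separates the points of index at most \<open>g w + k\<close> from
  the others.\<close>

definition pindex :: "real set \<Rightarrow> nat \<Rightarrow> (real \<Rightarrow> int) \<Rightarrow> bool" where
  "pindex S k g \<longleftrightarrow> periodic S \<and> (\<forall>x\<in>S. g (x + 2 * pi) = g x + (2 * int k + 1)) \<and>
     (\<forall>x\<in>S. \<forall>y\<in>S. x \<le> y \<longrightarrow> g x \<le> g y) \<and>
     (\<forall>x\<in>S. \<forall>w\<in>S. x < w + pi \<longleftrightarrow> g x \<le> g w + int k)"

definition run_index :: "real set \<Rightarrow> nat \<Rightarrow> (real \<Rightarrow> int) \<Rightarrow> bool" where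
  "run_index S k g \<longleftrightarrow> pindex S k g \<and> (\<forall>i. \<exists>x\<in>S. g x = i)"

lemma periodic_shift:
  assumes "periodic S" "x \<in> S"
  shows "x + 2 * pi * of_int n \<in> S"
proof (induction n rule: int_induct[where k = 0])
  case (step1 i)
  have "(x + 2 * pi * of_int i) + 2 * pi \<in> S" using assms(1) step1 by (auto simp: periodic_def)
  then show ?case by (simp add: algebra_simps)
next
  case (step2 i)
  have "(x + 2 * pi * of_int i) - 2 * pi \<in> S" using assms(1) step2 by (auto simp: periodic_def)
  then show ?case by (simp add: algebra_simps)
qed (use assms in simp)

lemma periodic_shift_fun:
  assumes "periodic S" and g: "\<And>x. x \<in> S \<Longrightarrow> g (x + 2 * pi) = g x + (d :: 'a :: comm_ring_1)" and "x \<in> S"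
  shows "g (x + 2 * pi * of_int n) = g x + of_int n * d"
proof (induction n rule: int_induct[where k = 0])
  case (step1 i)
  have "g ((x + 2 * pi * of_int i) + 2 * pi) = g (x + 2 * pi * of_int i) + d"
    using periodic_shift[OF assms(1,3)] by (rule g)
  with step1 show ?case by (simp add: algebra_simps)
next
  case (step2 i)
  have "g ((x + 2 * pi * of_int (i - 1)) + 2 * pi) = g (x + 2 * pi * of_int (i - 1)) + d"
    using periodic_shift[OF assms(1,3)] by (rule g)
  with step2 show ?case by (simp add: algebra_simps)
qed simp

lemma pindexD:
  assumes "pindex S k g"
  shows pindex_periodic: "periodic S"
    and pindex_mono: "\<And>x y. x \<in> S \<Longrightarrow> y \<in> S \<Longrightarrow> x \<le> y \<Longrightarrow> g x \<le> g y"
    and pindex_less: "\<And>x w. x \<in> S \<Longrightarrow> w \<in> S \<Longrightarrow> x < w + pi \<longleftrightarrow> g x \<le> g w + int k"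
  using assms by (auto simp: pindex_def)

lemma pindex_shift:
  assumes "pindex S k g" "x \<in> S"
  shows "g (x + 2 * pi * of_int n) = g x + n * (2 * int k + 1)"
  using periodic_shift_fun[of S g "2 * int k + 1" x n] assms by (auto simp: pindex_def)

lemma run_indexD:
  assumes "run_index S k g"
  shows run_index_pindex: "pindex S k g" and run_index_onto: "\<And>i. \<exists>x\<in>S. g x = i"
  using assms by (auto simp: run_index_def)

lemma run_index_separated:
  assumes g: "run_index S k g" and "y \<in> S" "g x < g y" "x \<in> S"
  obtains w where "w \<in> S" "x < w + pi" "w + pi \<le> y"
proof -
  obtain w where w: "w \<in> S" "g w = g y - int k - 1" using run_index_onto[OF g] by blast
  have "x < w + pi" "\<not> y < w + pi"
    using pindex_less[OF run_index_pindex[OF g]] w assms by auto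
  with w show ?thesis using that by force
qed

text \<open>A partial index can only jump more often than an index, and both make equally many
  jumps per turn.\<close>

lemma pindex_strict:
  assumes g: "run_index S k g" and S': "pindex S' l g'" "S \<subseteq> S'" and xy: "x \<in> S" "y \<in> S" "g x < g y"
  shows "g' x < g' y"
proof -
  obtain w where "w \<in> S" "x < w + pi" "w + pi \<le> y"
    using run_index_separated[OF g xy(2,3,1)] .
  then have "g' x \<le> g' w + int l" "\<not> g' y \<le> g' w + int l"
    using pindex_less[OF S'(1), of x w] pindex_less[OF S'(1), of y w] S'(2) xy by (auto simp: subset_iff)
  then show ?thesis by simp
qed

text \<open>Each of the \<open>n\<close> jumps of \<open>g\<close> on the way from \<open>x\<close>
  to \<open>y\<close> forces a strict increase of \<open>g'\<close>. The case \<open>n = 0\<close>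
  is excepted because two points of one run may come in either order.\<close>

lemma pindex_jumps:
  assumes g: "run_index S k g" and S': "pindex S' l g'" "S \<subseteq> S'" and xy: "x \<in> S" "y \<in> S" "g y = g x + int n"
  shows "g' x + int n \<le> g' y \<or> n = 0"
  using xy
proof (induction n arbitrary: y)
  case (Suc n)
  obtain z where z: "z \<in> S" "g z = g x + int n" using run_index_onto[OF g] by blast
  have "g' z < g' y" using pindex_strict[OF g S' z(1), of y] Suc.prems z by simp
  then show ?case using Suc.IH[OF xy(1) z] pindex_strict[OF g S' xy(1), of y] Suc.prems by auto
qed simp

text \<open>Over a full turn \<open>g\<close> makes \<open>2 * k + 1\<close> jumps while
  \<open>g'\<close> rises by \<open>2 * l + 1\<close>.\<close>

lemma pindex_level_le:
  assumes g: "run_index S k g" and S': "pindex S' l g'" "S \<subseteq> S'"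
  shows "k \<le> l"
proof -
  obtain x where x: "x \<in> S" using run_index_onto[OF g] by blast
  have P: "pindex S k g" using g by (rule run_index_pindex)
  have y: "x + 2 * pi \<in> S" "g (x + 2 * pi) = g x + int (2 * k + 1)" "g' (x + 2 * pi) = g' x + (2 * int l + 1)"
    using x P S' by (auto simp: pindex_def periodic_def)
  show ?thesis using pindex_jumps[OF g S' x y(1,2)] y(3) by simp
qed

text \<open>Equal rises over a turn leave no slack: the \<open>2 * k\<close> jumps from
  \<open>y\<close> to \<open>x + 2 * pi\<close> use up all but one unit of the rise of
  \<open>g'\<close>, so \<open>g'\<close> rises by exactly one at each jump of
  \<open>g\<close>.\<close>

lemma pindex_unique:
  assumes g: "run_index S k g" and S': "pindex S k g'"
  obtains c where "\<And>x. x \<in> S \<Longrightarrow> g' x = g x + c"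
proof -
  have P: "pindex S k g" using g by (rule run_index_pindex)
  have step: "g' y = g' x + 1" if x: "x \<in> S" and y: "y \<in> S" and 1: "g y = g x + 1" for x y
  proof -
    have x2: "x + 2 * pi \<in> S" "g (x + 2 * pi) = g x + int (2 * k + 1)" "g' (x + 2 * pi) = g' x + (2 * int k + 1)"
      using x P S' by (auto simp: pindex_def periodic_def)
    then have jump: "g (x + 2 * pi) = g y + int (2 * k)" using 1 by simp
    have "g' y + int (2 * k) \<le> g' (x + 2 * pi)"
    \<comment> \<open>For \<open>k = 0\<close> no jump separates \<open>y\<close> from
      \<open>x + 2 * pi\<close>; the antipode condition, valid for \<open>g\<close> and
      \<open>g'\<close> alike, supplies the inequality.\<close>
    proof (cases "k = 0")
      case True
      then show ?thesis
        using pindex_less[OF P y x2(1)] pindex_less[OF S' y x2(1)] jump by simp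
    next
      case False
      then show ?thesis
        using pindex_jumps[OF g S' order_refl y x2(1) jump] by simp
    qed
    then show ?thesis using x2 pindex_strict[OF g S' order_refl x y] 1 by simp
  qed
  \<comment> \<open>Points of one run have a common successor \<open>z\<close>, whose
    \<open>g'\<close> is one above that of each of them.\<close>
  have same: "g' x = g' y" if "x \<in> S" "y \<in> S" "g x = g y" for x y
  proof -
    obtain z where "z \<in> S" "g z = g x + 1" using run_index_onto[OF g] by blast
    then have "g' z = g' x + 1" "g' z = g' y + 1" using step[of x z] step[of y z] that by simp_all
    then show ?thesis by simp
  qed
  obtain x0 where x0: "x0 \<in> S" using run_index_onto[OF g] by blast
  have "\<forall>x\<in>S. g x = i \<longrightarrow> g' x = i + (g' x0 - g x0)" for i
  proof (induction i rule: int_induct[where k = "g x0"])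
    case base
    then show ?case
    proof (intro ballI impI)
      fix x assume "x \<in> S" "g x = g x0"
      from same[OF this(1) x0 this(2)] show "g' x = g x0 + (g' x0 - g x0)" by simp
    qed
  next
    case (step1 i)
    obtain z where z: "z \<in> S" "g z = i" using run_index_onto[OF g] by blast
    show ?case
    proof (intro ballI impI)
      fix x assume "x \<in> S" "g x = i + 1"
      then show "g' x = i + 1 + (g' x0 - g x0)" using step1(2) step[of z x] z by simp
    qed
  next
    case (step2 i)
    obtain z where z: "z \<in> S" "g z = i" using run_index_onto[OF g] by blast
    show ?case
    proof (intro ballI impI)
      fix x assume "x \<in> S" "g x = i - 1"
      then show "g' x = i - 1 + (g' x0 - g x0)" using step2(2) step[of x z] z by simp
    qed
  qed
  then show ?thesis using that[of "g' x0 - g x0"] by simp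
qed

lemma run_index_add_const:
  assumes "run_index S k g" "\<And>x. x \<in> S \<Longrightarrow> g' x = g x + c"
  shows "run_index S k g'"
proof -
  have P: "pindex S k g" "periodic S" using assms(1) by (auto simp: run_index_def pindex_def)
  have "\<exists>x\<in>S. g' x = i" for i
  proof -
    obtain x where "x \<in> S" "g x = i - c" using run_index_onto[OF assms(1)] by blast
    then show ?thesis using assms(2) by force
  qed
  moreover have "x + 2 * pi \<in> S" if "x \<in> S" for x using P(2) that by (auto simp: periodic_def)
  ultimately show ?thesis
    using P assms(2) pindex_mono[OF P(1)] pindex_less[OF P(1)] P(1)[unfolded pindex_def]
    unfolding run_index_def pindex_def by (intro conjI ballI allI impI) simp_all
qed

text \<open>At equal levels \<open>g'\<close> would be an index of \<open>S\<close> up to a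
  constant, hence onto. Applied to the index of a larger support, this says that losing a whole run
  lowers the level.\<close>

lemma pindex_level_less:
  assumes g: "run_index S k g" and S': "pindex S' l g'" "S \<subseteq> S'" and i: "i \<notin> g' ` S"
  shows "k < l"
proof -
  have "k \<noteq> l"
  proof
    assume "k = l"
    have "periodic S" using g by (auto simp: run_index_def pindex_def)
    then have "pindex S k g'" using S' \<open>k = l\<close> unfolding pindex_def by blast
    then obtain c where c: "\<And>x. x \<in> S \<Longrightarrow> g' x = g x + c" using pindex_unique[OF g] by blast
    obtain x where "x \<in> S" "g' x = i" using run_index_onto[OF run_index_add_const[OF g c]] by blast
    then show False using i by blast
  qed
  then show ?thesis using pindex_level_le[OF g S'] by simp
qed

subsection \<open>Numbering the runs of a periodic set\<close>

lemma int_recursion_exists: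
  fixes d :: "int \<Rightarrow> int"
  obtains c where "c 0 = a" "\<And>j. c (j + 1) = c j + d j"
proof -
  define c where "c j = a + (if 0 \<le> j then \<Sum>i\<in>{0..<j}. d i else - (\<Sum>i\<in>{j..<0}. d i))" for j
  have "c (j + 1) = c j + d j" for j
  proof (cases "0 \<le> j")
    case True
    have "{0..<j + 1} = insert j {0..<j}" using True by auto
    then show ?thesis using True by (simp add: c_def)
  next
    case False
    have "{j..<0} = insert j {j + 1..<0}" using False by auto
    then show ?thesis using False by (auto simp add: c_def)
  qed
  moreover have "c 0 = a" by (simp add: c_def)
  ultimately show ?thesis using that by blast
qed

lemma int_intermediate_value:
  fixes c :: "int \<Rightarrow> int"
  assumes "\<And>j. \<bar>c (j + 1) - c j\<bar> \<le> 1" "i \<le> j" "c i \<le> v" "v \<le> c j"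
  shows "\<exists>l. c l = v"
proof -
  have "\<exists>m. 0 \<le> m \<and> m \<le> nat (j - i) \<and> c (i + int m) = v"
  proof (rule nat_intermed_int_val, intro allI impI)
    fix m :: nat
    have "i + int (Suc m) = (i + int m) + 1" by simp
    then show "\<bar>c (i + int (Suc m)) - c (i + int m)\<bar> \<le> 1"
      using assms(1)[of "i + int m"] by metis
  qed (use assms in auto)
  then show ?thesis by blast
qed

text \<open>One period is sorted into the list \<open>L\<close>; division with remainder by its
  length extends the enumeration to all integers.\<close>

lemma enumerate_periodic:
  assumes per: "\<And>x. x \<in> T \<Longrightarrow> x + a \<in> T \<and> x - a \<in> T" and fin: "finite (T \<inter> {0..<a})" and "T \<noteq> {}" and a: "a > 0"
  obtains t :: "int \<Rightarrow> real" and n :: int where "n > 0" "\<And>j. t j < t (j + 1)" "range t = T" "\<And>j. t (j + n) = t j + a"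
proof -
  have sh: "x + a * of_int m \<in> T" if "x \<in> T" for x m
  proof (induction m rule: int_induct[where k = 0])
    case (step1 i) then show ?case using per[OF step1(2)] by (simp add: algebra_simps)
  next
    case (step2 i) then show ?case using per[OF step2(2)] by (simp add: algebra_simps)
  qed (use that in simp)
  define L where "L = sorted_list_of_set (T \<inter> {0..<a})"
  define n where "n = int (length L)"
  have Lset: "set L = T \<inter> {0..<a}" using fin by (simp add: L_def)
  have red: "x - a * of_int \<lfloor>x / a\<rfloor> \<in> T \<inter> {0..<a}" if "x \<in> T" for x
  proof -
    have "x - a * of_int \<lfloor>x / a\<rfloor> \<in> T" using sh[OF that, of "- \<lfloor>x / a\<rfloor>"] by simp
    moreover have "of_int \<lfloor>x / a\<rfloor> \<le> x / a" "x / a < of_int \<lfloor>x / a\<rfloor> + 1" by linarith+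
    then have "of_int \<lfloor>x / a\<rfloor> * a \<le> x" "x < (of_int \<lfloor>x / a\<rfloor> + 1) * a"
      by (simp_all only: pos_le_divide_eq[OF a] pos_divide_less_eq[OF a])
    then have "a * of_int \<lfloor>x / a\<rfloor> \<le> x" "x < a * of_int \<lfloor>x / a\<rfloor> + a"
      by (simp_all add: algebra_simps)
    ultimately show ?thesis by simp
  qed
  have n: "n > 0" using red \<open>T \<noteq> {}\<close> Lset unfolding n_def by fastforce
  have nth: "L ! nat (j mod n) \<in> T \<inter> {0..<a}" for j
  proof -
    have "0 \<le> j mod n" "j mod n < n" using n by simp_all
    then show ?thesis using n_def Lset nth_mem[of "nat (j mod n)" L] by (simp add: nat_less_iff)
  qed
  define t where "t j = L ! nat (j mod n) + a * of_int (j div n)" for j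
  have "t j < t (j + 1)" for j
  proof (cases "j mod n + 1 < n")
    case True
    have "j + 1 = n * (j div n) + (j mod n + 1)" by simp
    then have "(j + 1) div n = j div n" "(j + 1) mod n = j mod n + 1"
      using True n int_div_pos_eq[of "j + 1" n "j div n" "j mod n + 1"]
        int_mod_pos_eq[of "j + 1" n "j div n" "j mod n + 1"] by simp_all
    moreover have "L ! nat (j mod n) < L ! nat (j mod n + 1)"
      using True n n_def sorted_wrt_nth_less[of "(<)" L "nat (j mod n)" "nat (j mod n + 1)"]
        strict_sorted_list_of_set[of "T \<inter> {0..<a}"]
      by (auto simp: L_def nat_less_iff)
    ultimately show ?thesis by (simp add: t_def)
  next
    case False
    then have e: "j mod n = n - 1" using pos_mod_bound[OF n, of j] by linarith
    have "j + 1 = n * (j div n + 1)" using e mult_div_mod_eq[of n j] unfolding distrib_left mult_1_right by linarith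
    then have "(j + 1) div n = j div n + 1" using n by simp
    moreover have "L ! nat (j mod n) < a" "0 \<le> L ! nat ((j + 1) mod n)" using nth by auto
    ultimately show ?thesis by (simp add: t_def algebra_simps)
  qed
  moreover have "t (j + n) = t j + a" for j
    using n by (simp add: t_def algebra_simps)
  moreover have "range t = T"
  proof
    show "range t \<subseteq> T" using nth sh by (auto simp: t_def)
    show "T \<subseteq> range t"
    proof
      fix x assume "x \<in> T"
      from red[OF this] obtain i where i: "i < length L" "L ! i = x - a * of_int \<lfloor>x / a\<rfloor>"
        unfolding Lset[symmetric] in_set_conv_nth by blast
      then have "t (int i + n * \<lfloor>x / a\<rfloor>) = x" using n by (simp add: t_def n_def)
      then show "x \<in> range t" by (metis rangeI)
    qed
  qed
  ultimately show ?thesis using that n by blast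
qed

text \<open>Colour the points of the \<open>pi\<close>-periodic set \<open>T\<close> by membership
  in \<open>S\<close> or in its half turn. A half turn, that is \<open>n\<close> steps of the
  enumeration, exchanges the colours, so the number of colour changes along it is odd; this number
  is \<open>2 * k + 1\<close>.\<close>

lemma run_index_exists:
  assumes per: "periodic S" and fin: "finite (S \<inter> {0..<2 * pi})" and ne: "S \<noteq> {}"
    and anti: "\<And>x y. x \<in> S \<Longrightarrow> y \<in> S \<Longrightarrow> x \<noteq> y + pi"
  obtains k g where "run_index S k g"
proof -
  define T where "T = S \<union> (\<lambda>x. x + pi) ` S"
  have perT: "x + pi \<in> T \<and> x - pi \<in> T" if "x \<in> T" for x
  proof -
    have p: "y - pi \<in> T" "y + pi \<in> T" if "y \<in> S" for y
    proof -
      have "y - pi = (y - 2 * pi) + pi" by simp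
      then show "y - pi \<in> T" "y + pi \<in> T" using that per unfolding T_def periodic_def by blast+
    qed
    from that consider "x \<in> S" | y where "y \<in> S" "x = y + pi" unfolding T_def by blast
    then show ?thesis
    proof cases
      case 2
      then have "y + 2 * pi \<in> S" using per by (auto simp: periodic_def)
      then have "x + pi \<in> S" using 2 by (simp add: algebra_simps)
      then show ?thesis using 2 by (simp add: T_def)
    qed (use p in simp)
  qed
  have "T \<inter> {0..<pi} \<subseteq> (S \<inter> {0..<2 * pi}) \<union> (\<lambda>x. x - pi) ` (S \<inter> {0..<2 * pi})"
  proof
    fix x assume x: "x \<in> T \<inter> {0..<pi}"
    then have "x \<in> S \<or> x - pi \<in> S" by (auto simp: T_def)
    then show "x \<in> (S \<inter> {0..<2 * pi}) \<union> (\<lambda>x. x - pi) ` (S \<inter> {0..<2 * pi})"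
    proof
      assume "x - pi \<in> S"
      then have "x - pi + 2 * pi \<in> S" using per by (auto simp: periodic_def)
      moreover have "x - pi + 2 * pi = x + pi" by simp
      ultimately have "x + pi \<in> S \<inter> {0..<2 * pi}" using x by (simp only: Int_iff atLeastLessThan_iff) simp
      then have "(x + pi) - pi \<in> (\<lambda>x. x - pi) ` (S \<inter> {0..<2 * pi})" by (rule imageI)
      then show ?thesis by simp
    qed (use x in auto)
  qed
  then have finT: "finite (T \<inter> {0..<pi})" using fin finite_subset by blast
  have neT: "T \<noteq> {}" using ne by (auto simp: T_def)
  obtain t :: "int \<Rightarrow> real" and n :: int where n: "n > 0" and t1: "\<And>j. t j < t (j + 1)" and tr: "range t = T"
    and tn: "\<And>j. t (j + n) = t j + pi"
    by (rule enumerate_periodic[OF perT finT neT pi_gt_zero]) (assumption, rule that)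
  have tmono: "t i < t j" if "i < j" for i j
    using that
  proof (induction j rule: int_gr_induct)
    case (step j)
    then show ?case using t1[of j] by linarith
  qed (rule t1)
  define isS where "isS j \<longleftrightarrow> t j \<in> S" for j
  have chin: "isS (j + n) \<longleftrightarrow> \<not> isS j" for j
  proof -
    have "t j \<in> T" using tr by blast
    moreover have "s + pi + pi \<in> S" if "s \<in> S" for s
      using per that by (auto simp: periodic_def add.assoc)
    ultimately show ?thesis using anti[of "t j + pi" "t j"] by (auto simp: isS_def tn T_def)
  qed
  \<comment> \<open>\<open>c\<close> counts colour changes. Starting at \<open>0\<close> or
    \<open>1\<close> according to the colour makes \<open>c\<close> even exactly on
    \<open>S\<close>.\<close>
  obtain c :: "int \<Rightarrow> int" where c0: "c 0 = (if isS 0 then 0 else 1)"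
    and c1: "\<And>j. c (j + 1) = c j + (if isS (j + 1) = isS j then 0 else 1)"
    using int_recursion_exists[of _ "\<lambda>j. if isS (j + 1) = isS j then 0 else 1"] by metis
  have cmono: "c i \<le> c j" if "i \<le> j" for i j
    using that by (induction j rule: int_ge_induct) (auto simp: c1)
  have par: "even (c j) \<longleftrightarrow> isS j" for j
  proof (induction j rule: int_induct[where k = 0])
    case (step2 i) then show ?case using c1[of "i - 1"] by (auto split: if_splits)
  qed (auto simp: c0 c1)
  have cn: "c (j + n) = c j + (c n - c 0)" for j
  proof (induction j rule: int_induct[where k = 0])
    case (step1 i)
    have "c (i + 1 + n) = c (i + n) + (if isS (i + 1) = isS i then 0 else 1)"
      using c1[of "i + n"] chin[of i] chin[of "i + 1"] by (simp add: ac_simps)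
    then show ?case using step1 c1[of i] by simp
  next
    case (step2 i)
    have "c (i - 1 + n + 1) = c (i - 1 + n) + (if isS i = isS (i - 1) then 0 else 1)"
      using c1[of "i - 1 + n"] chin[of i] chin[of "i - 1"] by (simp add: algebra_simps)
    then show ?case using step2 c1[of "i - 1"] by (simp add: algebra_simps)
  qed simp
  have "odd (c n - c 0)" using par[of n] par[of 0] chin[of 0] by simp
  moreover have "0 \<le> c n - c 0" using cmono[of 0 n] n by simp
  ultimately have k: "c n - c 0 = 2 * int (nat ((c n - c 0) div 2)) + 1"
    by (simp add: odd_two_times_div_two_succ)
  define k where "k = nat ((c n - c 0) div 2)"
  note k = k[folded k_def]
  have cnq: "c (j + n * q) = c j + q * (c n - c 0)" for j q
  proof (induction q rule: int_induct[where k = 0])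
    case (step1 i) then show ?case using cn[of "j + n * i"] by (simp add: algebra_simps)
  next
    case (step2 i) then show ?case using cn[of "j + n * (i - 1)"] by (simp add: algebra_simps)
  qed simp
  have onto: "\<exists>j. c j = v" for v
  proof (rule int_intermediate_value[of c])
    show "\<bar>c (j + 1) - c j\<bar> \<le> 1" for j by (simp add: c1)
    \<comment> \<open>Each half turn adds at least one to \<open>c\<close>, so \<open>Q\<close> of
      them in either direction reach beyond \<open>v\<close>.\<close>
    define Q where "Q = \<bar>v\<bar> + \<bar>c 0\<bar>"
    have q: "Q \<le> Q * (2 * int k + 1)" by (simp add: Q_def mult_le_cancel_left1)
    have "Q \<ge> 0" by (simp add: Q_def)
    then show "n * (- Q) \<le> n * Q" using n by simp
    have "c (n * (- Q)) = c 0 - Q * (2 * int k + 1)" "c (n * Q) = c 0 + Q * (2 * int k + 1)"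
      using cnq[of 0 "- Q"] cnq[of 0 Q] unfolding k by simp_all
    then show "c (n * (- Q)) \<le> v" "v \<le> c (n * Q)"
      using q unfolding Q_def by linarith+
  qed
  define ti where "ti x = (THE j. t j = x)" for x
  have "strict_mono t" using tmono by (auto simp: strict_mono_def)
  then have tle: "t i \<le> t j \<longleftrightarrow> i \<le> j" and tless: "t i < t j \<longleftrightarrow> i < j" and "inj t" for i j
    by (simp_all add: strict_mono_less_eq strict_mono_less strict_mono_imp_inj_on)
  then have ti: "ti (t j) = j" for j unfolding ti_def by (auto simp: inj_eq)
  \<comment> \<open>On \<open>S\<close> the count is even, and half of it numbers the runs of
    \<open>S\<close> alone.\<close>
  define g where "g x = c (ti x) div 2" for x
  have gS: "c j = 2 * g (t j)" if "t j \<in> S" for j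
    using par[of j] that by (simp add: g_def ti isS_def)
  have Sj: "\<exists>j. x = t j" if "x \<in> S" for x using that tr by (auto simp: T_def)
  have shift2: "t (j + n + n) = t j + 2 * pi" for j using tn[of j] tn[of "j + n"] by simp
  have "run_index S k g"
    unfolding run_index_def pindex_def
  proof (intro conjI ballI allI impI per)
    fix x assume x: "x \<in> S"
    then obtain j where j: "x = t j" using Sj by blast
    have "x + 2 * pi \<in> S" using per x by (auto simp: periodic_def)
    then have "2 * g (x + 2 * pi) = c (j + n + n)" using gS[of "j + n + n"] shift2[of j] j by simp
    then show "g (x + 2 * pi) = g x + (2 * int k + 1)"
      using cn[of j] cn[of "j + n"] gS[of j] x k unfolding j by simp
  next
    fix x y assume xy: "x \<in> S" "y \<in> S" "x \<le> y"
    then obtain i j where ij: "x = t i" "y = t j" using Sj by blast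
    then show "g x \<le> g y" using gS[of i] gS[of j] cmono[of i j] xy tle by simp
  next
    fix x w assume xw: "x \<in> S" "w \<in> S"
    then obtain i j where ij: "x = t i" "w = t j" using Sj by blast
    have c: "c i = 2 * g x" "c (j + n) = 2 * g w + 2 * int k + 1"
      using gS[of i] gS[of j] cn[of j] k xw ij by auto
    \<comment> \<open>\<open>c i\<close> is even and \<open>c (j + n)\<close> is odd; they never
      coincide, so the order of the positions can be read off from the counts.\<close>
    have "x < w + pi \<longleftrightarrow> i < j + n" using ij tn[of j] tless[of i "j + n"] by simp
    moreover have "i < j + n \<Longrightarrow> c i \<le> c (j + n)" "\<not> i < j + n \<Longrightarrow> c (j + n) \<le> c i"
      using cmono by auto
    ultimately show "(x < w + pi) = (g x \<le> g w + int k)" using c by auto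
  next
    fix i
    obtain j where j: "c j = 2 * i" using onto by blast
    then have "t j \<in> S" using par[of j] by (simp add: isS_def)
    then show "\<exists>x\<in>S. g x = i" using gS[of j] j by auto
  qed
  then show ?thesis using that by blast
qed

section \<open>Equivariant monotone maps of lifted supports\<close>

definition step :: "nat \<Rightarrow> real" where
  "step k = 2 * pi / (2 * real k + 1)"

text \<open>On lifts of subsets of the circle, \<open>spread r\<close> says that the diameter is at most \<open>r\<close>; it also excludes
  antipodal pairs because \<open>r < pi\<close>.\<close>

definition spread :: "real \<Rightarrow> real set \<Rightarrow> bool" where
  "spread r S \<longleftrightarrow> periodic S \<and> (\<forall>x\<in>S. \<forall>y\<in>S. x \<le> y + pi \<longrightarrow> x \<le> y + r)"

text \<open>All conditions are linear in \<open>h\<close>, so they pass to convex combinations. The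
  last one keeps the image at diameter \<open>r\<close> and at the same time prevents a point from
  crossing an antipode.\<close>

definition short_map :: "real \<Rightarrow> real set \<Rightarrow> (real \<Rightarrow> real) \<Rightarrow> bool" where
  "short_map r S h \<longleftrightarrow> (\<forall>x\<in>S. h (x + 2 * pi) = h x + 2 * pi) \<and>
     (\<forall>x\<in>S. \<forall>y\<in>S. x \<le> y \<longrightarrow> h x \<le> h y) \<and>
     (\<forall>x\<in>S. \<forall>y\<in>S. x \<le> y + pi \<longrightarrow> h x \<le> h y + r)"

lemma step_pos: "step k > 0" by (simp add: step_def)

lemma step_turn: "step k * (2 * real k + 1) = 2 * pi"
proof -
  have "2 * real k + 1 \<noteq> 0" by linarith
  then show ?thesis by (simp add: step_def)
qed

lemma spreadD:
  assumes "spread r S"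
  shows spread_periodic: "periodic S"
    and spread_le: "\<And>x y. x \<in> S \<Longrightarrow> y \<in> S \<Longrightarrow> x \<le> y + pi \<Longrightarrow> x \<le> y + r"
  using assms by (auto simp: spread_def)

lemma spread_ge:
  assumes "spread r S" "x \<in> S" "y \<in> S" "y + pi \<le> x"
  shows "y + 2 * pi - r \<le> x"
proof -
  have "y + 2 * pi \<in> S" using spread_periodic[OF assms(1)] assms(3) by (auto simp: periodic_def)
  then show ?thesis using spread_le[OF assms(1), of "y + 2 * pi" x] assms by simp
qed

lemma spread_not_antipodal:
  assumes "spread r S" "r < pi" "x \<in> S" "y \<in> S" shows "x \<noteq> y + pi"
  using spread_le[OF assms(1,3,4)] assms(2) by auto

lemma periodic_image:
  assumes "periodic S" "\<And>x. x \<in> S \<Longrightarrow> h (x + 2 * pi) = h x + 2 * pi"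
  shows "periodic (h ` S)"
  unfolding periodic_def
proof
  fix y assume "y \<in> h ` S"
  then obtain x where x: "x \<in> S" "y = h x" by blast
  have *: "x + 2 * pi \<in> S" "x - 2 * pi \<in> S" using assms(1) x by (auto simp: periodic_def)
  have "y + 2 * pi = h (x + 2 * pi)" using assms(2)[OF x(1)] x by simp
  moreover have "y - 2 * pi = h (x - 2 * pi)" using assms(2)[OF *(2)] x by simp
  ultimately show "y + 2 * pi \<in> h ` S \<and> y - 2 * pi \<in> h ` S" using * by auto
qed

lemma short_mapD:
  assumes "short_map r S h"
  shows short_map_turn: "\<And>x. x \<in> S \<Longrightarrow> h (x + 2 * pi) = h x + 2 * pi"
    and short_map_mono: "\<And>x y. x \<in> S \<Longrightarrow> y \<in> S \<Longrightarrow> x \<le> y \<Longrightarrow> h x \<le> h y"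
    and short_map_le: "\<And>x y. x \<in> S \<Longrightarrow> y \<in> S \<Longrightarrow> x \<le> y + pi \<Longrightarrow> h x \<le> h y + r"
  using assms by (auto simp: short_map_def)

text \<open>For the direction from left to right: if \<open>x\<close> lies beyond
  \<open>y + pi\<close>, then \<open>y + 2 * pi\<close> lies before \<open>x + pi\<close>, and the
  bound on this pair puts \<open>h x\<close> beyond \<open>h y + pi\<close>.\<close>

lemma short_map_le_iff:
  assumes h: "short_map r S h" and S: "periodic S" and r: "r < pi" and xy: "x \<in> S" "y \<in> S"
  shows "h x \<le> h y + pi \<longleftrightarrow> x \<le> y + pi"
proof
  assume le: "h x \<le> h y + pi"
  show "x \<le> y + pi"
  proof (rule ccontr)
    assume "\<not> x \<le> y + pi"
    moreover have "y + 2 * pi \<in> S" using S xy by (auto simp: periodic_def)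
    ultimately have "h (y + 2 * pi) \<le> h x + r" using short_map_le[OF h, of "y + 2 * pi" x] xy by simp
    then show False using short_map_turn[OF h xy(2)] le r by simp
  qed
qed (use short_map_le[OF h xy] r in auto)

lemma short_map_image_spread:
  assumes "short_map r S h" "periodic S" "r < pi"
  shows "spread r (h ` S)"
proof -
  have "periodic (h ` S)" using assms(2) short_map_turn[OF assms(1)] by (rule periodic_image)
  then show ?thesis
    unfolding spread_def using short_map_le_iff[OF assms] short_map_le[OF assms(1)] by auto
qed

lemma short_map_translate: "spread r S \<Longrightarrow> short_map r S (\<lambda>x. x + c)"
  by (auto simp: short_map_def spread_def)

lemma short_map_convex:
  assumes f: "short_map r S f" and h: "short_map r S h" and t: "0 \<le> t" "t \<le> 1"
  shows "short_map r S (\<lambda>x. (1 - t) * f x + t * h x)"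
  unfolding short_map_def
proof (intro conjI ballI impI)
  fix x assume x: "x \<in> S"
  show "(1 - t) * f (x + 2 * pi) + t * h (x + 2 * pi) = (1 - t) * f x + t * h x + 2 * pi"
    using short_map_turn[OF f x] short_map_turn[OF h x] by (simp add: algebra_simps)
next
  fix x y assume xy: "x \<in> S" "y \<in> S" "x \<le> y"
  show "(1 - t) * f x + t * h x \<le> (1 - t) * f y + t * h y"
    using short_map_mono[OF f xy] short_map_mono[OF h xy] t by (intro add_mono mult_left_mono) auto
next
  fix x y assume xy: "x \<in> S" "y \<in> S" "x \<le> y + pi"
  have "(1 - t) * f x + t * h x \<le> (1 - t) * (f y + r) + t * (h y + r)"
    using short_map_le[OF f xy] short_map_le[OF h xy] t by (intro add_mono mult_left_mono) auto
  then show "(1 - t) * f x + t * h x \<le> (1 - t) * f y + t * h y + r" by (simp add: algebra_simps)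
qed

lemma short_map_subset: "short_map r S h \<Longrightarrow> T \<subseteq> S \<Longrightarrow> short_map r T h"
  unfolding short_map_def by blast

text \<open>A point at most a half turn ahead is at most \<open>k\<close> runs ahead, so the last
  condition comes down to \<open>step k * real k \<le> r\<close>.\<close>

lemma short_map_step:
  assumes g: "pindex S k g" and S: "spread r S" and r: "r < pi" and k: "step k * real k \<le> r"
  shows "short_map r S (\<lambda>x. step k * of_int (g x) + c)"
  unfolding short_map_def
proof (intro conjI ballI impI)
  fix x assume "x \<in> S"
  then have "g (x + 2 * pi) = g x + (2 * int k + 1)" using g by (auto simp: pindex_def)
  then show "step k * of_int (g (x + 2 * pi)) + c = step k * of_int (g x) + c + 2 * pi"
    using step_turn[of k] by (simp add: algebra_simps)
next
  fix x y assume "x \<in> S" "y \<in> S" "x \<le> y"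
  from pindex_mono[OF g this] show "step k * of_int (g x) + c \<le> step k * of_int (g y) + c"
    using step_pos[of k] by simp
next
  fix x y assume xy: "x \<in> S" "y \<in> S" "x \<le> y + pi"
  then have "x < y + pi" using spread_not_antipodal[OF S r xy(1,2)] by linarith
  then have "g x \<le> g y + int k" using pindex_less[OF g xy(1,2)] by simp
  then have "real_of_int (g x) \<le> real_of_int (g y) + real k" by linarith
  then have "step k * real_of_int (g x) \<le> step k * (real_of_int (g y) + real k)"
    using step_pos[of k] by (intro mult_left_mono) auto
  then show "step k * of_int (g x) + c \<le> step k * of_int (g y) + c + r" using k by (simp add: algebra_simps)
qed

text \<open>A hop of \<open>k\<close> runs stays within a half turn and hence covers at most
  \<open>r\<close>. After \<open>2 * k + 1\<close> hops the index has grown by \<open>k\<close> full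
  turns, which gives \<open>2 * pi * k \<le> (2 * k + 1) * r\<close>.\<close>

lemma level_bound:
  assumes g: "run_index S k g" and S: "spread r S"
  shows "step k * real k \<le> r"
proof -
  have P: "pindex S k g" using g by (rule run_index_pindex)
  obtain x where x: "x \<in> S" using run_index_onto[OF g] by blast
  \<comment> \<open>\<open>y\<close> is an arbitrary point of its run, hence \<open>j > 0\<close>: a
    point in the run of \<open>x\<close> itself may lie beyond \<open>x\<close>.\<close>
  have "y \<le> x + real j * r" if "y \<in> S" "g y = g x + int j * int k" "j > 0" for j y
    using that
  proof (induction j arbitrary: y)
    case (Suc j)
    show ?case
    proof (cases "j = 0")
      case True
      then have "y < x + pi" using pindex_less[OF P Suc.prems(1) x] Suc.prems by simp
      then show ?thesis using spread_le[OF S Suc.prems(1) x] True by simp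
    next
      case False
      obtain z where z: "z \<in> S" "g z = g x + int j * int k" using run_index_onto[OF g] by blast
      then have "y < z + pi" using pindex_less[OF P Suc.prems(1) z(1)] Suc.prems by (simp add: algebra_simps)
      then have "y \<le> z + r" using spread_le[OF S Suc.prems(1) z(1)] by simp
      then show ?thesis using Suc.IH[OF z] False by (simp add: algebra_simps)
    qed
  qed simp
  from this[of "x + 2 * pi * of_int (int k)" "2 * k + 1"]
  have "2 * pi * real k \<le> real (2 * k + 1) * r"
    using periodic_shift[OF pindex_periodic[OF P] x, of "int k"] pindex_shift[OF P x, of "int k"]
    by (simp add: algebra_simps)
  then show ?thesis by (simp add: step_def field_simps)
qed

text \<open>A change of run between two points is marked by an antipode \<open>w + pi\<close>
  between them, and \<open>h\<close> moves no point across an antipode. So \<open>g\<close> is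
  constant on the fibres of \<open>h\<close> and monotone along the image.\<close>

lemma run_index_image:
  assumes g: "run_index S l g" and S: "spread r S" and r: "r < pi" and h: "short_map r S h"
  obtains g' where "run_index (h ` S) l g'" "\<And>x. x \<in> S \<Longrightarrow> g' (h x) = g x"
proof -
  have P: "pindex S l g" using g by (rule run_index_pindex)
  have per: "periodic S" using S by (rule spread_periodic)
  have lt: "h x < h y + pi \<longleftrightarrow> x < y + pi" if "x \<in> S" "y \<in> S" for x y
    using short_map_le_iff[OF h per r that] spread_not_antipodal[OF S r that]
      spread_not_antipodal[OF short_map_image_spread[OF h per r] r imageI[OF that(1)] imageI[OF that(2)]]
    by linarith
  have nlt: "\<not> g x < g y" if xy: "x \<in> S" "y \<in> S" "h y \<le> h x" for x y
  proof
    assume "g x < g y"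
    from run_index_separated[OF g xy(2) this xy(1)]
    obtain w where w: "w \<in> S" "x < w + pi" "w + pi \<le> y" .
    then show False using lt[OF xy(1) w(1)] lt[OF xy(2) w(1)] xy(3) by linarith
  qed
  define g' where "g' z = g (SOME x. x \<in> S \<and> h x = z)" for z
  have g': "g' (h x) = g x" if "x \<in> S" for x
  proof -
    have "\<exists>y. y \<in> S \<and> h y = h x" using that by blast
    then have "(SOME y. y \<in> S \<and> h y = h x) \<in> S \<and> h (SOME y. y \<in> S \<and> h y = h x) = h x"
      by (rule someI_ex)
    then show ?thesis using nlt[OF that, of "SOME y. y \<in> S \<and> h y = h x"] nlt[of "SOME y. y \<in> S \<and> h y = h x" x] that
      unfolding g'_def by force
  qed
  have "run_index (h ` S) l g'"
    unfolding run_index_def pindex_def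
  proof (intro conjI allI)
    show "periodic (h ` S)" using per short_map_turn[OF h] by (rule periodic_image)
    show "\<forall>z\<in>h ` S. g' (z + 2 * pi) = g' z + (2 * int l + 1)"
    proof
      fix z assume "z \<in> h ` S"
      then obtain x where x: "x \<in> S" "z = h x" by blast
      have "x + 2 * pi \<in> S" "g (x + 2 * pi) = g x + (2 * int l + 1)" using x P per by (auto simp: pindex_def periodic_def)
      then show "g' (z + 2 * pi) = g' z + (2 * int l + 1)"
        using x g'[of x] g'[of "x + 2 * pi"] short_map_turn[OF h x(1)] by simp
    qed
    show "\<forall>z\<in>h ` S. \<forall>z'\<in>h ` S. z \<le> z' \<longrightarrow> g' z \<le> g' z'"
    proof (intro ballI impI)
      fix z z' assume z: "z \<in> h ` S" "z' \<in> h ` S" "z \<le> z'"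
      then obtain x y where xy: "x \<in> S" "z = h x" "y \<in> S" "z' = h y" by blast
      then show "g' z \<le> g' z'" using nlt[OF xy(3,1)] z(3) g' by force
    qed
    show "\<forall>z\<in>h ` S. \<forall>z'\<in>h ` S. (z < z' + pi) = (g' z \<le> g' z' + int l)"
      using lt pindex_less[OF P] g' by auto
    fix i
    obtain x where "x \<in> S" "g x = i" using run_index_onto[OF g] by blast
    then show "\<exists>z\<in>h ` S. g' z = i" using g' by force
  qed
  then show ?thesis using that g' by blast
qed

subsection \<open>Lifts of subsets of the circle\<close>

definition lifts :: "complex set \<Rightarrow> real set" where
  "lifts \<Theta> = {x. cis x \<in> \<Theta>}"

lemma cis_eq_iff: "cis x = cis y \<longleftrightarrow> (\<exists>n::int. x = y + 2 * pi * of_int n)"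
proof -
  have "cis x = cis y \<longleftrightarrow> sin x = sin y \<and> cos x = cos y" by (auto simp: complex_eq_iff)
  also have "\<dots> \<longleftrightarrow> (\<exists>n::int. x = y + 2 * pi * of_int n)"
    unfolding sin_cos_eq_iff by (auto elim!: Ints_cases)
  finally show ?thesis .
qed

lemma cis_shift [simp]: "cis (x + 2 * pi * of_int n) = cis x"
  using cis_eq_iff by blast

lemma cis_turn [simp]: "cis (x + 2 * pi) = cis x" "cis (x - 2 * pi) = cis x"
  using cis_shift[of x 1] cis_shift[of x "-1"] by simp_all

lemma periodic_lifts: "periodic (lifts \<Theta>)"
  by (simp add: periodic_def lifts_def)

lemma cis_Arg_circle: "p \<in> circle \<Longrightarrow> cis (Arg p) = p"
  using rcis_cmod_Arg[of p] by (simp add: rcis_def)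

lemma Arg_lifts: "p \<in> circle \<Longrightarrow> Arg p \<in> lifts \<Theta> \<longleftrightarrow> p \<in> \<Theta>"
  by (simp add: lifts_def cis_Arg_circle)

lemma lifts_mono: "\<Theta>' \<subseteq> \<Theta> \<Longrightarrow> lifts \<Theta>' \<subseteq> lifts \<Theta>"
  by (auto simp: lifts_def)

lemma two_pi_le_abs: "n \<noteq> 0 \<Longrightarrow> 2 * pi \<le> \<bar>2 * pi * real_of_int n\<bar>"
  by (simp add: abs_mult)

lemma inj_on_cis: "inj_on cis {a..<a + 2 * pi}"
proof (rule inj_onI)
  fix x y assume xy: "x \<in> {a..<a + 2 * pi}" "y \<in> {a..<a + 2 * pi}" "cis x = cis y"
  then obtain n :: int where n: "x = y + 2 * pi * of_int n" using cis_eq_iff by blast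
  have "n = 0"
  proof (rule ccontr)
    assume "n \<noteq> 0"
    from two_pi_le_abs[OF this] show False using n xy by (auto simp: abs_if split: if_splits)
  qed
  then show "x = y" using n by simp
qed

lemma finite_lifts: "finite \<Theta> \<Longrightarrow> finite (lifts \<Theta> \<inter> {a..<a + 2 * pi})"
  using finite_vimage_IntI[OF _ inj_on_cis, of \<Theta> a] by (simp add: lifts_def vimage_def)

lemma ex_lift:
  assumes "p \<in> circle"
  obtains y where "cis y = p" "\<bar>x - y\<bar> \<le> pi"
proof -
  let ?n = "\<lfloor>(x - Arg p + pi) / (2 * pi)\<rfloor>"
  have "of_int ?n \<le> (x - Arg p + pi) / (2 * pi)" "(x - Arg p + pi) / (2 * pi) < of_int ?n + 1" by linarith+
  then have "of_int ?n * (2 * pi) \<le> x - Arg p + pi" "x - Arg p + pi < (of_int ?n + 1) * (2 * pi)"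
    by (simp_all only: pos_le_divide_eq[OF mult_pos_pos[OF zero_less_numeral pi_gt_zero]]
      pos_divide_less_eq[OF mult_pos_pos[OF zero_less_numeral pi_gt_zero]])
  then have "\<bar>x - (Arg p + 2 * pi * of_int ?n)\<bar> \<le> pi" by (simp add: algebra_simps abs_le_iff)
  then show ?thesis using that[of "Arg p + 2 * pi * of_int ?n"] cis_Arg_circle[OF assms] by simp
qed

lemma dist_circle_eqI:
  assumes "\<bar>a - b\<bar> \<le> pi"
  shows "dist_circle (cis a) (cis b) = \<bar>a - b\<bar>"
proof (rule antisym)
  show "dist_circle (cis a) (cis b) \<le> \<bar>a - b\<bar>" by (rule dist_circle_le) auto
  show "\<bar>a - b\<bar> \<le> dist_circle (cis a) (cis b)"
  proof (rule dist_circle_greatest)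
    fix a' b' assume "cis a' = cis a" "cis b' = cis b"
    then obtain n m :: int where nm: "a' = a + 2 * pi * of_int n" "b' = b + 2 * pi * of_int m"
      using cis_eq_iff by blast
    have e: "a' - b' = (a - b) + 2 * pi * of_int (n - m)" unfolding nm by (simp add: algebra_simps)
    show "\<bar>a - b\<bar> \<le> \<bar>a' - b'\<bar>"
    proof (cases "n = m")
      case False
      then have "2 * pi \<le> \<bar>2 * pi * real_of_int (n - m)\<bar>" using two_pi_le_abs[of "n - m"] by simp
      then show ?thesis using e assms by linarith
    qed (use e in simp)
  qed auto
qed

lemma dist_circle_le_pi:
  assumes "p \<in> circle" "q \<in> circle" shows "dist_circle p q \<le> pi"
proof -
  obtain y where "cis y = q" "\<bar>Arg p - y\<bar> \<le> pi" using ex_lift[OF assms(2)] .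
  then show ?thesis using dist_circle_eqI[of "Arg p" y] cis_Arg_circle[OF assms(1)] by simp
qed

lemma dist_circle_gt_iff:
  "dist_circle (cis a) (cis b) > r \<longleftrightarrow>
     (\<exists>n::int. b + 2 * pi * of_int n + r < a \<and> a < b + 2 * pi * of_int n + 2 * pi - r)"
proof
  assume gt: "dist_circle (cis a) (cis b) > r"
  let ?n = "\<lfloor>(a - b) / (2 * pi)\<rfloor>"
  have "of_int ?n \<le> (a - b) / (2 * pi)" "(a - b) / (2 * pi) < of_int ?n + 1" by linarith+
  then have "of_int ?n * (2 * pi) \<le> a - b" "a - b < (of_int ?n + 1) * (2 * pi)"
    by (simp_all only: pos_le_divide_eq[OF mult_pos_pos[OF zero_less_numeral pi_gt_zero]]
      pos_divide_less_eq[OF mult_pos_pos[OF zero_less_numeral pi_gt_zero]])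
  then have n: "b + 2 * pi * of_int ?n \<le> a" "a \<le> b + 2 * pi * of_int ?n + 2 * pi"
    by (simp_all add: algebra_simps)
  have "cis (b + 2 * pi * of_int ?n) = cis b" "cis (b + 2 * pi * of_int ?n + 2 * pi) = cis b" by simp_all
  then have "r < \<bar>a - (b + 2 * pi * of_int ?n)\<bar>" "r < \<bar>a - (b + 2 * pi * of_int ?n + 2 * pi)\<bar>"
    using gt dist_circle_le[of a "cis a" _ "cis b"] by (metis less_le_trans)+
  then show "\<exists>n::int. b + 2 * pi * of_int n + r < a \<and> a < b + 2 * pi * of_int n + 2 * pi - r"
    using n by (intro exI[of _ ?n]) linarith
next
  assume "\<exists>n::int. b + 2 * pi * of_int n + r < a \<and> a < b + 2 * pi * of_int n + 2 * pi - r"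
  then obtain n :: int where n: "b + 2 * pi * of_int n + r < a" "a < b + 2 * pi * of_int n + 2 * pi - r" by blast
  let ?b = "b + 2 * pi * of_int n"
  show "dist_circle (cis a) (cis b) > r"
  proof (cases "a - ?b \<le> pi")
    case True
    \<comment> \<open>A negative \<open>r\<close> extends the window to points before
      \<open>?b\<close>; there nonnegativity of the distance is enough.\<close>
    then have "\<bar>a - ?b\<bar> \<le> pi \<or> r < 0 \<and> a < ?b" using n by linarith
    moreover have "0 \<le> dist_circle (cis a) (cis b)" by (rule dist_circle_nonneg) auto
    ultimately show ?thesis using dist_circle_eqI[of a ?b] n by auto
  next
    case False
    then have "\<bar>a - (?b + 2 * pi)\<bar> \<le> pi \<or> r < 0 \<and> a > ?b + 2 * pi" using n by linarith
    moreover have "0 \<le> dist_circle (cis a) (cis b)" by (rule dist_circle_nonneg) auto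
    ultimately show ?thesis using dist_circle_eqI[of a "?b + 2 * pi"] n by auto
  qed
qed

lemma diam_circle_le_iff:
  assumes "finite \<Theta>" "\<Theta> \<noteq> {}"
  shows "diam_circle \<Theta> \<le> r \<longleftrightarrow> (\<forall>p\<in>\<Theta>. \<forall>q\<in>\<Theta>. dist_circle p q \<le> r)"
proof -
  have eq: "{dist_circle p q | p q. p \<in> \<Theta> \<and> q \<in> \<Theta>} = (\<lambda>(p, q). dist_circle p q) ` (\<Theta> \<times> \<Theta>)" by auto
  have "finite ((\<lambda>(p, q). dist_circle p q) ` (\<Theta> \<times> \<Theta>))" "(\<lambda>(p, q). dist_circle p q) ` (\<Theta> \<times> \<Theta>) \<noteq> {}"
    using assms by auto
  then show ?thesis unfolding diam_circle_def eq by (subst cSup_le_iff) (auto intro: bdd_above_finite)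
qed

lemma spread_lifts_iff:
  assumes r: "0 \<le> r" "r < pi" and T: "\<Theta> \<subseteq> circle"
  shows "spread r (lifts \<Theta>) \<longleftrightarrow> (\<forall>p\<in>\<Theta>. \<forall>q\<in>\<Theta>. dist_circle p q \<le> r)"
proof
  assume s: "spread r (lifts \<Theta>)"
  show "\<forall>p\<in>\<Theta>. \<forall>q\<in>\<Theta>. dist_circle p q \<le> r"
  proof (intro ballI)
    fix p q assume pq: "p \<in> \<Theta>" "q \<in> \<Theta>"
    then have "q \<in> circle" "p \<in> circle" using T by auto
    then obtain y where y: "cis y = q" "\<bar>Arg p - y\<bar> \<le> pi" "cis (Arg p) = p" using ex_lift cis_Arg_circle by metis
    have "y \<in> lifts \<Theta>" "Arg p \<in> lifts \<Theta>" using y pq by (auto simp: lifts_def)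
    then have "\<bar>Arg p - y\<bar> \<le> r"
      using spread_le[OF s, of y "Arg p"] spread_le[OF s, of "Arg p" y] y(2) by linarith
    then show "dist_circle p q \<le> r" using dist_circle_le[OF y(3,1)] by linarith
  qed
next
  assume d: "\<forall>p\<in>\<Theta>. \<forall>q\<in>\<Theta>. dist_circle p q \<le> r"
  show "spread r (lifts \<Theta>)"
    unfolding spread_def
  proof (intro conjI ballI impI periodic_lifts)
    fix x y assume xy: "x \<in> lifts \<Theta>" "y \<in> lifts \<Theta>" "x \<le> y + pi"
    then have "dist_circle (cis x) (cis y) \<le> r" using d by (auto simp: lifts_def)
    then have "\<not> (y + 2 * pi * of_int 0 + r < x \<and> x < y + 2 * pi * of_int 0 + 2 * pi - r)"
      using dist_circle_gt_iff[of r x y] by (meson not_le)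
    then show "x \<le> y + r" using xy(3) r by simp
  qed
qed

lemma VR_iff:
  assumes r: "0 \<le> r" "r < pi"
  shows "\<mu> \<in> VR r \<longleftrightarrow> \<mu> \<in> Pfin \<and> spread r (lifts (set_pmf \<mu>))"
proof (cases "\<mu> \<in> Pfin")
  case True
  then have "finite (set_pmf \<mu>)" "set_pmf \<mu> \<subseteq> circle" using Pfin_D by auto
  then show ?thesis
    using True spread_lifts_iff[OF r] diam_circle_le_iff[of "set_pmf \<mu>" r] set_pmf_not_empty[of \<mu>]
    by (auto simp: VR_def)
qed (simp add: VR_def)

lemma run_index_lifts_exists:
  assumes "spread r (lifts \<Theta>)" "r < pi" "finite \<Theta>" "\<Theta> \<noteq> {}" "\<Theta> \<subseteq> circle"
  obtains k g where "run_index (lifts \<Theta>) k g"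
proof (rule run_index_exists[of "lifts \<Theta>"])
  show "finite (lifts \<Theta> \<inter> {0..<2 * pi})" using finite_lifts[OF assms(3), of 0] by simp
  obtain p where "p \<in> \<Theta>" using assms(4) by blast
  then have "Arg p \<in> lifts \<Theta>" using Arg_lifts assms(5) by blast
  then show "lifts \<Theta> \<noteq> {}" by blast
qed (use spread_not_antipodal[OF assms(1,2)] periodic_lifts that in auto)

section \<open>Densities and expectations for finitely supported measures\<close>

lemma pmf_embed_finite:
  assumes "finite A" "\<And>x. x \<notin> A \<Longrightarrow> f x = 0" "\<And>x. 0 \<le> f x" "(\<Sum>x\<in>A. f x) = 1"
  shows "pmf (embed_pmf f) x = f x"
proof (rule pmf_embed_pmf)
  have "(\<integral>\<^sup>+x. ennreal (f x) \<partial>count_space UNIV) = (\<Sum>x\<in>A. ennreal (f x))"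
    using assms by (intro nn_integral_count_space') auto
  also have "\<dots> = 1" using assms by (simp add: sum_ennreal)
  finally show "(\<integral>\<^sup>+x. ennreal (f x) \<partial>count_space UNIV) = 1" .
qed (use assms in auto)

lemma expectation_finite:
  fixes f :: "'a \<Rightarrow> real"
  assumes "finite (set_pmf \<mu>)"
  shows "measure_pmf.expectation \<mu> f = (\<Sum>p\<in>set_pmf \<mu>. pmf \<mu> p * f p)"
  using integral_measure_pmf_real[of "set_pmf \<mu>" \<mu> f] assms by (simp add: mult.commute)

lemma pmf_map_finite:
  assumes "finite (set_pmf \<mu>)"
  shows "pmf (map_pmf c \<mu>) z = (\<Sum>p\<in>{p \<in> set_pmf \<mu>. c p = z}. pmf \<mu> p)"
proof -
  have "pmf (map_pmf c \<mu>) z = measure_pmf.prob \<mu> ((c -` {z}) \<inter> set_pmf \<mu>)"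
    by (simp add: pmf_map measure_Int_set_pmf)
  also have "(c -` {z}) \<inter> set_pmf \<mu> = {p \<in> set_pmf \<mu>. c p = z}" by auto
  finally show ?thesis using assms by (simp add: measure_measure_pmf_finite)
qed

definition reweight :: "'a pmf \<Rightarrow> ('a \<Rightarrow> real) \<Rightarrow> 'a pmf" where
  "reweight \<mu> w = embed_pmf (\<lambda>p. pmf \<mu> p * w p)"

definition density :: "'a pmf \<Rightarrow> ('a \<Rightarrow> real) \<Rightarrow> bool" where
  "density \<mu> w \<longleftrightarrow> finite (set_pmf \<mu>) \<and> (\<forall>p\<in>set_pmf \<mu>. 0 \<le> w p) \<and> (\<Sum>p\<in>set_pmf \<mu>. pmf \<mu> p * w p) = 1"

lemma pmf_reweight:
  assumes "density \<mu> w" shows "pmf (reweight \<mu> w) p = pmf \<mu> p * w p"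
  unfolding reweight_def
proof (rule pmf_embed_finite[of "set_pmf \<mu>"])
  show "0 \<le> pmf \<mu> x * w x" for x
    using assms by (cases "x \<in> set_pmf \<mu>") (auto simp: density_def set_pmf_iff)
qed (use assms in \<open>auto simp: density_def set_pmf_iff\<close>)

lemma set_reweight:
  assumes "density \<mu> w" shows "set_pmf (reweight \<mu> w) = {p \<in> set_pmf \<mu>. w p \<noteq> 0}"
  by (auto simp: set_pmf_iff pmf_reweight[OF assms])

lemma expectation_reweight:
  fixes f :: "'a \<Rightarrow> real"
  assumes "density \<mu> w"
  shows "measure_pmf.expectation (reweight \<mu> w) f = (\<Sum>p\<in>set_pmf \<mu>. pmf \<mu> p * w p * f p)"
proof -
  have fin: "finite (set_pmf \<mu>)" using assms by (simp add: density_def)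
  then have "finite (set_pmf (reweight \<mu> w))" by (simp add: set_reweight[OF assms])
  then have "measure_pmf.expectation (reweight \<mu> w) f = (\<Sum>p\<in>set_pmf (reweight \<mu> w). pmf \<mu> p * w p * f p)"
    by (simp add: expectation_finite pmf_reweight[OF assms])
  also have "\<dots> = (\<Sum>p\<in>set_pmf \<mu>. pmf \<mu> p * w p * f p)"
    using fin by (intro sum.mono_neutral_left) (auto simp: set_reweight[OF assms])
  finally show ?thesis .
qed

lemma density_map:
  assumes "finite (set_pmf \<mu>)"
  shows "density \<mu> (\<lambda>p. w (c p)) \<longleftrightarrow> density (map_pmf c \<mu>) w"
proof -
  have "(\<Sum>z\<in>c ` set_pmf \<mu>. pmf (map_pmf c \<mu>) z * w z)
      = (\<Sum>z\<in>c ` set_pmf \<mu>. \<Sum>p\<in>{p \<in> set_pmf \<mu>. c p = z}. pmf \<mu> p * w (c p))"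
    by (simp add: pmf_map_finite[OF assms] sum_distrib_right)
  also have "\<dots> = (\<Sum>p\<in>set_pmf \<mu>. pmf \<mu> p * w (c p))"
    using assms by (intro sum.group) auto
  finally show ?thesis using assms by (auto simp: density_def)
qed

lemma map_reweight:
  assumes "density (map_pmf c \<mu>) w" "finite (set_pmf \<mu>)"
  shows "map_pmf c (reweight \<mu> (\<lambda>p. w (c p))) = reweight (map_pmf c \<mu>) w"
proof (rule pmf_eqI)
  fix z
  have d: "density \<mu> (\<lambda>p. w (c p))" using density_map assms by blast
  have "finite (set_pmf (reweight \<mu> (\<lambda>p. w (c p))))" using assms by (simp add: set_reweight[OF d])
  then have "pmf (map_pmf c (reweight \<mu> (\<lambda>p. w (c p)))) z
      = (\<Sum>p\<in>{p \<in> set_pmf \<mu>. w (c p) \<noteq> 0 \<and> c p = z}. pmf \<mu> p * w (c p))"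
    by (simp add: pmf_map_finite pmf_reweight[OF d] set_reweight[OF d] conj_assoc)
  also have "\<dots> = (\<Sum>p\<in>{p \<in> set_pmf \<mu>. c p = z}. pmf \<mu> p * w (c p))"
    using assms(2) by (intro sum.mono_neutral_left) auto
  also have "\<dots> = (\<Sum>p\<in>{p \<in> set_pmf \<mu>. c p = z}. pmf \<mu> p) * w z"
    by (simp add: sum_distrib_right)
  finally show "pmf (map_pmf c (reweight \<mu> (\<lambda>p. w (c p)))) z = pmf (reweight (map_pmf c \<mu>) w) z"
    by (simp add: pmf_reweight[OF assms(1)] pmf_map_finite[OF assms(2)])
qed

subsection \<open>Estimating the Wasserstein distance\<close>

lemma transport_planD:
  assumes "transport_plan \<mu> \<nu> \<kappa>"
  shows "\<And>p q. p \<in> set_pmf \<mu> \<Longrightarrow> q \<in> set_pmf \<nu> \<Longrightarrow> 0 \<le> \<kappa> p q"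
    and "\<And>p. p \<in> set_pmf \<mu> \<Longrightarrow> (\<Sum>q\<in>set_pmf \<nu>. \<kappa> p q) = pmf \<mu> p"
    and "\<And>q. q \<in> set_pmf \<nu> \<Longrightarrow> (\<Sum>p\<in>set_pmf \<mu>. \<kappa> p q) = pmf \<nu> q"
  using assms by (auto simp: transport_plan_def)

text \<open>The plan is pushed forward by summing over the fibres of \<open>h\<close> and
  \<open>h'\<close>, and its cost is regrouped along the same fibres.\<close>

lemma wasserstein_map_le:
  assumes k: "transport_plan \<nu> \<nu>' \<kappa>" and fin: "finite (set_pmf \<nu>)" "finite (set_pmf \<nu>')"
    and h: "h ` set_pmf \<nu> \<subseteq> circle" "h' ` set_pmf \<nu>' \<subseteq> circle"
  shows "wasserstein (map_pmf h \<nu>) (map_pmf h' \<nu>')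
    \<le> (\<Sum>p\<in>set_pmf \<nu>. \<Sum>q\<in>set_pmf \<nu>'. \<kappa> p q * dist_circle (h p) (h' q))"
proof -
  let ?A = "set_pmf \<nu>" and ?B = "set_pmf \<nu>'"
  define K where "K a b = (\<Sum>p\<in>{p \<in> ?A. h p = a}. \<Sum>q\<in>{q \<in> ?B. h' q = b}. \<kappa> p q)" for a b
  note k = transport_planD[OF k]
  have P: "map_pmf h \<nu> \<in> Pfin" "map_pmf h' \<nu>' \<in> Pfin" using fin h by (auto simp: Pfin_def)
  have "transport_plan (map_pmf h \<nu>) (map_pmf h' \<nu>') K"
    unfolding transport_plan_def
  proof (intro conjI ballI)
    fix a b show "0 \<le> K a b" unfolding K_def using k(1) by (intro sum_nonneg) auto
  next
    fix a
    have "(\<Sum>b\<in>h' ` ?B. K a b) = (\<Sum>p\<in>{p \<in> ?A. h p = a}. \<Sum>b\<in>h' ` ?B. \<Sum>q\<in>{q \<in> ?B. h' q = b}. \<kappa> p q)"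
      unfolding K_def by (rule sum.swap)
    also have "\<dots> = (\<Sum>p\<in>{p \<in> ?A. h p = a}. \<Sum>q\<in>?B. \<kappa> p q)"
      using fin by (intro sum.cong refl sum.group) auto
    finally show "(\<Sum>b\<in>set_pmf (map_pmf h' \<nu>'). K a b) = pmf (map_pmf h \<nu>) a"
      using k(2) by (simp add: pmf_map_finite[OF fin(1)])
  next
    fix b
    have "(\<Sum>a\<in>h ` ?A. K a b) = (\<Sum>p\<in>?A. \<Sum>q\<in>{q \<in> ?B. h' q = b}. \<kappa> p q)"
      unfolding K_def using fin by (intro sum.group) auto
    also have "\<dots> = (\<Sum>q\<in>{q \<in> ?B. h' q = b}. \<Sum>p\<in>?A. \<kappa> p q)" by (rule sum.swap)
    finally show "(\<Sum>a\<in>set_pmf (map_pmf h \<nu>). K a b) = pmf (map_pmf h' \<nu>') b"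
      using k(3) by (simp add: pmf_map_finite[OF fin(2)])
  qed
  from wasserstein_le[OF P this]
  have "wasserstein (map_pmf h \<nu>) (map_pmf h' \<nu>') \<le> (\<Sum>a\<in>h ` ?A. \<Sum>b\<in>h' ` ?B. K a b * dist_circle a b)"
    by (simp add: transport_cost_def)
  also have "\<dots> = (\<Sum>a\<in>h ` ?A. \<Sum>b\<in>h' ` ?B. \<Sum>p\<in>{p \<in> ?A. h p = a}. \<Sum>q\<in>{q \<in> ?B. h' q = b}. \<kappa> p q * dist_circle (h p) (h' q))"
    by (intro sum.cong refl) (simp add: K_def sum_distrib_right)
  also have "\<dots> = (\<Sum>a\<in>h ` ?A. \<Sum>p\<in>{p \<in> ?A. h p = a}. \<Sum>b\<in>h' ` ?B. \<Sum>q\<in>{q \<in> ?B. h' q = b}. \<kappa> p q * dist_circle (h p) (h' q))"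
    by (intro sum.cong refl sum.swap)
  also have "\<dots> = (\<Sum>a\<in>h ` ?A. \<Sum>p\<in>{p \<in> ?A. h p = a}. \<Sum>q\<in>?B. \<kappa> p q * dist_circle (h p) (h' q))"
    using fin by (intro sum.cong refl sum.group) auto
  also have "\<dots> = (\<Sum>p\<in>?A. \<Sum>q\<in>?B. \<kappa> p q * dist_circle (h p) (h' q))"
    using fin by (intro sum.group) auto
  finally show ?thesis .
qed

text \<open>The unmatched masses \<open>a\<close> and \<open>b\<close> have the same total
  \<open>R\<close>, and their product divided by \<open>R\<close> completes the partial plan at a
  cost of at most \<open>D\<close> per unit.\<close>

lemma sub_plan_extend:
  assumes fin: "finite (set_pmf \<nu>)" "finite (set_pmf \<nu>')"
    and k0: "\<And>p q. p \<in> set_pmf \<nu> \<Longrightarrow> q \<in> set_pmf \<nu>' \<Longrightarrow> 0 \<le> \<kappa> p q"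
    and k1: "\<And>p. p \<in> set_pmf \<nu> \<Longrightarrow> (\<Sum>q\<in>set_pmf \<nu>'. \<kappa> p q) \<le> pmf \<nu> p"
    and k2: "\<And>q. q \<in> set_pmf \<nu>' \<Longrightarrow> (\<Sum>p\<in>set_pmf \<nu>. \<kappa> p q) \<le> pmf \<nu>' q"
    and c: "\<And>p q. p \<in> set_pmf \<nu> \<Longrightarrow> q \<in> set_pmf \<nu>' \<Longrightarrow> c p q \<le> D"
  obtains \<kappa>' where "transport_plan \<nu> \<nu>' \<kappa>'"
    "(\<Sum>p\<in>set_pmf \<nu>. \<Sum>q\<in>set_pmf \<nu>'. \<kappa>' p q * c p q)
      \<le> (\<Sum>p\<in>set_pmf \<nu>. \<Sum>q\<in>set_pmf \<nu>'. \<kappa> p q * c p q) + D * (1 - (\<Sum>p\<in>set_pmf \<nu>. \<Sum>q\<in>set_pmf \<nu>'. \<kappa> p q))"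
proof -
  let ?A = "set_pmf \<nu>" and ?B = "set_pmf \<nu>'"
  define a b R where "a p = pmf \<nu> p - (\<Sum>q\<in>?B. \<kappa> p q)" and "b q = pmf \<nu>' q - (\<Sum>p\<in>?A. \<kappa> p q)"
    and "R = 1 - (\<Sum>p\<in>?A. \<Sum>q\<in>?B. \<kappa> p q)" for p q
  have a0: "p \<in> ?A \<Longrightarrow> 0 \<le> a p" and b0: "q \<in> ?B \<Longrightarrow> 0 \<le> b q" for p q using k1 k2 by (auto simp: a_def b_def)
  have aR: "(\<Sum>p\<in>?A. a p) = R" using fin by (simp add: a_def R_def sum_subtractf sum_pmf_eq_1)
  have "(\<Sum>q\<in>?B. b q) = 1 - (\<Sum>q\<in>?B. \<Sum>p\<in>?A. \<kappa> p q)" using fin by (simp add: b_def sum_subtractf sum_pmf_eq_1)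
  then have bR: "(\<Sum>q\<in>?B. b q) = R" unfolding R_def by (subst sum.swap)
  \<comment> \<open>If \<open>R = 0\<close> both remainders vanish, in agreement with the value
    \<open>0\<close> of the division by \<open>R\<close> in \<open>K\<close>.\<close>
  have z: "R = 0 \<Longrightarrow> p \<in> ?A \<Longrightarrow> a p = 0" "R = 0 \<Longrightarrow> q \<in> ?B \<Longrightarrow> b q = 0" for p q
    using aR bR a0 b0 fin by (auto simp: sum_nonneg_eq_0_iff)
  have R0: "0 \<le> R" unfolding aR[symmetric] by (rule sum_nonneg) (rule a0)
  define K where "K p q = \<kappa> p q + a p * b q / R" for p q
  have "transport_plan \<nu> \<nu>' K"
    unfolding transport_plan_def
  proof (intro conjI ballI)
    fix p q assume "p \<in> ?A" "q \<in> ?B"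
    then show "0 \<le> K p q" unfolding K_def using k0 a0 b0 R0 by simp
  next
    fix p assume p: "p \<in> ?A"
    have "(\<Sum>q\<in>?B. K p q) = (\<Sum>q\<in>?B. \<kappa> p q) + a p * (\<Sum>q\<in>?B. b q) / R"
      by (simp add: K_def sum.distrib sum_distrib_left sum_divide_distrib)
    also have "a p * (\<Sum>q\<in>?B. b q) / R = a p" using z(1)[OF _ p] unfolding bR by auto
    finally show "(\<Sum>q\<in>?B. K p q) = pmf \<nu> p" by (simp add: a_def)
  next
    fix q assume q: "q \<in> ?B"
    have "(\<Sum>p\<in>?A. K p q) = (\<Sum>p\<in>?A. \<kappa> p q) + (\<Sum>p\<in>?A. a p) * b q / R"
      by (simp add: K_def sum.distrib sum_distrib_right sum_divide_distrib)
    also have "(\<Sum>p\<in>?A. a p) * b q / R = b q" using z(2)[OF _ q] unfolding aR by auto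
    finally show "(\<Sum>p\<in>?A. K p q) = pmf \<nu>' q" by (simp add: b_def)
  qed
  moreover have "(\<Sum>p\<in>?A. \<Sum>q\<in>?B. K p q * c p q) \<le> (\<Sum>p\<in>?A. \<Sum>q\<in>?B. \<kappa> p q * c p q) + D * R"
  proof -
    have "(\<Sum>p\<in>?A. \<Sum>q\<in>?B. K p q * c p q) = (\<Sum>p\<in>?A. \<Sum>q\<in>?B. \<kappa> p q * c p q)
        + (\<Sum>p\<in>?A. \<Sum>q\<in>?B. a p * b q / R * c p q)"
      by (simp add: K_def sum.distrib distrib_right)
    also have "(\<Sum>p\<in>?A. \<Sum>q\<in>?B. a p * b q / R * c p q) \<le> (\<Sum>p\<in>?A. \<Sum>q\<in>?B. a p * b q / R * D)"
      using a0 b0 R0 c by (intro sum_mono mult_left_mono) auto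
    also have "\<dots> = (\<Sum>p\<in>?A. \<Sum>q\<in>?B. a p * b q) / R * D"
      by (simp add: sum_divide_distrib sum_distrib_right)
    also have "(\<Sum>p\<in>?A. \<Sum>q\<in>?B. a p * b q) = (\<Sum>p\<in>?A. a p) * (\<Sum>q\<in>?B. b q)"
      by (rule sum_product[symmetric])
    finally show ?thesis unfolding aR bR by (simp add: mult.commute)
  qed
  ultimately show ?thesis using that[of K] unfolding R_def by blast
qed

text \<open>Of the mass that \<open>\<kappa>\<close> carries from \<open>p\<close> to
  \<open>q\<close>, the share \<open>min (w p) (w' q)\<close> common to both densities keeps its
  route; the rest is moved at a cost of at most \<open>pi\<close> per unit.\<close>

lemma wasserstein_reweight_le:
  assumes M: "\<mu> \<in> Pfin" and M': "\<mu>' \<in> Pfin" and k: "transport_plan \<mu> \<mu>' \<kappa>"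
    and w: "density \<mu> w" and w': "density \<mu>' w'"
    and h: "h ` set_pmf \<mu> \<subseteq> circle" "h' ` set_pmf \<mu>' \<subseteq> circle"
  shows "wasserstein (map_pmf h (reweight \<mu> w)) (map_pmf h' (reweight \<mu>' w'))
    \<le> (\<Sum>p\<in>set_pmf \<mu>. \<Sum>q\<in>set_pmf \<mu>'. \<kappa> p q * (w p * dist_circle (h p) (h' q) + pi * \<bar>w p - w' q\<bar>))"
proof -
  let ?A = "set_pmf \<mu>" and ?B = "set_pmf \<mu>'"
  let ?\<nu> = "reweight \<mu> w" and ?\<nu>' = "reweight \<mu>' w'"
  let ?A' = "set_pmf ?\<nu>" and ?B' = "set_pmf ?\<nu>'"
  let ?d = "\<lambda>p q. dist_circle (h p) (h' q)"
  define l where "l p q = min (w p) (w' q) * \<kappa> p q" for p q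
  note kD = transport_planD[OF k]
  have fin: "finite ?A" "finite ?B" using M M' Pfin_D by auto
  have sub: "?A' \<subseteq> ?A" "?B' \<subseteq> ?B" using w w' by (auto simp: set_reweight)
  have fin': "finite ?A'" "finite ?B'" using sub fin finite_subset by blast+
  have wp: "p \<in> ?A \<Longrightarrow> 0 \<le> w p" and wq: "q \<in> ?B \<Longrightarrow> 0 \<le> w' q" for p q using w w' by (auto simp: density_def)
  have l0: "0 \<le> l p q" if "p \<in> ?A" "q \<in> ?B" for p q
    unfolding l_def using kD(1) wp wq that by simp
  have lz: "l p q = 0" if "p \<in> ?A" "q \<in> ?B" "p \<notin> ?A' \<or> q \<notin> ?B'" for p q
    using that wp[of p] wq[of q] by (auto simp: l_def set_reweight[OF w] set_reweight[OF w'] min_def)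
  have l1: "(\<Sum>q\<in>?B'. l p q) \<le> pmf ?\<nu> p" if "p \<in> ?A'" for p
  proof -
    have p: "p \<in> ?A" using that sub by blast
    have "(\<Sum>q\<in>?B'. l p q) \<le> (\<Sum>q\<in>?B. l p q)" using fin sub l0 p by (intro sum_mono2) auto
    also have "\<dots> \<le> (\<Sum>q\<in>?B. w p * \<kappa> p q)"
      unfolding l_def using kD(1) p by (intro sum_mono mult_right_mono) auto
    also have "\<dots> = pmf ?\<nu> p" using kD(2)[OF p] by (simp add: sum_distrib_left[symmetric] pmf_reweight[OF w])
    finally show ?thesis .
  qed
  have l2: "(\<Sum>p\<in>?A'. l p q) \<le> pmf ?\<nu>' q" if "q \<in> ?B'" for q
  proof -
    have q: "q \<in> ?B" using that sub by blast
    have "(\<Sum>p\<in>?A'. l p q) \<le> (\<Sum>p\<in>?A. l p q)" using fin sub l0 q by (intro sum_mono2) auto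
    also have "\<dots> \<le> (\<Sum>p\<in>?A. w' q * \<kappa> p q)"
      unfolding l_def using kD(1) q by (intro sum_mono mult_right_mono) auto
    also have "\<dots> = pmf ?\<nu>' q" using kD(3)[OF q] by (simp add: sum_distrib_left[symmetric] pmf_reweight[OF w'])
    finally show ?thesis .
  qed
  have hc: "h p \<in> circle" "h' q \<in> circle" if "p \<in> ?A" "q \<in> ?B" for p q using h that by auto
  have dpi: "?d p q \<le> pi" if "p \<in> ?A'" "q \<in> ?B'" for p q
    using dist_circle_le_pi[OF hc] that sub by blast
  have red: "(\<Sum>p\<in>?A'. \<Sum>q\<in>?B'. l p q * c p q) = (\<Sum>p\<in>?A. \<Sum>q\<in>?B. l p q * c p q)" for c
  proof -
    have "(\<Sum>p\<in>?A'. \<Sum>q\<in>?B'. l p q * c p q) = (\<Sum>p\<in>?A'. \<Sum>q\<in>?B. l p q * c p q)"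
      using fin sub lz by (intro sum.cong refl sum.mono_neutral_left) auto
    also have "\<dots> = (\<Sum>p\<in>?A. \<Sum>q\<in>?B. l p q * c p q)"
      using fin sub lz by (intro sum.mono_neutral_left ballI sum.neutral) auto
    finally show ?thesis .
  qed
  obtain K where K: "transport_plan ?\<nu> ?\<nu>' K"
    "(\<Sum>p\<in>?A'. \<Sum>q\<in>?B'. K p q * ?d p q) \<le> (\<Sum>p\<in>?A'. \<Sum>q\<in>?B'. l p q * ?d p q) + pi * (1 - (\<Sum>p\<in>?A'. \<Sum>q\<in>?B'. l p q))"
  proof (rule sub_plan_extend[OF fin', of l ?d pi])
    show "0 \<le> l p q" if "p \<in> ?A'" "q \<in> ?B'" for p q using l0 sub that by blast
  qed (use l1 l2 dpi that in auto)
  have "h ` ?A' \<subseteq> circle" "h' ` ?B' \<subseteq> circle" using h sub by blast+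
  from wasserstein_map_le[OF K(1) fin' this] K(2)
  have "wasserstein (map_pmf h ?\<nu>) (map_pmf h' ?\<nu>') \<le> (\<Sum>p\<in>?A. \<Sum>q\<in>?B. l p q * ?d p q) + pi * (1 - (\<Sum>p\<in>?A. \<Sum>q\<in>?B. l p q))"
    using red[of ?d] red[of "\<lambda>_ _. 1"] by simp
  also have "1 = (\<Sum>p\<in>?A. \<Sum>q\<in>?B. \<kappa> p q * w p)"
    using w kD(2) by (simp add: density_def sum_distrib_right[symmetric])
  also have "(\<Sum>p\<in>?A. \<Sum>q\<in>?B. l p q * ?d p q) + pi * ((\<Sum>p\<in>?A. \<Sum>q\<in>?B. \<kappa> p q * w p) - (\<Sum>p\<in>?A. \<Sum>q\<in>?B. l p q))
      = (\<Sum>p\<in>?A. \<Sum>q\<in>?B. l p q * ?d p q + pi * (\<kappa> p q * w p - l p q))"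
    by (simp add: sum.distrib sum_subtractf sum_distrib_left[symmetric])
  also have "\<dots> \<le> (\<Sum>p\<in>?A. \<Sum>q\<in>?B. \<kappa> p q * (w p * ?d p q + pi * \<bar>w p - w' q\<bar>))"
  proof (intro sum_mono)
    fix p q assume pq: "p \<in> ?A" "q \<in> ?B"
    have kp: "0 \<le> \<kappa> p q" using kD(1) pq by blast
    have dp: "0 \<le> ?d p q" using hc[OF pq] by (rule dist_circle_nonneg)
    have "l p q * ?d p q \<le> (\<kappa> p q * w p) * ?d p q"
    proof (intro mult_right_mono dp)
      show "l p q \<le> \<kappa> p q * w p"
        unfolding l_def mult.commute[of _ "\<kappa> p q"] using kp by (intro mult_left_mono) auto
    qed
    moreover have "\<kappa> p q * w p - l p q = \<kappa> p q * (w p - min (w p) (w' q))" by (simp add: l_def algebra_simps)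
    moreover have "\<kappa> p q * (w p - min (w p) (w' q)) \<le> \<kappa> p q * \<bar>w p - w' q\<bar>"
      using kp by (intro mult_left_mono) auto
    ultimately show "l p q * ?d p q + pi * (\<kappa> p q * w p - l p q) \<le> \<kappa> p q * (w p * ?d p q + pi * \<bar>w p - w' q\<bar>)"
      using mult_left_mono[of "\<kappa> p q * w p - l p q" "\<kappa> p q * \<bar>w p - w' q\<bar>" pi]
      by (simp add: algebra_simps)
  qed
  finally show ?thesis by simp
qed

text \<open>Pairs at distance at least \<open>\<rho>\<close> are paid for by the transport cost
  itself, since there \<open>B \<le> B / \<rho> * dist_circle p q\<close>.\<close>

lemma plan_estimate:
  assumes k: "transport_plan \<mu> \<mu>' \<kappa>" and M: "\<mu> \<in> Pfin" "\<mu>' \<in> Pfin"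
    and near: "\<And>p q. p \<in> set_pmf \<mu> \<Longrightarrow> q \<in> set_pmf \<mu>' \<Longrightarrow> dist_circle p q < \<rho> \<Longrightarrow> c p q \<le> e + L * dist_circle p q"
    and far: "\<And>p q. p \<in> set_pmf \<mu> \<Longrightarrow> q \<in> set_pmf \<mu>' \<Longrightarrow> c p q \<le> B"
    and pos: "\<rho> > 0" "0 \<le> e" "0 \<le> L" "0 \<le> B"
  shows "(\<Sum>p\<in>set_pmf \<mu>. \<Sum>q\<in>set_pmf \<mu>'. \<kappa> p q * c p q) \<le> e + (L + B / \<rho>) * transport_cost \<mu> \<mu>' \<kappa>"
proof -
  let ?A = "set_pmf \<mu>" and ?B = "set_pmf \<mu>'"
  note kD = transport_planD[OF k]
  have "(\<Sum>p\<in>?A. \<Sum>q\<in>?B. \<kappa> p q * c p q) \<le> (\<Sum>p\<in>?A. \<Sum>q\<in>?B. \<kappa> p q * (e + (L + B / \<rho>) * dist_circle p q))"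
  proof (intro sum_mono mult_left_mono kD(1))
    fix p q assume pq: "p \<in> ?A" "q \<in> ?B"
    have d: "0 \<le> dist_circle p q" using Pfin_D(2)[OF M(1) pq(1)] Pfin_D(2)[OF M(2) pq(2)] by (rule dist_circle_nonneg)
    show "c p q \<le> e + (L + B / \<rho>) * dist_circle p q"
    proof (cases "dist_circle p q < \<rho>")
      case True
      moreover have "0 \<le> B / \<rho> * dist_circle p q" using pos d by simp
      ultimately show ?thesis using near[OF pq] by (simp add: algebra_simps)
    next
      case False
      have "B = B / \<rho> * \<rho>" using pos by simp
      also have "\<dots> \<le> B / \<rho> * dist_circle p q" using False pos by (intro mult_left_mono) auto
      also have "\<dots> \<le> e + (L + B / \<rho>) * dist_circle p q" using pos d by (simp add: algebra_simps)
      finally show ?thesis using far[OF pq] by linarith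
    qed
  qed
  also have "\<dots> = (\<Sum>p\<in>?A. \<Sum>q\<in>?B. \<kappa> p q) * e + (L + B / \<rho>) * transport_cost \<mu> \<mu>' \<kappa>"
    by (simp add: transport_cost_def distrib_left sum.distrib sum_distrib_left sum_distrib_right mult.assoc mult.left_commute)
  also have "(\<Sum>p\<in>?A. \<Sum>q\<in>?B. \<kappa> p q) = 1" using kD(2) Pfin_sum_pmf[OF M(1)] by simp
  finally show ?thesis by simp
qed

lemma le_wasserstein_scale:
  assumes M: "\<mu> \<in> Pfin" "\<mu>' \<in> Pfin" and C: "C > 0"
    and le: "\<And>\<kappa>. transport_plan \<mu> \<mu>' \<kappa> \<Longrightarrow> X \<le> e + C * transport_cost \<mu> \<mu>' \<kappa>"
  shows "X \<le> e + C * wasserstein \<mu> \<mu>'"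
proof -
  have "(X - e) / C \<le> wasserstein \<mu> \<mu>'"
    using le C by (intro wasserstein_greatest[OF M]) (simp add: field_simps)
  then show ?thesis using C by (simp add: field_simps)
qed

text \<open>Integrating \<open>u p - u' q\<close> against a plan compares functions on two different
  measures. Closeness is asked for on near pairs only; far ones enter through
  \<open>B / \<rho>\<close>.\<close>

lemma expectation_diff_le:
  fixes u u' :: "complex \<Rightarrow> real"
  assumes M: "\<mu> \<in> Pfin" "\<mu>' \<in> Pfin"
    and near: "\<And>p q. p \<in> set_pmf \<mu> \<Longrightarrow> q \<in> set_pmf \<mu>' \<Longrightarrow> dist_circle p q < \<rho> \<Longrightarrow> \<bar>u p - u' q\<bar> \<le> e + L * dist_circle p q"
    and far: "\<And>p q. p \<in> set_pmf \<mu> \<Longrightarrow> q \<in> set_pmf \<mu>' \<Longrightarrow> \<bar>u p - u' q\<bar> \<le> B"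
    and pos: "\<rho> > 0" "0 \<le> e" "0 \<le> L" "0 < B"
  shows "\<bar>measure_pmf.expectation \<mu> u - measure_pmf.expectation \<mu>' u'\<bar> \<le> e + (L + B / \<rho>) * wasserstein \<mu> \<mu>'"
proof (rule le_wasserstein_scale[OF M])
  show "0 < L + B / \<rho>" using pos by (simp add: add_nonneg_pos)
  fix \<kappa> assume k: "transport_plan \<mu> \<mu>' \<kappa>"
  let ?A = "set_pmf \<mu>" and ?B = "set_pmf \<mu>'"
  note kD = transport_planD[OF k]
  have "measure_pmf.expectation \<mu> u = (\<Sum>p\<in>?A. \<Sum>q\<in>?B. \<kappa> p q * u p)"
    using kD(2) M Pfin_D(1) by (simp add: expectation_finite sum_distrib_right[symmetric])
  moreover have "measure_pmf.expectation \<mu>' u' = (\<Sum>q\<in>?B. \<Sum>p\<in>?A. \<kappa> p q * u' q)"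
    using kD(3) M Pfin_D(1) by (simp add: expectation_finite sum_distrib_right[symmetric])
  moreover have "(\<Sum>q\<in>?B. \<Sum>p\<in>?A. \<kappa> p q * u' q) = (\<Sum>p\<in>?A. \<Sum>q\<in>?B. \<kappa> p q * u' q)" by (rule sum.swap)
  ultimately have "\<bar>measure_pmf.expectation \<mu> u - measure_pmf.expectation \<mu>' u'\<bar> = \<bar>\<Sum>p\<in>?A. \<Sum>q\<in>?B. \<kappa> p q * (u p - u' q)\<bar>"
    by (simp add: sum_subtractf right_diff_distrib)
  also have "\<dots> \<le> (\<Sum>p\<in>?A. \<bar>\<Sum>q\<in>?B. \<kappa> p q * (u p - u' q)\<bar>)" by (rule sum_abs)
  also have "\<dots> \<le> (\<Sum>p\<in>?A. \<Sum>q\<in>?B. \<bar>\<kappa> p q * (u p - u' q)\<bar>)" by (intro sum_mono sum_abs)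
  also have "\<dots> = (\<Sum>p\<in>?A. \<Sum>q\<in>?B. \<kappa> p q * \<bar>u p - u' q\<bar>)"
    using kD(1) by (intro sum.cong refl) (simp add: abs_mult)
  also have "\<dots> \<le> e + (L + B / \<rho>) * transport_cost \<mu> \<mu>' \<kappa>"
    using plan_estimate[OF k M near far] pos by simp
  finally show "\<bar>measure_pmf.expectation \<mu> u - measure_pmf.expectation \<mu>' u'\<bar> \<le> e + (L + B / \<rho>) * transport_cost \<mu> \<mu>' \<kappa>" .
qed

lemma wasserstein_reweight_estimate:
  assumes M: "\<mu> \<in> Pfin" "\<mu>' \<in> Pfin"
    and w: "density \<mu> w" and w': "density \<mu>' w'"
    and h: "h ` set_pmf \<mu> \<subseteq> circle" "h' ` set_pmf \<mu>' \<subseteq> circle"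
    and near: "\<And>p q. p \<in> set_pmf \<mu> \<Longrightarrow> q \<in> set_pmf \<mu>' \<Longrightarrow> dist_circle p q < \<rho> \<Longrightarrow>
      w p * dist_circle (h p) (h' q) + pi * \<bar>w p - w' q\<bar> \<le> e + L * dist_circle p q"
    and C: "\<And>p. p \<in> set_pmf \<mu> \<Longrightarrow> w p \<le> C" "\<And>q. q \<in> set_pmf \<mu>' \<Longrightarrow> w' q \<le> C" "0 < C"
    and pos: "\<rho> > 0" "0 \<le> e" "0 \<le> L"
  shows "wasserstein (map_pmf h (reweight \<mu> w)) (map_pmf h' (reweight \<mu>' w')) \<le> e + (L + 2 * pi * C / \<rho>) * wasserstein \<mu> \<mu>'"
proof (rule le_wasserstein_scale[OF M])
  show "0 < L + 2 * pi * C / \<rho>" using pos C by (simp add: add_nonneg_pos)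
  fix \<kappa> assume k: "transport_plan \<mu> \<mu>' \<kappa>"
  have far: "w p * dist_circle (h p) (h' q) + pi * \<bar>w p - w' q\<bar> \<le> 2 * pi * C"
    if pq: "p \<in> set_pmf \<mu>" "q \<in> set_pmf \<mu>'" for p q
  proof -
    have w0: "0 \<le> w p" "0 \<le> w' q" using w w' pq by (auto simp: density_def)
    have hc: "h p \<in> circle" "h' q \<in> circle" using h pq by auto
    have "w p * dist_circle (h p) (h' q) \<le> C * pi"
      using C pq w0 dist_circle_le_pi[OF hc] dist_circle_nonneg[OF hc] by (intro mult_mono) auto
    moreover have "pi * \<bar>w p - w' q\<bar> \<le> pi * C"
      using w0 C(1)[OF pq(1)] C(2)[OF pq(2)] by (intro mult_left_mono) auto
    ultimately have "w p * dist_circle (h p) (h' q) + pi * \<bar>w p - w' q\<bar> \<le> C * pi + pi * C" by (rule add_mono)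
    also have "\<dots> = 2 * pi * C" by simp
    finally show ?thesis .
  qed
  show "wasserstein (map_pmf h (reweight \<mu> w)) (map_pmf h' (reweight \<mu>' w')) \<le> e + (L + 2 * pi * C / \<rho>) * transport_cost \<mu> \<mu>' \<kappa>"
    by (rule order_trans[OF wasserstein_reweight_le[OF M k w w' h]], rule plan_estimate[OF k M near far]) (use pos C in auto)
qed

text \<open>Otherwise the whole mass of \<open>p\<close> would have to travel at least
  \<open>\<rho>\<close>.\<close>

lemma wasserstein_covers:
  assumes M: "\<mu> \<in> Pfin" "\<mu>' \<in> Pfin" and p: "p \<in> set_pmf \<mu>" and lt: "wasserstein \<mu> \<mu>' < \<rho> * pmf \<mu> p"
  shows "\<exists>q\<in>set_pmf \<mu>'. dist_circle p q < \<rho>"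
proof (rule ccontr)
  assume "\<not> ?thesis"
  then have far: "q \<in> set_pmf \<mu>' \<Longrightarrow> \<rho> \<le> dist_circle p q" for q by force
  have "\<rho> * pmf \<mu> p \<le> wasserstein \<mu> \<mu>'"
  proof (rule wasserstein_greatest[OF M])
    fix \<kappa> assume k: "transport_plan \<mu> \<mu>' \<kappa>"
    note kD = transport_planD[OF k]
    have "\<rho> * pmf \<mu> p = (\<Sum>q\<in>set_pmf \<mu>'. \<kappa> p q * \<rho>)"
      using kD(2)[OF p] by (simp add: sum_distrib_right[symmetric])
    also have "\<dots> \<le> (\<Sum>q\<in>set_pmf \<mu>'. \<kappa> p q * dist_circle p q)"
      using kD(1)[OF p] far by (intro sum_mono mult_left_mono) auto
    also have "\<dots> \<le> transport_cost \<mu> \<mu>' \<kappa>"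
      unfolding transport_cost_def
    proof (rule member_le_sum[OF p, where f = "\<lambda>p. \<Sum>q\<in>set_pmf \<mu>'. \<kappa> p q * dist_circle p q"])
      show "0 \<le> (\<Sum>q\<in>set_pmf \<mu>'. \<kappa> p' q * dist_circle p' q)" if "p' \<in> set_pmf \<mu> - {p}" for p'
        using that kD(1) M Pfin_D(2) by (intro sum_nonneg mult_nonneg_nonneg dist_circle_nonneg) auto
    qed (use M Pfin_D in auto)
    finally show "\<rho> * pmf \<mu> p \<le> transport_cost \<mu> \<mu>' \<kappa>" .
  qed
  then show False using lt by simp
qed

section \<open>The arcs of a support in terms of its index\<close>

locale indexed_set =
  fixes r :: real and \<Theta> :: "complex set" and k :: nat and g :: "real \<Rightarrow> int"
  assumes r: "0 \<le> r" "r < pi" and fin: "finite \<Theta>" and circ: "\<Theta> \<subseteq> circle"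
    and spread: "spread r (lifts \<Theta>)" and index: "run_index (lifts \<Theta>) k g"
begin

abbreviation "S \<equiv> lifts \<Theta>"

definition run :: "int \<Rightarrow> real set" where "run i = {x \<in> S. g x = i}"

text \<open>A point next to run \<open>i\<close> is not excluded if it is within \<open>r\<close> of
  all support points. The critical ones are the last point of run \<open>i + k\<close>, the farthest
  run ahead within a half turn, and, for \<open>upper\<close>, the first point of run
  \<open>i - k\<close>.\<close>

definition lower :: "int \<Rightarrow> real" where "lower i = Max (run (i + int k)) - r"

definition upper :: "int \<Rightarrow> real" where "upper i = Min (run (i - int k)) + r"

definition arc :: "int \<Rightarrow> complex set" where "arc i = cis ` {lower i..upper i}"

lemma pindex: "pindex S k g" using index by (rule run_index_pindex)

lemma run_nonempty: "run i \<noteq> {}" using run_index_onto[OF index, of i] by (auto simp: run_def)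

lemma finite_run: "finite (run i)"
proof -
  obtain a where a: "a \<in> S" "g a = i" using run_index_onto[OF index] by blast
  have "run i \<subseteq> S \<inter> {a - pi..<(a - pi) + 2 * pi}"
  proof
    fix x assume "x \<in> run i"
    then have "x \<in> S" "x < a + pi" "a < x + pi" using a pindex_less[OF pindex] by (auto simp: run_def)
    then show "x \<in> S \<inter> {a - pi..<(a - pi) + 2 * pi}" by auto
  qed
  then show ?thesis using finite_lifts[OF fin, of "a - pi"] finite_subset by blast
qed

lemma Min_run: "Min (run i) \<in> S" "g (Min (run i)) = i"
  using Min_in[OF finite_run run_nonempty, of i] by (auto simp: run_def)

lemma Max_run: "Max (run i) \<in> S" "g (Max (run i)) = i"
  using Max_in[OF finite_run run_nonempty, of i] by (auto simp: run_def)

lemma Min_run_le: assumes "x \<in> S" "i \<le> g x" shows "Min (run i) \<le> x"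
proof (rule ccontr)
  assume "\<not> Min (run i) \<le> x"
  then have "x \<in> run i" using pindex_mono[OF pindex assms(1) Min_run(1)[of i]] Min_run(2)[of i] assms by (simp add: run_def)
  then show False using Min_le[OF finite_run] \<open>\<not> Min (run i) \<le> x\<close> by blast
qed

lemma Max_run_ge: assumes "x \<in> S" "g x \<le> i" shows "x \<le> Max (run i)"
proof (rule ccontr)
  assume "\<not> x \<le> Max (run i)"
  then have "x \<in> run i" using pindex_mono[OF pindex Max_run(1)[of i] assms(1)] Max_run(2)[of i] assms by (simp add: run_def)
  then show False using Max_ge[OF finite_run] \<open>\<not> x \<le> Max (run i)\<close> by blast
qed

lemma shift_mem: "x \<in> S \<Longrightarrow> x + 2 * pi * of_int n \<in> S"
  by (simp add: lifts_def)

lemma shift_index: "x \<in> S \<Longrightarrow> g (x + 2 * pi * of_int n) = g x + n * (2 * int k + 1)"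
  by (rule pindex_shift[OF pindex])

lemma Min_run_shift: "Min (run (i + n * (2 * int k + 1))) = Min (run i) + 2 * pi * of_int n"
proof -
  have le: "Min (run (i + n * (2 * int k + 1))) \<le> Min (run i) + 2 * pi * of_int n" for i n
    using shift_mem[OF Min_run(1)] shift_index[OF Min_run(1)] Min_run(2) by (intro Min_run_le) auto
  have "Min (run i) \<le> Min (run (i + n * (2 * int k + 1))) + 2 * pi * of_int (- n)"
    using le[of "i + n * (2 * int k + 1)" "- n"] by simp
  then show ?thesis using le[of i n] by simp
qed

lemma Max_run_shift: "Max (run (i + n * (2 * int k + 1))) = Max (run i) + 2 * pi * of_int n"
proof -
  have le: "Max (run i) + 2 * pi * of_int n \<le> Max (run (i + n * (2 * int k + 1)))" for i n
    using shift_mem[OF Max_run(1)] shift_index[OF Max_run(1)] Max_run(2) by (intro Max_run_ge) auto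
  have "Max (run (i + n * (2 * int k + 1))) + 2 * pi * of_int (- n) \<le> Max (run i)"
    using le[of "i + n * (2 * int k + 1)" "- n"] by simp
  then show ?thesis using le[of i n] by simp
qed

lemma lower_shift: "lower (i + n * (2 * int k + 1)) = lower i + 2 * pi * of_int n"
  using Max_run_shift[of "i + int k" n] by (simp add: lower_def ac_simps)

lemma upper_shift: "upper (i + n * (2 * int k + 1)) = upper i + 2 * pi * of_int n"
  using Min_run_shift[of "i - int k" n] by (simp add: upper_def algebra_simps)

lemma arc_shift: "arc (i + n * (2 * int k + 1)) = arc i"
proof -
  have "{lower i + 2 * pi * of_int n..upper i + 2 * pi * of_int n} = (\<lambda>x. x + 2 * pi * of_int n) ` {lower i..upper i}"
    by simp
  then show ?thesis unfolding arc_def lower_shift upper_shift by (simp only: image_image cis_shift)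
qed

lemma in_window: assumes "x \<in> S" shows "lower (g x) \<le> x" "x \<le> upper (g x)"
proof -
  have "Max (run (g x + int k)) < x + pi"
    using pindex_less[OF pindex Max_run(1) assms] Max_run(2) by simp
  then show "lower (g x) \<le> x" using spread_le[OF spread Max_run(1) assms, of "g x + int k"] by (simp add: lower_def)
  have "x < Min (run (g x - int k)) + pi"
    using pindex_less[OF pindex assms Min_run(1)] Min_run(2) by simp
  then show "x \<le> upper (g x)" using spread_le[OF spread assms Min_run(1), of "g x - int k"] by (simp add: upper_def)
qed

lemma lower_le_upper: "lower i \<le> upper i"
  using in_window[OF Min_run(1)[of i]] Min_run(2)[of i] by simp

text \<open>Run \<open>i - k\<close> reappears as run \<open>i + k + 1\<close> one turn later, so
  consecutive windows are at least \<open>2 * pi - 2 * r\<close> apart.\<close>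

lemma upper_less_lower: "i < j \<Longrightarrow> upper i < lower j"
proof (induction j rule: int_gr_induct)
  have *: "upper i < lower (i + 1)" for i
  proof -
    let ?m = "Min (run (i - int k))"
    have "?m + 2 * pi * of_int 1 \<le> Max (run (i + 1 + int k))"
      using shift_index[OF Min_run(1), of "i - int k" 1] Min_run(2)[of "i - int k"]
      by (intro Max_run_ge shift_mem Min_run) auto
    then show ?thesis using r by (simp add: upper_def lower_def)
  qed
  { case base show ?case by (rule *) }
  { case (step j) then show ?case using *[of j] lower_le_upper[of j] by linarith }
qed

lemma window_unique:
  assumes "lower i \<le> z" "z \<le> upper i" "lower j \<le> z" "z \<le> upper j" shows "i = j"
  using upper_less_lower[of i j] upper_less_lower[of j i] assms by (cases i j rule: linorder_cases) auto

lemma mem_arcD: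
  assumes "cis z \<in> arc i"
  obtains n where "lower (i + n * (2 * int k + 1)) \<le> z" "z \<le> upper (i + n * (2 * int k + 1))"
proof -
  obtain y where y: "lower i \<le> y" "y \<le> upper i" "cis z = cis y" using assms by (auto simp: arc_def)
  then obtain n :: int where "z = y + 2 * pi * of_int n" using cis_eq_iff by blast
  then show ?thesis using that[of n] y by (simp add: lower_shift upper_shift)
qed

lemma mem_arc_index:
  assumes "x \<in> S" "cis x \<in> arc i"
  obtains n where "g x = i + n * (2 * int k + 1)"
proof -
  obtain n where "lower (i + n * (2 * int k + 1)) \<le> x" "x \<le> upper (i + n * (2 * int k + 1))"
    using mem_arcD[OF assms(2)] .
  from window_unique[OF in_window[OF assms(1)] this] show ?thesis by (rule that)
qed

lemma cis_mem_arc: "x \<in> S \<Longrightarrow> cis x \<in> arc (g x)"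
  unfolding arc_def using in_window by auto

lemma excludedI:
  assumes "w \<in> S" "w + r < z" "z < w + 2 * pi - r" shows "excluded r \<Theta> (cis z)"
proof -
  have "dist_circle (cis z) (cis w) > r"
    unfolding dist_circle_gt_iff by (rule exI[of _ 0]) (use assms in auto)
  then show ?thesis using assms(1) unfolding excluded_def lifts_def by auto
qed

lemma excludedD:
  assumes "excluded r \<Theta> (cis z)"
  obtains w where "w \<in> S" "w + r < z" "z < w + 2 * pi - r"
proof -
  obtain q where q: "q \<in> \<Theta>" "dist_circle (cis z) q > r" using assms by (auto simp: excluded_def)
  then have qA: "cis (Arg q) = q" using circ cis_Arg_circle by blast
  then obtain n :: int where "Arg q + 2 * pi * of_int n + r < z" "z < Arg q + 2 * pi * of_int n + 2 * pi - r"
    using q dist_circle_gt_iff[of r z "Arg q"] by auto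
  moreover have "Arg q + 2 * pi * of_int n \<in> S" using q qA by (simp add: lifts_def)
  ultimately show ?thesis using that by blast
qed

text \<open>A support point of index at least \<open>i - k\<close> excludes, going forward, only
  points beyond \<open>upper i\<close>. One of smaller index has its next lift at index at most
  \<open>i + k\<close>, so the interval it excludes ends before \<open>lower i\<close>.\<close>

lemma not_excluded_window:
  assumes "lower i \<le> z" "z \<le> upper i" shows "\<not> excluded r \<Theta> (cis z)"
proof
  assume "excluded r \<Theta> (cis z)"
  then obtain w where w: "w \<in> S" "w + r < z" "z < w + 2 * pi - r" by (rule excludedD)
  show False
  proof (cases "i - int k \<le> g w")
    case True
    from Min_run_le[OF w(1) this] show False using w(2) assms(2) by (simp add: upper_def)
  next
    case False
    have "g (w + 2 * pi * of_int 1) \<le> i + int k" using shift_index[OF w(1), of 1] False by simp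
    from Max_run_ge[OF shift_mem[OF w(1)] this] show False using w(3) assms(1) by (auto simp: lower_def)
  qed
qed

text \<open>Right outside the window begins an interval excluded by the support point that defines
  this end of it. An arc reaching out would meet that interval at its own endpoint or at the
  antipode of that support point, whichever comes first.\<close>

lemma admissible_window:
  assumes free: "\<And>z. \<alpha> \<le> z \<Longrightarrow> z \<le> \<beta> \<Longrightarrow> \<not> excluded r \<Theta> (cis z)"
    and x: "x \<in> S" "\<alpha> \<le> x" "x \<le> \<beta>"
  shows "lower (g x) \<le> \<alpha>" "\<beta> \<le> upper (g x)"
proof -
  show "\<beta> \<le> upper (g x)"
  proof (rule ccontr)
    let ?m = "Min (run (g x - int k))"
    assume "\<not> \<beta> \<le> upper (g x)"
    then have gt: "?m + r < \<beta>" by (simp add: upper_def)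
    have "x \<le> ?m + r" using in_window(2)[OF x(1)] by (simp add: upper_def)
    then have "\<not> excluded r \<Theta> (cis (min \<beta> (?m + pi)))" using gt r x by (intro free) auto
    moreover have "excluded r \<Theta> (cis (min \<beta> (?m + pi)))"
      by (rule excludedI[OF Min_run(1)]) (use gt r in auto)
    ultimately show False by blast
  qed
  show "lower (g x) \<le> \<alpha>"
  proof (rule ccontr)
    let ?m = "Max (run (g x + int k))"
    assume "\<not> lower (g x) \<le> \<alpha>"
    then have gt: "\<alpha> < ?m - r" by (simp add: lower_def)
    have "?m - r \<le> x" using in_window(1)[OF x(1)] by (simp add: lower_def)
    then have "\<not> excluded r \<Theta> (cis (max \<alpha> (?m - pi)))" using gt r x by (intro free) auto
    \<comment> \<open>The interval before \<open>?m - r\<close> is excluded by the lift of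
      \<open>?m\<close> one turn earlier.\<close>
    moreover have "excluded r \<Theta> (cis (max \<alpha> (?m - pi)))"
      by (rule excludedI[OF shift_mem[OF Max_run(1), of _ "-1"]]) (use gt r in auto)
    ultimately show False by blast
  qed
qed

lemma admissible_arc_arc: "admissible_arc r \<Theta> (arc i)"
  unfolding admissible_arc_def closed_arc_def
proof (intro conjI)
  show "\<exists>\<alpha> \<beta>. \<alpha> \<le> \<beta> \<and> \<beta> < \<alpha> + 2 * pi \<and> arc i = cis ` {\<alpha>..\<beta>}"
    using lower_le_upper[of i] upper_less_lower[of i "i + 1 * (2 * int k + 1)"] lower_shift[of i 1]
    by (intro exI[of _ "lower i"] exI[of _ "upper i"]) (auto simp: arc_def)
  have "cis (Min (run i)) \<in> arc i \<inter> \<Theta>" using cis_mem_arc[OF Min_run(1)[of i]] Min_run[of i] by (simp add: lifts_def)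
  then show "arc i \<inter> \<Theta> \<noteq> {}" by blast
  show "\<forall>p\<in>arc i. \<not> excluded r \<Theta> p" using not_excluded_window by (auto simp: arc_def)
qed

lemma admissible_arc_subset:
  assumes "admissible_arc r \<Theta> A"
  obtains i where "A \<subseteq> arc i"
proof -
  obtain \<alpha> \<beta> where A: "A = cis ` {\<alpha>..\<beta>}" using assms by (auto simp: admissible_arc_def closed_arc_def)
  obtain x where x: "x \<in> S" "\<alpha> \<le> x" "x \<le> \<beta>" using assms A by (auto simp: admissible_arc_def lifts_def)
  have "\<not> excluded r \<Theta> (cis z)" if "\<alpha> \<le> z" "z \<le> \<beta>" for z
    using assms A that by (auto simp: admissible_arc_def)
  from admissible_window[OF this x] have "A \<subseteq> arc (g x)" unfolding A arc_def by (intro image_mono) auto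
  then show ?thesis by (rule that)
qed

lemma arc_subset_arc:
  assumes "arc i \<subseteq> arc j" obtains n where "i = j + n * (2 * int k + 1)"
  using mem_arc_index[OF Min_run(1)[of i], of j] cis_mem_arc[OF Min_run(1)[of i]] Min_run(2)[of i] assms by auto

lemma arcs_eq: "arcs r \<Theta> = range arc"
proof
  show "arcs r \<Theta> \<subseteq> range arc"
  proof
    fix A assume A: "A \<in> arcs r \<Theta>"
    then obtain i where "A \<subseteq> arc i" using admissible_arc_subset[of A] by (auto simp: arcs_def)
    then show "A \<in> range arc" using A admissible_arc_arc[of i] by (auto simp: arcs_def)
  qed
  show "range arc \<subseteq> arcs r \<Theta>"
  proof
    fix A assume "A \<in> range arc"
    then obtain i where A: "A = arc i" by blast
    have "B = arc i" if B: "admissible_arc r \<Theta> B" "arc i \<subseteq> B" for B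
    proof -
      obtain j where j: "B \<subseteq> arc j" using admissible_arc_subset[OF B(1)] .
      then obtain n where "i = j + n * (2 * int k + 1)" using B(2) arc_subset_arc[of i j] by blast
      then have "arc i = arc j" using arc_shift by simp
      then show ?thesis using j B(2) by blast
    qed
    then show "A \<in> arcs r \<Theta>" unfolding A arcs_def using admissible_arc_arc by blast
  qed
qed

lemma int_mult_window:
  fixes a b n N :: int
  assumes "a = b + n * N" "\<bar>a - b\<bar> < N" shows "n = 0" "a = b"
proof -
  show "n = 0"
  proof (rule ccontr)
    assume "n \<noteq> 0"
    then have "1 \<le> \<bar>n\<bar>" by simp
    then have "1 * \<bar>N\<bar> \<le> \<bar>n\<bar> * \<bar>N\<bar>" by (intro mult_right_mono) auto
    then show False using assms by (simp add: abs_mult[symmetric])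
  qed
  then show "a = b" using assms by simp
qed

lemma arc_eq_iff: "\<bar>i - j\<bar> < 2 * int k + 1 \<Longrightarrow> arc i = arc j \<longleftrightarrow> i = j"
  using arc_subset_arc[of i j] int_mult_window(2)[of i j _ "2 * int k + 1"] by blast

lemma bij_betw_arc: "bij_betw (\<lambda>i. arc (e + int i)) {..2 * k} (arcs r \<Theta>)"
  unfolding bij_betw_def
proof
  show "inj_on (\<lambda>i. arc (e + int i)) {..2 * k}"
    by (rule inj_onI) (auto simp: arc_eq_iff)
  have "\<exists>i\<le>2 * k. arc j = arc (e + int i)" for j
  proof -
    let ?N = "2 * int k + 1"
    have "0 < ?N" by simp
    then have m: "0 \<le> (j - e) mod ?N" "(j - e) mod ?N < ?N" by (simp_all only: pos_mod_bound pos_mod_sign)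
    have "arc j = arc (e + (j - e) mod ?N)"
      using arc_shift[of "e + (j - e) mod ?N" "(j - e) div ?N"] unfolding add.assoc mod_div_mult_eq by simp
    then have "arc j = arc (e + int (nat ((j - e) mod ?N)))" using m(1) by simp
    moreover have "nat ((j - e) mod ?N) \<le> 2 * k" using m by linarith
    ultimately show ?thesis by blast
  qed
  then show "(\<lambda>i. arc (e + int i)) ` {..2 * k} = arcs r \<Theta>" unfolding arcs_eq by fastforce
qed

lemma card_arcs: "card (arcs r \<Theta>) = 2 * k + 1"
  using bij_betw_same_card[OF bij_betw_arc[of 0]] by simp

text \<open>The windows that contain the lifts \<open>c i\<close> have strictly increasing indices
  \<open>e i\<close>. These span less than a full turn, so \<open>2 * k + 1\<close> of them are
  consecutive and only the first one is free.\<close>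

lemma ccw_enumeration_arc:
  assumes "ccw_enumeration r k \<Theta> A"
  obtains e where "\<And>i. i \<le> 2 * k \<Longrightarrow> A i = arc (e + int i)"
proof -
  let ?N = "2 * int k + 1"
  obtain c where bij: "bij_betw A {..2 * k} (arcs r \<Theta>)" and c: "\<And>i. i \<le> 2 * k \<Longrightarrow> cis (c i) \<in> A i"
    "strict_mono_on {..2 * k} c" "c (2 * k) < c 0 + 2 * pi"
    using assms by (auto simp: ccw_enumeration_def)
  have "\<exists>e. A i = arc e \<and> lower e \<le> c i \<and> c i \<le> upper e" if "i \<le> 2 * k" for i
  proof -
    have "A i \<in> arcs r \<Theta>" using bij that by (auto simp: bij_betw_def)
    then obtain j where j: "A i = arc j" using arcs_eq by blast
    then have "cis (c i) \<in> arc j" using c(1)[OF that] by simp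
    then obtain n where "lower (j + n * ?N) \<le> c i" "c i \<le> upper (j + n * ?N)" by (rule mem_arcD)
    then show ?thesis using j arc_shift[of j n] by (intro exI[of _ "j + n * ?N"]) simp
  qed
  then have "\<exists>e. \<forall>i\<in>{..2 * k}. A i = arc (e i) \<and> lower (e i) \<le> c i \<and> c i \<le> upper (e i)"
    by (intro bchoice) auto
  then obtain e where e: "\<And>i. i \<le> 2 * k \<Longrightarrow> A i = arc (e i)" "\<And>i. i \<le> 2 * k \<Longrightarrow> lower (e i) \<le> c i"
    "\<And>i. i \<le> 2 * k \<Longrightarrow> c i \<le> upper (e i)" by auto
  have ne: "e i \<noteq> e j" if "i < j" "j \<le> 2 * k" for i j
  proof
    assume "e i = e j"
    then have "A i = A j" using e(1)[of i] e(1)[of j] that by simp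
    then show False using inj_onD[OF bij_betw_imp_inj_on[OF bij], of i j] that by simp
  qed
  have less: "e i < e j" if ij: "i < j" "j \<le> 2 * k" for i j
  proof -
    have "c i < c j" using c(2) ij by (auto simp: strict_mono_on_def)
    then have "\<not> e j < e i" using upper_less_lower[of "e j" "e i"] e(2)[of i] e(3)[of j] ij by auto
    then show ?thesis using ne[OF ij] by simp
  qed
  have grow: "e i + int d \<le> e (i + d)" if "i + d \<le> 2 * k" for i d
    using that
  proof (induction d)
    case (Suc d) then show ?case using less[of "i + d" "i + Suc d"] by simp
  qed simp
  have "e (2 * k) \<le> e 0 + ?N"
  proof (rule ccontr)
    assume "\<not> e (2 * k) \<le> e 0 + ?N"
    then have "upper (e 0 + 1 * ?N) < lower (e (2 * k))" by (intro upper_less_lower) simp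
    then show False using upper_shift[of "e 0" 1] e(2)[of "2 * k"] e(3)[of 0] c(3) by simp
  qed
  \<comment> \<open>Equality would identify the last arc with the first one, which injectivity
    allows only for \<open>k = 0\<close>, where it reads \<open>e 0 = e 0 + 1\<close>.\<close>
  moreover have "e (2 * k) \<noteq> e 0 + ?N"
  proof
    assume eq: "e (2 * k) = e 0 + ?N"
    then have "A (2 * k) = A 0" using arc_shift[of "e 0" 1] e(1)[of 0] e(1)[of "2 * k"] by simp
    then have "2 * k = 0" using inj_onD[OF bij_betw_imp_inj_on[OF bij], of "2 * k" 0] by simp
    then show False using eq by simp
  qed
  ultimately have top: "e (2 * k) \<le> e 0 + 2 * int k" by linarith
  have ei: "e i = e 0 + int i" if i: "i \<le> 2 * k" for i
  proof -
    obtain d where d: "2 * k = i + d" using i le_Suc_ex by blast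
    have "e i + int d \<le> e (i + d)" by (rule grow) (simp add: d)
    moreover have "e 0 + int i \<le> e (0 + i)" by (rule grow) (simp add: i)
    moreover have "2 * int k = int i + int d" using d by linarith
    moreover have "e (i + d) \<le> e 0 + 2 * int k" using top unfolding d .
    ultimately show ?thesis by simp
  qed
  show ?thesis
  proof (rule that[of "e 0"])
    fix i assume i: "i \<le> 2 * k"
    show "A i = arc (e 0 + int i)" using e(1)[OF i] unfolding ei[OF i] .
  qed
qed

text \<open>However the coordinate system is chosen, the cut at \<open>\<theta>0\<close> falls
  between two consecutive runs, so the turn after it carries the indices \<open>j\<close> to
  \<open>j + 2 * k\<close> in the order of the enumeration.\<close>

lemma coord_choice_window:
  assumes "coord_choice r k \<mu> \<theta>0 y0 A" and \<mu>: "set_pmf \<mu> = \<Theta>"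
  obtains j where "\<theta>0 \<notin> S" "\<And>x. x \<in> S \<Longrightarrow> \<theta>0 < x \<Longrightarrow> x < \<theta>0 + 2 * pi \<Longrightarrow> j \<le> g x \<and> g x \<le> j + 2 * int k"
    "\<And>i. i \<le> 2 * k \<Longrightarrow> A i = arc (j + int i)"
proof -
  let ?N = "2 * int k + 1"
  obtain e where e: "\<And>i. i \<le> 2 * k \<Longrightarrow> A i = arc (e + int i)"
    using ccw_enumeration_arc[of A] assms by (auto simp: coord_choice_def)
  show ?thesis
  proof (cases "k = 0")
    case True
    then have "excluded r \<Theta> (cis \<theta>0)" using assms by (simp add: coord_choice_def)
    then obtain w where w: "w \<in> S" "w + r < \<theta>0" "\<theta>0 < w + 2 * pi - r" by (rule excludedD)
    \<comment> \<open>Since \<open>w\<close> excludes the cut, all support points in the turn after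
      the cut lie within \<open>r\<close> of the next lift of \<open>w\<close>.\<close>
    let ?w = "w + 2 * pi * of_int 1"
    have w': "?w \<in> S" using shift_mem[OF w(1)] by blast
    show ?thesis
    proof (rule that[of "g ?w"])
      have "\<not> excluded r \<Theta> (cis x)" if "x \<in> S" for x using not_excluded_window[OF in_window[OF that]] .
      then show "\<theta>0 \<notin> S" using \<open>excluded r \<Theta> (cis \<theta>0)\<close> by blast
      fix x assume x: "x \<in> S" "\<theta>0 < x" "x < \<theta>0 + 2 * pi"
      have "?w - r \<le> x"
      proof (rule ccontr)
        assume "\<not> ?w - r \<le> x"
        then have "excluded r \<Theta> (cis x)" using excludedI[OF w(1), of x] w x by simp
        then show False using not_excluded_window[OF in_window[OF x(1)]] by blast
      qed
      moreover have "x \<le> ?w + r"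
      proof (rule ccontr)
        assume "\<not> x \<le> ?w + r"
        then have "excluded r \<Theta> (cis x)" using excludedI[OF w', of x] w x by simp
        then show False using not_excluded_window[OF in_window[OF x(1)]] by blast
      qed
      ultimately have "x < ?w + pi" "?w < x + pi" using r by auto
      then show "g ?w \<le> g x \<and> g x \<le> g ?w + 2 * int k"
        using pindex_less[OF pindex x(1) w'] pindex_less[OF pindex w' x(1)] True by simp
    next
      fix i assume "i \<le> 2 * k"
      then have "i = 0" "A i = arc e" using True e[of i] by auto
      moreover have "arc (g ?w) = arc e" using arc_shift[of e "g ?w - e"] True by simp
      ultimately show "A i = arc (g ?w + int i)" by simp
    qed
  next
    case False
    obtain \<alpha> \<beta> where ab: "\<alpha> < \<theta>0" "\<theta>0 < \<beta>" "\<beta> - \<alpha> = dist_circle (cis \<alpha>) (cis \<beta>)"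
      "cis \<alpha> \<in> \<Theta>" "cis \<alpha> \<in> A (2 * k)" "cis \<beta> \<in> \<Theta>" "cis \<beta> \<in> A 0"
      and min: "\<And>p q. p \<in> \<Theta> \<inter> A (2 * k) \<Longrightarrow> q \<in> \<Theta> \<inter> A 0 \<Longrightarrow> dist_circle (cis \<alpha>) (cis \<beta>) \<le> dist_circle p q"
      using assms False by (auto simp: coord_choice_def strictly_between_closest_def)
    have S: "\<alpha> \<in> S" "\<beta> \<in> S" using ab by (auto simp: lifts_def)
    obtain n where n: "g \<alpha> = e + int (2 * k) + n * ?N" using mem_arc_index[OF S(1)] ab(5) e[of "2 * k"] by auto
    obtain m where m: "g \<beta> = e + m * ?N" using mem_arc_index[OF S(2), of e] ab(7) e[of 0] by auto
    have "dist_circle (cis \<alpha>) (cis \<beta>) \<le> r" using spread_lifts_iff[OF r circ] spread ab by blast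
    then have "\<beta> - \<alpha> \<le> r" using ab(3) by simp
    then have "\<beta> < \<alpha> + pi" using r by simp
    then have gk: "g \<beta> \<le> g \<alpha> + int k" using pindex_less[OF pindex S(2,1)] by simp
    have "g \<alpha> \<le> g \<beta>" using pindex_mono[OF pindex S] ab by simp
    \<comment> \<open>Modulo \<open>?N\<close> the index of \<open>\<beta>\<close> is one more than
      that of \<open>\<alpha>\<close>, and closeness bounds their difference by \<open>k\<close>.
      For \<open>k > 0\<close> the congruence becomes an equality.\<close>
    then have "g \<beta> = g \<alpha> + 1"
      using int_mult_window(2)[of "g \<beta>" "g \<alpha> + 1" "m - n - 1" ?N] gk n m False by (simp add: algebra_simps)
    have none: "x \<le> \<alpha> \<or> \<beta> \<le> x" if x: "x \<in> S" for x
    proof (rule ccontr)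
      assume "\<not> ?thesis"
      then have lt: "\<alpha> < x" "x < \<beta>" by auto
      have "g \<alpha> \<le> g x" "g x \<le> g \<beta>" using pindex_mono[OF pindex] S x lt by auto
      then consider "g x = g \<alpha>" | "g x = g \<beta>" using \<open>g \<beta> = g \<alpha> + 1\<close> by linarith
      then show False
      proof cases
        case 1
        then have "arc (g x) = A (2 * k)" using n arc_shift[of "e + int (2 * k)" n] e[of "2 * k"] by simp
        then have "cis x \<in> \<Theta> \<inter> A (2 * k)" using cis_mem_arc[OF x] x by (simp add: lifts_def)
        then have "dist_circle (cis \<alpha>) (cis \<beta>) \<le> dist_circle (cis x) (cis \<beta>)" using min ab by blast
        also have "\<dots> \<le> \<bar>x - \<beta>\<bar>" by (rule dist_circle_le) auto
        finally show False using ab(3) lt by simp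
      next
        case 2
        then have "arc (g x) = A 0" using m arc_shift[of e m] e[of 0] by simp
        then have "cis x \<in> \<Theta> \<inter> A 0" using cis_mem_arc[OF x] x by (simp add: lifts_def)
        then have "dist_circle (cis \<alpha>) (cis \<beta>) \<le> dist_circle (cis \<alpha>) (cis x)" using min ab by blast
        also have "\<dots> \<le> \<bar>\<alpha> - x\<bar>" by (rule dist_circle_le) auto
        finally show False using ab(3) lt by simp
      qed
    qed
    show ?thesis
    proof (rule that[of "g \<beta>"])
      show "\<theta>0 \<notin> S" using none[of \<theta>0] ab by auto
      fix x assume x: "x \<in> S" "\<theta>0 < x" "x < \<theta>0 + 2 * pi"
      have "\<beta> \<le> x" using none[OF x(1)] x ab by auto
      then have 1: "g \<beta> \<le> g x" using pindex_mono[OF pindex S(2) x(1)] by simp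
      have "x + 2 * pi * of_int (-1) \<le> \<alpha>" using none[OF shift_mem[OF x(1), of "-1"]] x ab by auto
      then have "g (x + 2 * pi * of_int (-1)) \<le> g \<alpha>" using pindex_mono[OF pindex shift_mem[OF x(1)] S(1)] by blast
      then show "g \<beta> \<le> g x \<and> g x \<le> g \<beta> + 2 * int k"
        using 1 shift_index[OF x(1), of "-1"] \<open>g \<beta> = g \<alpha> + 1\<close> by simp
    next
      fix i assume "i \<le> 2 * k"
      then show "A i = arc (g \<beta> + int i)" using e[of i] m arc_shift[of "e + int i" m] by (simp add: ac_simps)
    qed
  qed
qed

text \<open>For \<open>k > 0\<close> a cut halfway between the last point of run \<open>-1\<close>
  and the first point of run \<open>0\<close> will do; for \<open>k = 0\<close>, the antipode of a
  support point.\<close>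

lemma coord_choice_exists:
  assumes \<mu>: "set_pmf \<mu> = \<Theta>"
  shows "\<exists>\<theta>0 y0 A. coord_choice r k \<mu> \<theta>0 y0 A"
proof -
  let ?A = "\<lambda>i. arc (int i)" and ?N = "2 * int k + 1"
  have "ccw_enumeration r k \<Theta> ?A"
    unfolding ccw_enumeration_def
  proof (intro conjI exI[of _ "\<lambda>i. Min (run (int i))"] allI impI)
    show "bij_betw ?A {..2 * k} (arcs r \<Theta>)" using bij_betw_arc[of 0] by simp
    have lt: "Min (run i) < Min (run j)" if "i < j" for i j
      using upper_less_lower[OF that] in_window[OF Min_run(1)[of i]] in_window[OF Min_run(1)[of j]]
      by (simp add: Min_run(2))
    show "cis (Min (run (int i))) \<in> ?A i" for i using cis_mem_arc[OF Min_run(1)] by (simp add: Min_run(2))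
    show "strict_mono_on {..2 * k} (\<lambda>i. Min (run (int i)))" using lt by (auto simp: strict_mono_on_def)
    show "Min (run (int (2 * k))) < Min (run (int 0)) + 2 * pi"
      using lt[of "int (2 * k)" "0 + 1 * ?N"] unfolding Min_run_shift by simp
  qed
  moreover have "\<exists>\<theta>0. if k = 0 then excluded r \<Theta> (cis \<theta>0) else strictly_between_closest \<Theta> (?A (2 * k)) (?A 0) \<theta>0"
  proof (cases "k = 0")
    case True
    have "excluded r \<Theta> (cis (Min (run 0) + pi))" by (rule excludedI[OF Min_run(1)[of 0]]) (use r in auto)
    then show ?thesis using True by auto
  next
    case False
    let ?a = "Max (run (-1))" and ?b = "Min (run 0)"
    have S: "?a \<in> S" "?b \<in> S" "g ?a = -1" "g ?b = 0" using Max_run Min_run by auto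
    have ab: "?a < ?b"
    proof (rule ccontr)
      assume "\<not> ?a < ?b"
      then have "g ?b \<le> g ?a" using pindex_mono[OF pindex S(2,1)] by simp
      then show False using S by simp
    qed
    have "?b < ?a + pi" using pindex_less[OF pindex S(2,1)] S False by simp
    then have d: "dist_circle (cis ?a) (cis ?b) = ?b - ?a" using dist_circle_eqI[of ?a ?b] ab by simp
    have A2: "?A (2 * k) = arc (-1)" using arc_shift[of "-1" 1] by simp
    have "strictly_between_closest \<Theta> (?A (2 * k)) (?A 0) ((?a + ?b) / 2)"
      unfolding strictly_between_closest_def
    proof (rule exI[of _ ?a], rule exI[of _ ?b], intro conjI ballI)
      show "cis ?a \<in> \<Theta> \<inter> ?A (2 * k)" unfolding A2 using cis_mem_arc[OF S(1)] S by (simp add: lifts_def)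
      show "cis ?b \<in> \<Theta> \<inter> ?A 0" using cis_mem_arc[OF S(2)] S by (simp add: lifts_def)
      fix p q assume p: "p \<in> \<Theta> \<inter> ?A (2 * k)" and q: "q \<in> \<Theta> \<inter> ?A 0"
      show "dist_circle (cis ?a) (cis ?b) \<le> dist_circle p q"
        unfolding d
      proof (rule dist_circle_greatest)
        show "p \<in> circle" "q \<in> circle" using p q circ by auto
        fix a b assume cab: "cis a = p" "cis b = q"
        have aS: "a \<in> S" and bS: "b \<in> S" using cab p q by (auto simp: lifts_def)
        obtain n where n: "g a = -1 + n * ?N" using mem_arc_index[OF aS, of "-1"] p cab A2 by auto
        obtain m where m: "g b = 0 + m * ?N" using mem_arc_index[OF bS, of 0] q cab by auto
        let ?a' = "a + 2 * pi * of_int (- n)" and ?b' = "b + 2 * pi * of_int (- n)"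
        have S': "?a' \<in> S" "?b' \<in> S" using shift_mem aS bS by blast+
        have ga: "g ?a' = -1" using shift_index[OF aS, of "- n"] n by simp
        have gb: "g ?b' = (m - n) * ?N" using shift_index[OF bS, of "- n"] m by (simp add: algebra_simps)
        have "?b - ?a \<le> \<bar>?a' - ?b'\<bar>"
        proof (cases "0 \<le> m - n")
          case True
          then have "0 \<le> g ?b'" unfolding gb by simp
          then have "?b \<le> ?b'" using Min_run_le[OF S'(2)] by blast
          moreover have "?a' \<le> ?a" using Max_run_ge[OF S'(1)] ga by simp
          ultimately show ?thesis by linarith
        next
          \<comment> \<open>Now \<open>?b'\<close> has index at most \<open>-1 - 2 * k\<close>, more
            than \<open>k\<close> runs before \<open>?a'\<close>, and is thus at least a half turn
            away; \<open>?a\<close> and \<open>?b\<close> are closer than that.\<close>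
          case F: False
          then have "(m - n) * ?N \<le> (-1) * ?N" by (intro mult_right_mono) auto
          then have "\<not> g ?a' \<le> g ?b' + int k" using gb ga False by simp
          then have "?b' + pi \<le> ?a'" using pindex_less[OF pindex S'] by simp
          then show ?thesis using \<open>?b < ?a + pi\<close> by linarith
        qed
        then show "?b - ?a \<le> \<bar>a - b\<bar>" by simp
      qed
    qed (use ab d in auto)
    then show ?thesis using False by auto
  qed
  ultimately show ?thesis unfolding coord_choice_def \<mu> by blast
qed

end

text \<open>The function \<open>x - step k * g x\<close> is \<open>2 * pi\<close>-periodic, so that any lift of \<open>p\<close> may stand in for \<open>Arg p\<close>.\<close>

definition dev :: "nat \<Rightarrow> (real \<Rightarrow> int) \<Rightarrow> complex \<Rightarrow> real" where
  "dev k g p = Arg p - step k * of_int (g (Arg p))"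

definition center :: "nat \<Rightarrow> (real \<Rightarrow> int) \<Rightarrow> complex pmf \<Rightarrow> real" where
  "center k g \<mu> = measure_pmf.expectation \<mu> (dev k g)"

definition spot :: "nat \<Rightarrow> (real \<Rightarrow> int) \<Rightarrow> complex pmf \<Rightarrow> complex \<Rightarrow> complex" where
  "spot k g \<mu> p = cis (step k * of_int (g (Arg p)) + center k g \<mu>)"

definition collapse :: "nat \<Rightarrow> (real \<Rightarrow> int) \<Rightarrow> complex pmf \<Rightarrow> complex pmf" where
  "collapse k g \<mu> = map_pmf (spot k g \<mu>) \<mu>"

lemma step_index_shift:
  assumes "pindex S k g" "x \<in> S"
  shows "step k * of_int (g (x + 2 * pi * of_int n)) = step k * of_int (g x) + 2 * pi * of_int n"
proof -
  have "step k * of_int (g (x + 2 * pi * of_int n)) = step k * of_int (g x) + (step k * (2 * real k + 1)) * of_int n"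
    unfolding pindex_shift[OF assms] by (simp add: algebra_simps)
  then show ?thesis unfolding step_turn .
qed

lemma cis_Arg_cis_shift:
  obtains n :: int where "Arg (cis x) = x + 2 * pi * of_int n"
  using cis_eq_iff[of "Arg (cis x)" x] cis_Arg_circle[of "cis x"] by auto

lemma dev_cis:
  assumes "pindex S k g" "x \<in> S"
  shows "dev k g (cis x) = x - step k * of_int (g x)"
proof -
  obtain n :: int where n: "Arg (cis x) = x + 2 * pi * of_int n" by (rule cis_Arg_cis_shift)
  show ?thesis unfolding dev_def n step_index_shift[OF assms] by simp
qed

lemma spot_cis:
  assumes "pindex S k g" "x \<in> S"
  shows "spot k g \<mu> (cis x) = cis (step k * of_int (g x) + center k g \<mu>)"
proof -
  obtain n :: int where n: "Arg (cis x) = x + 2 * pi * of_int n" by (rule cis_Arg_cis_shift)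
  have "cis (step k * of_int (g x) + 2 * pi * of_int n + center k g \<mu>) = cis ((step k * of_int (g x) + center k g \<mu>) + 2 * pi * of_int n)"
    by (simp only: ac_simps)
  then show ?thesis unfolding spot_def n step_index_shift[OF assms] by (simp only: cis_shift)
qed

section \<open>The collapsing maps at time one\<close>

context indexed_set
begin

text \<open>The choices of \<open>\<theta>0\<close>, \<open>y0\<close> and the first index
  \<open>j\<close> enter \<open>mean\<close> only through the constant
  \<open>y0 - \<theta>0 + step k * j\<close>. Its first part is undone by \<open>coord_tau\<close>,
  its second one by counting arcs from \<open>j\<close>.\<close>

lemma F_coord_spot:
  assumes ch: "coord_choice r k \<mu> \<theta>0 y0 A" and \<mu>: "set_pmf \<mu> = \<Theta>" and p: "p \<in> \<Theta>"
  shows "F_coord k \<mu> \<theta>0 y0 A p 1 = spot k g \<mu> p"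
proof -
  let ?N = "2 * int k + 1"
  obtain j where j: "\<theta>0 \<notin> S" "\<And>x. x \<in> S \<Longrightarrow> \<theta>0 < x \<Longrightarrow> x < \<theta>0 + 2 * pi \<Longrightarrow> j \<le> g x \<and> g x \<le> j + 2 * int k"
    "\<And>i. i \<le> 2 * k \<Longrightarrow> A i = arc (j + int i)" using coord_choice_window[OF ch \<mu>] by blast
  have "\<exists>x. x \<in> S \<and> \<theta>0 < x \<and> x < \<theta>0 + 2 * pi \<and> cis x = q" if q: "q \<in> \<Theta>" for q
  proof -
    have qc: "q \<in> circle" using q circ by blast
    obtain y where y: "cis y = q" "\<bar>(\<theta>0 + pi) - y\<bar> \<le> pi" using ex_lift[OF qc, of "\<theta>0 + pi"] .
    have "y \<in> S" using y q by (simp add: lifts_def)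
    moreover have "y \<noteq> \<theta>0" "y \<noteq> \<theta>0 + 2 * pi" using j(1) \<open>y \<in> S\<close> by (auto simp: lifts_def)
    ultimately show ?thesis using y by (intro exI[of _ y]) (auto simp: abs_le_iff)
  qed
  then have "\<exists>X. \<forall>q\<in>\<Theta>. X q \<in> S \<and> \<theta>0 < X q \<and> X q < \<theta>0 + 2 * pi \<and> cis (X q) = q"
    by (intro bchoice) blast
  then obtain X where X: "\<And>q. q \<in> \<Theta> \<Longrightarrow> X q \<in> S" "\<And>q. q \<in> \<Theta> \<Longrightarrow> \<theta>0 < X q" "\<And>q. q \<in> \<Theta> \<Longrightarrow> X q < \<theta>0 + 2 * pi"
    "\<And>q. q \<in> \<Theta> \<Longrightarrow> cis (X q) = q" by blast
  have cx: "coord_x \<theta>0 y0 q = y0 + X q - \<theta>0" if q: "q \<in> \<Theta>" for q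
  proof -
    have "(THE \<theta>. \<theta>0 < \<theta> \<and> \<theta> < \<theta>0 + 2 * pi \<and> cis \<theta> = q) = X q"
    proof (rule the_equality)
      show "\<theta> = X q" if "\<theta>0 < \<theta> \<and> \<theta> < \<theta>0 + 2 * pi \<and> cis \<theta> = q" for \<theta>
        using inj_on_cis[of \<theta>0] X[OF q] that by (auto simp: inj_on_def)
    qed (use X q in auto)
    then show ?thesis by (simp add: coord_x_def)
  qed
  define I where "I q = nat (g (X q) - j)" for q
  have I: "int (I q) = g (X q) - j" "I q \<le> 2 * k" if q: "q \<in> \<Theta>" for q
    using j(2)[of "X q"] X[OF q] by (auto simp: I_def)
  have IA: "q \<in> A i \<longleftrightarrow> i = I q" if q: "q \<in> \<Theta>" "i \<le> 2 * k" for q i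
  proof
    assume "q \<in> A i"
    then have "cis (X q) \<in> arc (j + int i)" using X(4)[OF q(1)] j(3)[OF q(2)] by simp
    then obtain n where "g (X q) = j + int i + n * ?N" using mem_arc_index[OF X(1)[OF q(1)]] by blast
    then have "g (X q) = j + int i" using int_mult_window(2)[of "g (X q)" "j + int i" n ?N] I[OF q(1)] q(2) by simp
    then show "i = I q" by (simp add: I_def)
  next
    assume "i = I q"
    then show "q \<in> A i" using cis_mem_arc[OF X(1)[OF q(1)]] X(4)[OF q(1)] I[OF q(1)] j(3)[OF q(2)] by simp
  qed
  have the: "(THE i. i \<le> 2 * k \<and> q \<in> A i) = I q" if q: "q \<in> \<Theta>" for q
    using IA[OF q] I(2)[OF q] by (intro the_equality) auto
  have st: "2 * real i * pi / real (2 * k + 1) = step k * real i" for i by (simp add: step_def ac_simps)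
  have one: "(\<Sum>q\<in>\<Theta>. pmf \<mu> q) = 1" using fin \<mu> by (simp add: sum_pmf_eq_1)
  have "mean k \<mu> \<theta>0 y0 A = (\<Sum>i\<le>2 * k. \<Sum>q\<in>\<Theta>. pmf \<mu> q * (indicator (A i) q * (coord_x \<theta>0 y0 q - step k * real i)))"
    unfolding mean_def st set_lebesgue_integral_def using expectation_finite[of \<mu>] fin \<mu> by simp
  also have "\<dots> = (\<Sum>q\<in>\<Theta>. \<Sum>i\<le>2 * k. pmf \<mu> q * (indicator (A i) q * (coord_x \<theta>0 y0 q - step k * real i)))"
    by (rule sum.swap)
  also have "\<dots> = (\<Sum>q\<in>\<Theta>. pmf \<mu> q * (dev k g q + (y0 - \<theta>0 + step k * of_int j)))"
  proof (rule sum.cong[OF refl])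
    fix q assume q: "q \<in> \<Theta>"
    have "(\<Sum>i\<le>2 * k. pmf \<mu> q * (indicator (A i) q * (coord_x \<theta>0 y0 q - step k * real i)))
      = (\<Sum>i\<le>2 * k. if i = I q then pmf \<mu> q * (coord_x \<theta>0 y0 q - step k * real i) else 0)"
      using IA[OF q] by (intro sum.cong refl) auto
    also have "\<dots> = pmf \<mu> q * (coord_x \<theta>0 y0 q - step k * real (I q))" using I(2)[OF q] by simp
    also have "real (I q) = of_int (g (X q)) - of_int j"
      using arg_cong[OF I(1)[OF q], of real_of_int] by simp
    also have "coord_x \<theta>0 y0 q - step k * (of_int (g (X q)) - of_int j) = dev k g q + (y0 - \<theta>0 + step k * of_int j)"
      using dev_cis[OF pindex X(1)[OF q]] X(4)[OF q] cx[OF q] by (simp add: algebra_simps)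
    finally show "(\<Sum>i\<le>2 * k. pmf \<mu> q * (indicator (A i) q * (coord_x \<theta>0 y0 q - step k * real i)))
      = pmf \<mu> q * (dev k g q + (y0 - \<theta>0 + step k * of_int j))" .
  qed
  also have "\<dots> = (\<Sum>q\<in>\<Theta>. pmf \<mu> q * dev k g q) + (\<Sum>q\<in>\<Theta>. pmf \<mu> q) * (y0 - \<theta>0 + step k * of_int j)"
    by (simp only: distrib_left[of _ "dev _ _ _"] sum.distrib sum_distrib_right)
  also have "\<dots> = center k g \<mu> + (y0 - \<theta>0 + step k * of_int j)"
    using fin \<mu> one by (simp add: center_def expectation_finite)
  finally have mean: "mean k \<mu> \<theta>0 y0 A = center k g \<mu> + (y0 - \<theta>0 + step k * of_int j)" .
  have "F_coord k \<mu> \<theta>0 y0 A p 1 = cis (step k * real (I p) + mean k \<mu> \<theta>0 y0 A + \<theta>0 - y0)"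
    unfolding F_coord_def Let_def the[OF p] st coord_tau_def by simp
  also have "step k * real (I p) + mean k \<mu> \<theta>0 y0 A + \<theta>0 - y0 = step k * of_int (g (X p)) + center k g \<mu>"
  proof -
    have Ip: "real (I p) = of_int (g (X p)) - of_int j"
      using arg_cong[OF I(1)[OF p], of real_of_int] by simp
    show ?thesis unfolding mean Ip by (simp add: algebra_simps)
  qed
  also have "cis \<dots> = spot k g \<mu> p" using spot_cis[OF pindex X(1)[OF p], of \<mu>] X(4)[OF p] by simp
  finally show ?thesis .
qed

lemma F_tilde_collapse:
  assumes \<mu>: "set_pmf \<mu> = \<Theta>"
  shows "F_tilde r k \<mu> 1 = collapse k g \<mu>"
  unfolding F_tilde_def collapse_def
proof (rule map_pmf_cong[OF refl])
  fix p assume "p \<in> set_pmf \<mu>"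
  then have p: "p \<in> \<Theta>" using \<mu> by simp
  obtain \<theta>0 y0 A where ch: "(SOME (\<theta>0, y0, A). coord_choice r k \<mu> \<theta>0 y0 A) = (\<theta>0, y0, A)"
    by (rule prod_cases3)
  have "\<exists>z. case z of (\<theta>0, y0, A) \<Rightarrow> coord_choice r k \<mu> \<theta>0 y0 A"
    using coord_choice_exists[OF \<mu>] by auto
  from someI_ex[OF this] have "coord_choice r k \<mu> \<theta>0 y0 A" unfolding ch by simp
  from F_coord_spot[OF this \<mu> p] show "F r k p \<mu> 1 = spot k g \<mu> p" unfolding F_def ch by simp
qed

end

definition indexed :: "real \<Rightarrow> nat \<Rightarrow> (real \<Rightarrow> int) \<Rightarrow> complex pmf \<Rightarrow> bool" where
  "indexed r k g \<mu> \<longleftrightarrow> \<mu> \<in> Pfin \<and> spread r (lifts (set_pmf \<mu>)) \<and> run_index (lifts (set_pmf \<mu>)) k g"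

text \<open>One lift of each point is moved; for maps that commute with full turns it does not
  matter which one.\<close>

definition push :: "(real \<Rightarrow> real) \<Rightarrow> complex pmf \<Rightarrow> complex pmf" where
  "push h \<mu> = map_pmf (\<lambda>p. cis (h (Arg p))) \<mu>"

lemma indexedD:
  assumes "indexed r k g \<mu>"
  shows indexed_Pfin: "\<mu> \<in> Pfin" and indexed_spread: "spread r (lifts (set_pmf \<mu>))"
    and indexed_run: "run_index (lifts (set_pmf \<mu>)) k g" and indexed_pindex: "pindex (lifts (set_pmf \<mu>)) k g"
    and indexed_finite: "finite (set_pmf \<mu>)"
  using assms run_index_pindex by (auto simp: indexed_def Pfin_def)

lemma indexed_set: "0 \<le> r \<Longrightarrow> r < pi \<Longrightarrow> indexed r k g \<mu> \<Longrightarrow> indexed_set r (set_pmf \<mu>) k g"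
  by unfold_locales (auto simp: indexed_def Pfin_def)

lemma VR_indexed:
  assumes "0 \<le> r" "r < pi" "\<mu> \<in> VR r"
  obtains k g where "indexed r k g \<mu>"
proof -
  have m: "\<mu> \<in> Pfin" "spread r (lifts (set_pmf \<mu>))" using VR_iff[OF assms(1,2)] assms(3) by auto
  have "finite (set_pmf \<mu>)" "set_pmf \<mu> \<subseteq> circle" using Pfin_D[OF m(1)] by auto
  from run_index_lifts_exists[OF m(2) assms(2) this(1) set_pmf_not_empty this(2)]
  obtain k g where "run_index (lifts (set_pmf \<mu>)) k g" .
  then show ?thesis using that m by (auto simp: indexed_def)
qed

lemma V_iff_indexed:
  assumes r: "0 \<le> r" "r < pi"
  shows "\<mu> \<in> V r k \<longleftrightarrow> (\<exists>g. indexed r k g \<mu>)"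
proof
  assume "\<mu> \<in> V r k"
  then have V: "\<mu> \<in> VR r" "card (arcs r (set_pmf \<mu>)) = 2 * k + 1" by (auto simp: V_def)
  obtain k' g where g: "indexed r k' g \<mu>" using VR_indexed[OF r V(1)] .
  have "k' = k" using indexed_set.card_arcs[OF indexed_set[OF r g]] V(2) by simp
  then show "\<exists>g. indexed r k g \<mu>" using g by blast
next
  assume "\<exists>g. indexed r k g \<mu>"
  then obtain g where g: "indexed r k g \<mu>" by blast
  then have "\<mu> \<in> VR r" using VR_iff[OF r] by (auto simp: indexed_def)
  then show "\<mu> \<in> V r k" using indexed_set.card_arcs[OF indexed_set[OF r g]] by (simp add: V_def)
qed

lemma F_tilde_indexed:
  assumes "0 \<le> r" "r < pi" "indexed r k g \<mu>"
  shows "F_tilde r k \<mu> 1 = collapse k g \<mu>"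
  using indexed_set.F_tilde_collapse[OF indexed_set[OF assms]] by simp

text \<open>Both sides equal \<open>F_tilde r k \<mu> 1\<close>, whose definition mentions no
  index.\<close>

lemma collapse_unique:
  assumes "0 \<le> r" "r < pi" "indexed r k g \<mu>" "indexed r k g' \<mu>"
  shows "collapse k g \<mu> = collapse k g' \<mu>"
  using F_tilde_indexed[OF assms(1,2)] assms(3,4) by metis

lemma collapse_relI:
  assumes r: "0 \<le> r" "r < pi" and "indexed r k g \<mu>" "indexed r k g' \<nu>" "collapse k g \<mu> = collapse k g' \<nu>"
  shows "(\<mu>, \<nu>) \<in> collapse_rel r"
  unfolding collapse_rel_def using assms V_iff_indexed[OF r] F_tilde_indexed[OF r] by auto

lemma V_disjoint: "\<mu> \<in> V r k \<Longrightarrow> \<mu> \<in> V r l \<Longrightarrow> k = l"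
  by (simp add: V_def)

lemma VR_cover: "0 \<le> r \<Longrightarrow> r < pi \<Longrightarrow> \<mu> \<in> VR r \<Longrightarrow> \<exists>k. \<mu> \<in> V r k"
  using VR_indexed V_iff_indexed by metis

lemma equiv_collapse_rel:
  assumes r: "0 \<le> r" "r < pi"
  shows "equiv (VR r) (collapse_rel r)"
proof (rule equivI)
  show sub: "collapse_rel r \<subseteq> VR r \<times> VR r" by (auto simp: collapse_rel_def V_def)
  show "refl_on (VR r) (collapse_rel r)"
    using VR_cover[OF r] by (auto simp: refl_on_def collapse_rel_def)
  show "sym (collapse_rel r)" by (rule symI) (auto simp: collapse_rel_def)
  show "trans (collapse_rel r)"
  proof (rule transI)
    fix a b c assume "(a, b) \<in> collapse_rel r" "(b, c) \<in> collapse_rel r"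
    then obtain k l where "a \<in> V r k" "b \<in> V r k" "F_tilde r k a 1 = F_tilde r k b 1"
      "b \<in> V r l" "c \<in> V r l" "F_tilde r l b 1 = F_tilde r l c 1" by (auto simp: collapse_rel_def)
    moreover from this have "k = l" using V_disjoint by blast
    ultimately show "(a, c) \<in> collapse_rel r" by (auto simp: collapse_rel_def)
  qed
qed

subsection \<open>Moves and the collapse\<close>

lemma turn_shift:
  assumes "periodic S" "\<forall>x\<in>S. h (x + 2 * pi) = h x + 2 * pi" "x \<in> S"
  shows "h (x + 2 * pi * of_int n) = h x + 2 * pi * of_int n"
  using periodic_shift_fun[of S h "2 * pi" x n] assms by (simp add: mult.commute)

lemma push_cis:
  assumes "periodic S" "\<forall>x\<in>S. h (x + 2 * pi) = h x + 2 * pi" "x \<in> S"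
  shows "cis (h (Arg (cis x))) = cis (h x)"
proof -
  obtain n :: int where n: "Arg (cis x) = x + 2 * pi * of_int n" by (rule cis_Arg_cis_shift)
  show ?thesis unfolding n turn_shift[OF assms] by simp
qed

lemma push_Pfin: "\<mu> \<in> Pfin \<Longrightarrow> push h \<mu> \<in> Pfin"
  by (auto simp: Pfin_def push_def)

lemma lifts_push:
  assumes \<mu>: "\<mu> \<in> Pfin" and h: "\<forall>x\<in>lifts (set_pmf \<mu>). h (x + 2 * pi) = h x + 2 * pi"
  shows "lifts (set_pmf (push h \<mu>)) = h ` lifts (set_pmf \<mu>)"
proof (intro equalityI subsetI)
  fix z assume "z \<in> lifts (set_pmf (push h \<mu>))"
  then obtain p where p: "p \<in> set_pmf \<mu>" "cis z = cis (h (Arg p))" by (auto simp: lifts_def push_def)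
  then have A: "Arg p \<in> lifts (set_pmf \<mu>)" using Pfin_D(2)[OF \<mu>] Arg_lifts by blast
  obtain n :: int where "z = h (Arg p) + 2 * pi * of_int n" using p(2) cis_eq_iff by blast
  then have "z = h (Arg p + 2 * pi * of_int n)" using turn_shift[OF periodic_lifts h A] by simp
  then show "z \<in> h ` lifts (set_pmf \<mu>)" using periodic_shift[OF periodic_lifts A] by blast
next
  fix z assume "z \<in> h ` lifts (set_pmf \<mu>)"
  then obtain x where x: "x \<in> lifts (set_pmf \<mu>)" "z = h x" by blast
  then have "cis z = cis (h (Arg (cis x)))" using push_cis[OF periodic_lifts h x(1)] by simp
  then show "z \<in> lifts (set_pmf (push h \<mu>))" using x(1) by (auto simp: lifts_def push_def)
qed

text \<open>Neither the arcs nor, up to the rotation by the mean displacement, the collapse are affected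
  by a monotone equivariant move: it does not disturb the cyclic order of the support and its
  antipode.\<close>

lemma indexed_push:
  assumes r: "0 \<le> r" "r < pi" and g: "indexed r k g \<mu>" and h: "short_map r (lifts (set_pmf \<mu>)) h"
  obtains g' where "indexed r k g' (push h \<mu>)"
    "collapse k g' (push h \<mu>) = map_pmf (\<lambda>z. z * cis (measure_pmf.expectation \<mu> (\<lambda>p. h (Arg p) - Arg p))) (collapse k g \<mu>)"
proof -
  let ?S = "lifts (set_pmf \<mu>)" and ?d = "measure_pmf.expectation \<mu> (\<lambda>p. h (Arg p) - Arg p)"
  have \<mu>: "\<mu> \<in> Pfin" and sp: "spread r ?S" and ri: "run_index ?S k g" and fin: "finite (set_pmf \<mu>)"
    using indexedD[OF g] by auto
  obtain g' where g': "run_index (h ` ?S) k g'" "\<And>x. x \<in> ?S \<Longrightarrow> g' (h x) = g x"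
    using run_index_image[OF ri sp r(2) h] by blast
  have "\<forall>x\<in>?S. h (x + 2 * pi) = h x + 2 * pi" using short_map_turn[OF h] by blast
  note L = lifts_push[OF \<mu> this]
  have sp': "spread r (h ` ?S)" using short_map_image_spread[OF h periodic_lifts r(2)] .
  have i: "indexed r k g' (push h \<mu>)" unfolding indexed_def L using push_Pfin[OF \<mu>] sp' g' by blast
  have pi': "pindex (h ` ?S) k g'" using g'(1) by (rule run_index_pindex)
  have A: "Arg p \<in> ?S" if "p \<in> set_pmf \<mu>" for p using Pfin_D(2)[OF \<mu> that] Arg_lifts that by blast
  have "center k g' (push h \<mu>) = measure_pmf.expectation \<mu> (\<lambda>p. dev k g' (cis (h (Arg p))))"
    by (simp add: center_def push_def)
  also have "\<dots> = (\<Sum>p\<in>set_pmf \<mu>. pmf \<mu> p * (dev k g p + (h (Arg p) - Arg p)))"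
    unfolding expectation_finite[OF fin]
    using dev_cis[OF pi' imageI[OF A]] g'(2)[OF A] by (intro sum.cong refl) (simp add: dev_def)
  also have "\<dots> = center k g \<mu> + ?d"
    unfolding center_def expectation_finite[OF fin] by (simp add: distrib_left sum.distrib)
  finally have c: "center k g' (push h \<mu>) = center k g \<mu> + ?d" .
  have "collapse k g' (push h \<mu>) = map_pmf (\<lambda>p. spot k g' (push h \<mu>) (cis (h (Arg p)))) \<mu>"
    unfolding collapse_def by (simp add: push_def pmf.map_comp o_def)
  also have "\<dots> = map_pmf (\<lambda>p. spot k g \<mu> p * cis ?d) \<mu>"
  proof (rule map_pmf_cong[OF refl])
    fix p assume p: "p \<in> set_pmf \<mu>"
    show "spot k g' (push h \<mu>) (cis (h (Arg p))) = spot k g \<mu> p * cis ?d"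
      unfolding spot_cis[OF pi' imageI[OF A[OF p]]] g'(2)[OF A[OF p]] c
      by (simp add: spot_def cis_mult add.assoc)
  qed
  also have "\<dots> = map_pmf (\<lambda>z. z * cis ?d) (collapse k g \<mu>)"
    by (simp add: collapse_def pmf.map_comp o_def)
  finally show ?thesis using that i by blast
qed

text \<open>The index of the larger support restricts to a partial index of the smaller one, so the
  level cannot rise, and it drops if a value is no longer taken.\<close>

lemma indexed_subset:
  assumes r: "0 \<le> r" "r < pi" and g: "indexed r k g \<mu>" and \<nu>: "\<nu> \<in> Pfin" "set_pmf \<nu> \<subseteq> set_pmf \<mu>"
  obtains l g' where "indexed r l g' \<nu>" "l \<le> k"
    "g ` lifts (set_pmf \<nu>) \<noteq> UNIV \<longrightarrow> l < k"
proof -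
  note sub = lifts_mono[OF \<nu>(2)]
  have "spread r (lifts (set_pmf \<nu>))"
    using indexed_spread[OF g] sub periodic_lifts unfolding spread_def by blast
  then have "\<nu> \<in> VR r" using VR_iff[OF r] \<nu> by blast
  then obtain l g' where g': "indexed r l g' \<nu>" using VR_indexed[OF r] by blast
  note * = indexed_run[OF g'] indexed_pindex[OF g] sub
  have "g ` lifts (set_pmf \<nu>) \<noteq> UNIV \<longrightarrow> l < k" using pindex_level_less[OF *] by blast
  then show ?thesis by (rule that[OF g' pindex_level_le[OF *]])
qed

lemma cis_step_eq_iff:
  "cis (step k * of_int i + c) = cis (step k * of_int j + c) \<longleftrightarrow> (\<exists>n. i = j + n * (2 * int k + 1))"
proof -
  have "step k * of_int i + c = step k * of_int j + c + 2 * pi * of_int n \<longleftrightarrow> i = j + n * (2 * int k + 1)" for n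
  proof -
    have "step k * of_int i + c = step k * of_int j + c + 2 * pi * of_int n
      \<longleftrightarrow> step k * of_int i = step k * of_int (j + n * (2 * int k + 1))"
      unfolding step_turn[of k, symmetric] by (simp add: algebra_simps)
    also have "\<dots> \<longleftrightarrow> i = j + n * (2 * int k + 1)"
      using step_pos[of k] unfolding mult_cancel_left of_int_eq_iff by simp
    finally show ?thesis .
  qed
  then show ?thesis unfolding cis_eq_iff by simp
qed

text \<open>The collapsed position of run \<open>i\<close>. Runs a full turn apart share it, so only
  the residue of \<open>i\<close> modulo \<open>2 * k + 1\<close> matters.\<close>

definition place :: "nat \<Rightarrow> (real \<Rightarrow> int) \<Rightarrow> complex pmf \<Rightarrow> int \<Rightarrow> complex" where
  "place k g \<mu> i = cis (step k * of_int i + center k g \<mu>)"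

lemma spot_place: "spot k g \<mu> p = place k g \<mu> (g (Arg p))"
  by (simp add: spot_def place_def)

lemma place_eq_iff: "place k g \<mu> i = place k g \<mu> j \<longleftrightarrow> (\<exists>n. i = j + n * (2 * int k + 1))"
  unfolding place_def by (rule cis_step_eq_iff)

lemma range_place: "range (place k g \<mu>) = place k g \<mu> ` int ` {..2 * k}"
proof -
  have "place k g \<mu> i \<in> place k g \<mu> ` int ` {..2 * k}" for i
  proof -
    let ?N = "2 * int k + 1"
    have "0 < ?N" by simp
    then have m: "0 \<le> i mod ?N" "i mod ?N < ?N" by (simp_all only: pos_mod_bound pos_mod_sign)
    have "i = i mod ?N + (i div ?N) * ?N" by (rule mod_div_mult_eq[symmetric])
    then have "place k g \<mu> i = place k g \<mu> (int (nat (i mod ?N)))" unfolding place_eq_iff using m(1) by auto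
    moreover have "nat (i mod ?N) \<in> {..2 * k}" using m by auto
    ultimately show ?thesis by blast
  qed
  then show ?thesis by auto
qed

lemma inj_on_place: "inj_on (\<lambda>i. place k g \<mu> (int i)) {..2 * k}"
proof (rule inj_onI)
  fix i j assume ij: "i \<in> {..2 * k}" "j \<in> {..2 * k}" "place k g \<mu> (int i) = place k g \<mu> (int j)"
  then obtain n where n: "int i = int j + n * (2 * int k + 1)" using place_eq_iff by blast
  have "n = 0"
  proof (rule ccontr)
    assume "n \<noteq> 0"
    then have "1 * (2 * int k + 1) \<le> \<bar>n\<bar> * (2 * int k + 1)" by (intro mult_right_mono) auto
    also have "\<dots> = \<bar>n * (2 * int k + 1)\<bar>" by (simp add: abs_mult)
    finally show False using n ij by auto
  qed
  then show "i = j" using n by simp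
qed

lemma set_collapse:
  assumes "indexed r k g \<mu>"
  shows "set_pmf (collapse k g \<mu>) = (\<lambda>i. place k g \<mu> (int i)) ` {..2 * k}"
proof -
  have "range (place k g \<mu>) \<subseteq> spot k g \<mu> ` set_pmf \<mu>"
  proof
    fix z assume "z \<in> range (place k g \<mu>)"
    then obtain i where i: "z = place k g \<mu> i" by blast
    obtain x where x: "x \<in> lifts (set_pmf \<mu>)" "g x = i" using run_index_onto[OF indexed_run[OF assms]] by blast
    then have "spot k g \<mu> (cis x) = z" using spot_cis[OF indexed_pindex[OF assms] x(1)] i by (simp add: place_def)
    then show "z \<in> spot k g \<mu> ` set_pmf \<mu>" using x(1) by (auto simp: lifts_def)
  qed
  moreover have "spot k g \<mu> ` set_pmf \<mu> \<subseteq> range (place k g \<mu>)" by (auto simp: spot_place)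
  ultimately show ?thesis using range_place[of k g \<mu>] by (simp add: collapse_def image_image)
qed

lemma card_collapse:
  assumes "indexed r k g \<mu>" shows "card (set_pmf (collapse k g \<mu>)) = 2 * k + 1"
  unfolding set_collapse[OF assms] by (subst card_image[OF inj_on_place]) simp

lemma place_in_collapse:
  assumes "indexed r k g \<mu>" shows "place k g \<mu> i \<in> set_pmf (collapse k g \<mu>)"
  using range_place[of k g \<mu>] unfolding set_collapse[OF assms] image_image by auto

lemma finite_collapse: "indexed r k g \<mu> \<Longrightarrow> finite (set_pmf (collapse k g \<mu>))"
  by (simp add: set_collapse)

lemma pmf_collapse:
  "pmf (collapse k g \<mu>) (place k g \<mu> i) = measure_pmf.expectation \<mu> (indicator {p. \<exists>n. g (Arg p) = i + n * (2 * int k + 1)})"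
proof -
  have "spot k g \<mu> -` {place k g \<mu> i} = {p. \<exists>n. g (Arg p) = i + n * (2 * int k + 1)}"
    by (auto simp: spot_place place_eq_iff)
  then show ?thesis by (simp add: collapse_def pmf_map)
qed

subsection \<open>Thinning out\<close>

definition low :: "complex pmf \<Rightarrow> real" where
  "low f = Min (pmf f ` set_pmf f)"

text \<open>Under this density every atom of \<open>f\<close> loses the mass
  \<open>s * low f\<close> before normalisation; at \<open>s = 1\<close> the lightest atoms vanish.
  The atoms of a collapse stand for arcs, so \<open>thin\<close> scales all points of an arc
  alike.\<close>

definition thinning :: "real \<Rightarrow> complex pmf \<Rightarrow> complex \<Rightarrow> real" where
  "thinning s f z = (1 - s * low f / pmf f z) / (1 - real (card (set_pmf f)) * s * low f)"

lemma low_le: "finite (set_pmf f) \<Longrightarrow> z \<in> set_pmf f \<Longrightarrow> low f \<le> pmf f z"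
  unfolding low_def by (intro Min_le) auto

lemma low_attained:
  assumes "finite (set_pmf f)" obtains z where "z \<in> set_pmf f" "pmf f z = low f"
  using Min_in[of "pmf f ` set_pmf f"] assms set_pmf_not_empty[of f] unfolding low_def by fastforce

lemma low_pos: "finite (set_pmf f) \<Longrightarrow> 0 < low f"
  using low_attained[of f] by (metis pmf_positive)

lemma thinning_nonneg:
  assumes fin: "finite (set_pmf f)" and s: "0 \<le> s" "s \<le> 1" "real (card (set_pmf f)) * s * low f \<le> 1 / 2"
    and z: "z \<in> set_pmf f"
  shows "0 \<le> thinning s f z" "thinning s f z \<le> 2"
proof -
  have pz: "0 < pmf f z" using z by (simp add: pmf_positive)
  have "s * low f \<le> 1 * pmf f z" using low_le[OF fin z] low_pos[OF fin] s by (intro mult_mono) auto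
  then have "s * low f / pmf f z \<le> 1" using pz by (simp add: field_simps)
  moreover have "0 \<le> s * low f / pmf f z" using s low_pos[OF fin] pz by simp
  moreover have "1 / 2 \<le> 1 - real (card (set_pmf f)) * s * low f" using s by simp
  ultimately show "0 \<le> thinning s f z" "thinning s f z \<le> 2"
    by (auto simp: thinning_def divide_le_eq)
qed

lemma density_thinning:
  assumes fin: "finite (set_pmf f)" and s: "0 \<le> s" "s \<le> 1" "real (card (set_pmf f)) * s * low f \<le> 1 / 2"
  shows "density f (thinning s f)"
  unfolding density_def
proof (intro conjI ballI fin)
  let ?D = "1 - real (card (set_pmf f)) * s * low f"
  have "(\<Sum>z\<in>set_pmf f. pmf f z * thinning s f z) = (\<Sum>z\<in>set_pmf f. (pmf f z - s * low f) / ?D)"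
  proof (rule sum.cong[OF refl])
    fix z assume "z \<in> set_pmf f"
    then have "pmf f z * (1 - s * low f / pmf f z) = pmf f z - s * low f"
      by (simp add: right_diff_distrib set_pmf_iff)
    then show "pmf f z * thinning s f z = (pmf f z - s * low f) / ?D"
      unfolding thinning_def times_divide_eq_right by simp
  qed
  also have "\<dots> = ?D / ?D"
    using sum_pmf_eq_1[OF fin order_refl] by (simp add: sum_divide_distrib[symmetric] sum_subtractf)
  finally show "(\<Sum>z\<in>set_pmf f. pmf f z * thinning s f z) = 1" using s by simp
qed (use thinning_nonneg[OF fin s] in auto)

definition thin :: "nat \<Rightarrow> (real \<Rightarrow> int) \<Rightarrow> complex pmf \<Rightarrow> real \<Rightarrow> complex pmf" where
  "thin k g \<mu> s = reweight \<mu> (\<lambda>p. thinning s (collapse k g \<mu>) (spot k g \<mu> p))"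

text \<open>The difference of the centers is the rotation that makes up for the change of the mean by thinning.\<close>

definition glide :: "nat \<Rightarrow> (real \<Rightarrow> int) \<Rightarrow> complex pmf \<Rightarrow> real \<Rightarrow> real \<Rightarrow> real \<Rightarrow> real" where
  "glide k g \<mu> s t x = (1 - t) * (x + (center k g \<mu> - center k g (thin k g \<mu> s)))
     + t * (step k * of_int (g x) + center k g \<mu>)"

definition move :: "nat \<Rightarrow> (real \<Rightarrow> int) \<Rightarrow> complex pmf \<Rightarrow> real \<Rightarrow> real \<Rightarrow> complex pmf" where
  "move k g \<mu> s t = push (glide k g \<mu> s t) (thin k g \<mu> s)"

text \<open>The bound \<open>1 / 2\<close> keeps the normalising denominator away from zero and the
  density below \<open>2\<close>. For a collapse with \<open>k = 0\<close>, a single atom of mass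
  one, it rules out \<open>s = 1\<close>: the last arc is never removed.\<close>

definition thinnable :: "nat \<Rightarrow> complex pmf \<Rightarrow> real \<Rightarrow> bool" where
  "thinnable k f s \<longleftrightarrow> 0 \<le> s \<and> s \<le> 1 \<and> real (2 * k + 1) * s * low f \<le> 1 / 2"

lemma density_thin:
  assumes g: "indexed r k g \<mu>" and s: "thinnable k (collapse k g \<mu>) s"
  shows "density \<mu> (\<lambda>p. thinning s (collapse k g \<mu>) (spot k g \<mu> p))"
    and "density (collapse k g \<mu>) (thinning s (collapse k g \<mu>))"
proof -
  show "density (collapse k g \<mu>) (thinning s (collapse k g \<mu>))"
    using s finite_collapse[OF g] card_collapse[OF g] by (intro density_thinning) (auto simp: thinnable_def)
  then show "density \<mu> (\<lambda>p. thinning s (collapse k g \<mu>) (spot k g \<mu> p))"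
    using density_map[OF indexed_finite[OF g], of "thinning s (collapse k g \<mu>)" "spot k g \<mu>"]
    by (simp add: collapse_def)
qed

lemma thin_Pfin:
  assumes g: "indexed r k g \<mu>" and s: "thinnable k (collapse k g \<mu>) s"
  shows "thin k g \<mu> s \<in> Pfin" "set_pmf (thin k g \<mu> s) \<subseteq> set_pmf \<mu>"
  using indexed_Pfin[OF g] unfolding thin_def Pfin_def by (auto simp: set_reweight[OF density_thin(1)[OF g s]])

lemma short_map_glide:
  assumes r: "0 \<le> r" "r < pi" and g: "indexed r k g \<mu>" and t: "0 \<le> t" "t \<le> 1"
  shows "short_map r (lifts (set_pmf \<mu>)) (glide k g \<mu> s t)"
  unfolding glide_def
  by (intro short_map_convex short_map_translate short_map_step t r indexed_spread[OF g] indexed_pindex[OF g]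
      level_bound[OF indexed_run[OF g] indexed_spread[OF g]])

text \<open>On the thinned measure, the translation at \<open>t = 0\<close> and the passage to the
  collapsed positions at \<open>t = 1\<close> have the same mean displacement, hence so have their
  mixtures. By \<open>indexed_push\<close> the collapse then stays fixed during the slide.\<close>

lemma glide_displacement:
  assumes g: "indexed r k g \<mu>" and s: "thinnable k (collapse k g \<mu>) s"
  shows "measure_pmf.expectation (thin k g \<mu> s) (\<lambda>p. glide k g \<mu> s t (Arg p) - Arg p)
    = center k g \<mu> - center k g (thin k g \<mu> s)"
proof -
  let ?\<nu> = "thin k g \<mu> s" and ?c = "center k g \<mu> - center k g (thin k g \<mu> s)"
  have fin: "finite (set_pmf ?\<nu>)" using thin_Pfin(1)[OF g s] Pfin_D by blast
  have "(\<Sum>p\<in>set_pmf ?\<nu>. pmf ?\<nu> p * (glide k g \<mu> s t (Arg p) - Arg p))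
      = (\<Sum>p\<in>set_pmf ?\<nu>. pmf ?\<nu> p * ((1 - t) * ?c + t * center k g \<mu>) - t * (pmf ?\<nu> p * dev k g p))"
    by (intro sum.cong refl) (simp add: glide_def dev_def algebra_simps)
  also have "\<dots> = (\<Sum>p\<in>set_pmf ?\<nu>. pmf ?\<nu> p) * ((1 - t) * ?c + t * center k g \<mu>) - t * center k g ?\<nu>"
    unfolding center_def[of k g ?\<nu>] expectation_finite[OF fin] sum_subtractf sum_distrib_right sum_distrib_left ..
  also have "(\<Sum>p\<in>set_pmf ?\<nu>. pmf ?\<nu> p) = 1" using sum_pmf_eq_1[OF fin order_refl] .
  finally show ?thesis unfolding expectation_finite[OF fin] by (simp add: algebra_simps)
qed

text \<open>For given \<open>s\<close> the right-hand side depends on \<open>\<mu>\<close> only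
  through its collapse; this is why a completed slide sends a whole class to one point.\<close>

lemma move_one:
  assumes g: "indexed r k g \<mu>" and s: "thinnable k (collapse k g \<mu>) s"
  shows "move k g \<mu> s 1 = reweight (collapse k g \<mu>) (thinning s (collapse k g \<mu>))"
proof -
  have "move k g \<mu> s 1 = map_pmf (spot k g \<mu>) (thin k g \<mu> s)"
    by (simp add: move_def push_def glide_def spot_def[abs_def])
  also have "\<dots> = reweight (collapse k g \<mu>) (thinning s (collapse k g \<mu>))"
    unfolding thin_def
    using map_reweight[of "spot k g \<mu>" \<mu> "thinning s (collapse k g \<mu>)"] density_thin(2)[OF g s] indexed_finite[OF g]
    by (simp add: collapse_def)
  finally show ?thesis .
qed

lemma move_zero:
  assumes g: "indexed r k g \<mu>" shows "move k g \<mu> 0 0 = \<mu>"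
proof -
  have "thinning 0 f z = 1" for f z by (simp add: thinning_def)
  moreover have "reweight \<mu> (\<lambda>p. 1) = \<mu>"
  proof (rule pmf_eqI)
    have "density \<mu> (\<lambda>p. 1)" using indexed_finite[OF g] by (simp add: density_def sum_pmf_eq_1)
    then show "pmf (reweight \<mu> (\<lambda>p. 1)) p = pmf \<mu> p" for p by (simp add: pmf_reweight)
  qed
  ultimately have thin: "thin k g \<mu> 0 = \<mu>" by (simp add: thin_def)
  have "map_pmf (\<lambda>p. cis (Arg p)) \<mu> = map_pmf (\<lambda>p. p) \<mu>"
    using Pfin_D(2)[OF indexed_Pfin[OF g]] cis_Arg_circle by (intro map_pmf_cong refl) blast
  then show ?thesis by (simp add: move_def push_def glide_def thin)
qed

text \<open>The level is that of the thinned measure, as the slide is a short map. At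
  \<open>s = 1\<close> a lightest atom disappears, and the index of its arc is no longer
  taken.\<close>

lemma move_level:
  assumes r: "0 \<le> r" "r < pi" and g: "indexed r k g \<mu>" and s: "thinnable k (collapse k g \<mu>) s"
  obtains l where "l \<le> k" "s = 1 \<Longrightarrow> l < k"
    "\<And>t. 0 \<le> t \<Longrightarrow> t \<le> 1 \<Longrightarrow> move k g \<mu> s t \<in> V r l"
    "\<And>t. 0 \<le> t \<Longrightarrow> t \<le> 1 \<Longrightarrow> (move k g \<mu> s t, move k g \<mu> s 1) \<in> collapse_rel r"
proof -
  let ?\<nu> = "thin k g \<mu> s" and ?f = "collapse k g \<mu>"
  have \<nu>: "?\<nu> \<in> Pfin" "set_pmf ?\<nu> \<subseteq> set_pmf \<mu>" using thin_Pfin[OF g s] by auto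
  obtain l g' where g': "indexed r l g' ?\<nu>" and l: "l \<le> k" "g ` lifts (set_pmf ?\<nu>) \<noteq> UNIV \<longrightarrow> l < k"
    by (rule indexed_subset[OF r g \<nu>])
  have sm: "short_map r (lifts (set_pmf ?\<nu>)) (glide k g \<mu> s t)" if "0 \<le> t" "t \<le> 1" for t
    using short_map_glide[OF r g that] lifts_mono[OF \<nu>(2)] by (rule short_map_subset)
  have ex: "\<exists>h. indexed r l h (move k g \<mu> s t) \<and>
      collapse l h (move k g \<mu> s t) = map_pmf (\<lambda>z. z * cis (center k g \<mu> - center k g ?\<nu>)) (collapse l g' ?\<nu>)"
    if t: "0 \<le> t" "t \<le> 1" for t
    using indexed_push[OF r g' sm[OF t]] unfolding glide_displacement[OF g s] move_def[symmetric] by metis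
  show ?thesis
  proof (rule that[OF l(1)])
    assume "s = 1"
    obtain z where z: "z \<in> set_pmf ?f" "pmf ?f z = low ?f" using low_attained[OF finite_collapse[OF g]] .
    then have tz: "thinning s ?f z = 0" using low_pos[OF finite_collapse[OF g]] \<open>s = 1\<close> by (simp add: thinning_def)
    obtain i where i: "z = place k g \<mu> (int i)" using z(1) unfolding set_collapse[OF g] by blast
    have "int i \<notin> g ` lifts (set_pmf ?\<nu>)"
    proof
      assume "int i \<in> g ` lifts (set_pmf ?\<nu>)"
      then obtain x where x: "x \<in> lifts (set_pmf ?\<nu>)" "g x = int i" by auto
      have "x \<in> lifts (set_pmf \<mu>)" using x(1) lifts_mono[OF \<nu>(2)] by blast
      then have "spot k g \<mu> (cis x) = z" using spot_cis[OF indexed_pindex[OF g]] x(2) i by (simp add: place_def)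
      moreover have "thinning s ?f (spot k g \<mu> (cis x)) \<noteq> 0"
        using x(1) by (simp add: lifts_def thin_def set_reweight[OF density_thin(1)[OF g s]])
      ultimately show False using tz by simp
    qed
    then show "l < k" using l(2) by blast
  next
    fix t :: real assume t: "0 \<le> t" "t \<le> 1"
    then show "move k g \<mu> s t \<in> V r l" using ex V_iff_indexed[OF r] by blast
    show "(move k g \<mu> s t, move k g \<mu> s 1) \<in> collapse_rel r"
      using ex[OF t] ex[of 1] collapse_relI[OF r] by fastforce
  qed
qed

text \<open>Two indices differ by a constant, which shifts all centers by the same multiple of
  \<open>step k\<close>; these shifts cancel in \<open>spot\<close>, \<open>thin\<close> and
  \<open>glide\<close>.\<close>

lemma move_index_independent:
  assumes r: "0 \<le> r" "r < pi" and g: "indexed r k g \<mu>" and g': "indexed r k g' \<mu>"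
    and s: "thinnable k (collapse k g \<mu>) s"
  shows "move k g \<mu> s t = move k g' \<mu> s t"
proof -
  let ?S = "lifts (set_pmf \<mu>)"
  obtain c where c: "\<And>x. x \<in> ?S \<Longrightarrow> g' x = g x + c"
    using pindex_unique[OF indexed_run[OF g] indexed_pindex[OF g']] by blast
  have A: "Arg p \<in> ?S" if "p \<in> set_pmf \<mu>" for p
    using Pfin_D(2)[OF indexed_Pfin[OF g] that] Arg_lifts that by blast
  have cen: "center k g' \<nu> = center k g \<nu> - step k * of_int c"
    if \<nu>: "set_pmf \<nu> \<subseteq> set_pmf \<mu>" "\<nu> \<in> Pfin" for \<nu>
  proof -
    have fin: "finite (set_pmf \<nu>)" using \<nu>(2) Pfin_D by blast
    have "center k g' \<nu> = (\<Sum>p\<in>set_pmf \<nu>. pmf \<nu> p * dev k g p - pmf \<nu> p * (step k * of_int c))"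
      unfolding center_def expectation_finite[OF fin]
      using \<nu>(1) c A by (intro sum.cong refl) (auto simp: dev_def algebra_simps)
    also have "\<dots> = center k g \<nu> - (\<Sum>p\<in>set_pmf \<nu>. pmf \<nu> p) * (step k * of_int c)"
      unfolding center_def expectation_finite[OF fin] sum_subtractf sum_distrib_right ..
    also have "(\<Sum>p\<in>set_pmf \<nu>. pmf \<nu> p) = 1" using sum_pmf_eq_1[OF fin order_refl] .
    finally show ?thesis by simp
  qed
  have spot: "spot k g' \<mu> p = spot k g \<mu> p" if "p \<in> set_pmf \<mu>" for p
  proof -
    have "step k * of_int (g' (Arg p)) + center k g' \<mu> = step k * of_int (g (Arg p)) + center k g \<mu>"
      using cen[OF order_refl indexed_Pfin[OF g]] c[OF A[OF that]] by (simp add: algebra_simps)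
    then show ?thesis by (simp add: spot_def)
  qed
  have col: "collapse k g' \<mu> = collapse k g \<mu>" using collapse_unique[OF r g' g] .
  have thin: "thin k g' \<mu> s = thin k g \<mu> s"
  proof -
    have "pmf \<mu> p * thinning s (collapse k g \<mu>) (spot k g' \<mu> p) = pmf \<mu> p * thinning s (collapse k g \<mu>) (spot k g \<mu> p)" for p
      using spot[of p] by (cases "p \<in> set_pmf \<mu>") (auto simp: set_pmf_iff)
    then show ?thesis unfolding thin_def reweight_def col by (simp only:)
  qed
  note \<nu> = thin_Pfin[OF g s]
  have "glide k g' \<mu> s t (Arg p) = glide k g \<mu> s t (Arg p)" if p: "p \<in> set_pmf (thin k g \<mu> s)" for p
  proof -
    have "g' (Arg p) = g (Arg p) + c" using c[OF A] p \<nu>(2) by blast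
    then show ?thesis
      unfolding glide_def thin cen[OF order_refl indexed_Pfin[OF g]] cen[OF \<nu>(2,1)]
      by (simp add: algebra_simps)
  qed
  then show ?thesis unfolding move_def push_def thin by (intro map_pmf_cong refl) simp
qed

subsection \<open>Comparing nearby measures\<close>

text \<open>Half of the gap \<open>pi - r\<close>. A pair of support points within a half turn is
  within \<open>r\<close>, so when both move by less than \<open>radius r\<close>, neither passes
  the antipode of the other.\<close>

definition radius :: "real \<Rightarrow> real" where "radius r = (pi - r) / 2"

definition matched :: "real \<Rightarrow> complex pmf \<Rightarrow> (real \<Rightarrow> int) \<Rightarrow> complex pmf \<Rightarrow> (real \<Rightarrow> int) \<Rightarrow> bool" where
  "matched r \<mu> g \<mu>' g' \<longleftrightarrow>
     (\<forall>x\<in>lifts (set_pmf \<mu>). \<forall>y\<in>lifts (set_pmf \<mu>'). \<bar>x - y\<bar> < radius r \<longrightarrow> g' y = g x)"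

definition covers :: "real \<Rightarrow> complex pmf \<Rightarrow> complex pmf \<Rightarrow> bool" where
  "covers r \<mu> \<mu>' \<longleftrightarrow> (\<forall>p\<in>set_pmf \<mu>. \<exists>q\<in>set_pmf \<mu>'. dist_circle p q < radius r)"

lemma radius_pos: "r < pi \<Longrightarrow> 0 < radius r" by (simp add: radius_def)

text \<open>Consecutive runs are separated by the window that a support point between their antipodes
  excludes.\<close>

lemma same_run:
  assumes g: "run_index S k g" and sp: "spread r S" and xy: "x \<in> S" "y \<in> S" "\<bar>x - y\<bar> < 2 * (pi - r)"
  shows "g x = g y"
proof -
  have "\<not> g x < g y" if xy: "x \<in> S" "y \<in> S" "\<bar>x - y\<bar> < 2 * (pi - r)" for x y
  proof
    assume "g x < g y"
    from run_index_separated[OF g xy(2) this xy(1)]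
    obtain w where w: "w \<in> S" "x < w + pi" "w + pi \<le> y" .
    then show False using spread_le[OF sp xy(1) w(1)] spread_ge[OF sp xy(2) w(1)] xy(3) by simp
  qed
  from this[OF xy] this[OF xy(2,1)] show ?thesis using xy(3) by (simp add: abs_minus_commute)
qed

lemma covers_lift:
  assumes cov: "covers r \<mu> \<mu>'" and P: "\<mu> \<in> Pfin" "\<mu>' \<in> Pfin" and x: "x \<in> lifts (set_pmf \<mu>)"
  obtains y where "y \<in> lifts (set_pmf \<mu>')" "\<bar>x - y\<bar> < radius r"
proof -
  obtain q where q: "q \<in> set_pmf \<mu>'" "dist_circle (cis x) q < radius r"
    using cov x by (auto simp: covers_def lifts_def)
  obtain y where y: "cis y = q" "\<bar>x - y\<bar> \<le> pi" using ex_lift[OF Pfin_D(2)[OF P(2) q(1)]] .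
  have "\<bar>x - y\<bar> < radius r" using dist_circle_eqI[OF y(2)] q(2) y(1) by simp
  then show ?thesis using that y q by (auto simp: lifts_def)
qed

text \<open>Only \<open>\<mu>\<close> has to be covered, since a nearby \<open>\<mu>'\<close> may
  have many further points of small mass. The index is pulled back along a choice \<open>Y\<close>
  of nearby points; all candidates for one point lie in the same run.\<close>

lemma matching_pindex:
  assumes r: "0 \<le> r" "r < pi" and \<mu>: "\<mu> \<in> Pfin" "spread r (lifts (set_pmf \<mu>))"
    and g': "indexed r k g' \<mu>'" and cov: "covers r \<mu> \<mu>'"
  obtains g where "pindex (lifts (set_pmf \<mu>)) k g" "matched r \<mu> g \<mu>' g'"
proof -
  let ?S = "lifts (set_pmf \<mu>)" and ?S' = "lifts (set_pmf \<mu>')" and ?\<rho> = "radius r"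
  note sp' = indexed_spread[OF g'] and ri' = indexed_run[OF g'] and pi' = indexed_pindex[OF g']
  define Y where "Y x = (SOME y. y \<in> ?S' \<and> \<bar>x - y\<bar> < ?\<rho>)" for x
  have Y: "Y x \<in> ?S' \<and> \<bar>x - Y x\<bar> < ?\<rho>" if "x \<in> ?S" for x
    unfolding Y_def
  proof (rule someI_ex)
    show "\<exists>y. y \<in> ?S' \<and> \<bar>x - y\<bar> < ?\<rho>" using covers_lift[OF cov \<mu>(1) indexed_Pfin[OF g'] that] by blast
  qed
  have Yb: "x - ?\<rho> < Y x" "Y x < x + ?\<rho>" if "x \<in> ?S" for x
    using Y[OF that] by (auto simp: abs_less_iff)
  have \<rho>: "2 * ?\<rho> = pi - r" by (simp add: radius_def)
  define g where "g x = g' (Y x)" for x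
  have g: "g' y = g x" if "x \<in> ?S" "y \<in> ?S'" "\<bar>x - y\<bar> < ?\<rho>" for x y
  proof -
    have "\<bar>y - Y x\<bar> < 2 * (pi - r)"
      using Y[OF that(1), THEN conjunct2] that(3) r(2) unfolding radius_def by linarith
    then show ?thesis unfolding g_def using same_run[OF ri' sp' that(2)] Y[OF that(1)] by blast
  qed
  have "pindex ?S k g"
    unfolding pindex_def
  proof (intro conjI ballI impI periodic_lifts)
    fix x assume x: "x \<in> ?S"
    have "x + 2 * pi \<in> ?S" "Y x + 2 * pi \<in> ?S'" using x Y[OF x] by (auto simp: lifts_def)
    then have "g (x + 2 * pi) = g' (Y x + 2 * pi)" using g[of "x + 2 * pi" "Y x + 2 * pi"] Y[OF x] by simp
    also have "\<dots> = g x + (2 * int k + 1)" using pi' Y[OF x] by (auto simp: pindex_def g_def)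
    finally show "g (x + 2 * pi) = g x + (2 * int k + 1)" .
  next
    fix x y assume xy: "x \<in> ?S" "y \<in> ?S" "x \<le> y"
    show "g x \<le> g y"
    proof (cases "Y x \<le> Y y")
      case True then show ?thesis unfolding g_def using pindex_mono[OF pi'] Y xy by blast
    next
      case False
      then have "\<bar>Y x - Y y\<bar> < 2 * (pi - r)" using Y[OF xy(1), THEN conjunct2] Y[OF xy(2), THEN conjunct2] xy(3) r(2)
        unfolding radius_def by linarith
      from same_run[OF ri' sp' Y[OF xy(1), THEN conjunct1] Y[OF xy(2), THEN conjunct1] this]
      show ?thesis unfolding g_def by simp
    qed
  next
    fix x w assume xw: "x \<in> ?S" "w \<in> ?S"
    have "x < w + pi \<longleftrightarrow> Y x < Y w + pi"
    proof
      assume "x < w + pi"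
      then have "x \<le> w + r" using spread_le[OF \<mu>(2) xw] by simp
      then show "Y x < Y w + pi" using Yb[OF xw(1)] Yb[OF xw(2)] \<rho> by linarith
    next
      assume lt: "Y x < Y w + pi"
      show "x < w + pi"
      proof (rule ccontr)
        assume "\<not> x < w + pi"
        then have "w + 2 * pi - r \<le> x" using spread_ge[OF \<mu>(2) xw] by simp
        then show False using lt Yb[OF xw(1)] Yb[OF xw(2)] \<rho> by linarith
      qed
    qed
    then show "x < w + pi \<longleftrightarrow> g x \<le> g w + int k"
      unfolding g_def using pindex_less[OF pi', of "Y x" "Y w"] Y[OF xw(1)] Y[OF xw(2)] by blast
  qed
  then show ?thesis using that g by (auto simp: matched_def)
qed

text \<open>The index pulled back from \<open>\<mu>'\<close> has the level of \<open>g\<close> and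
  hence differs from it by a constant, which is subtracted on the side of
  \<open>\<mu>'\<close>.\<close>

lemma matching_index:
  assumes r: "0 \<le> r" "r < pi" and g: "indexed r k g \<mu>" and \<mu>': "\<mu>' \<in> V r k" and cov: "covers r \<mu> \<mu>'"
  shows "\<exists>g'. indexed r k g' \<mu>' \<and> matched r \<mu> g \<mu>' g'"
proof -
  obtain g0 where g0: "indexed r k g0 \<mu>'" using \<mu>' V_iff_indexed[OF r] by blast
  obtain h where h: "pindex (lifts (set_pmf \<mu>)) k h" "matched r \<mu> h \<mu>' g0"
    using matching_pindex[OF r indexed_Pfin[OF g] indexed_spread[OF g] g0 cov] .
  obtain c where c: "\<And>x. x \<in> lifts (set_pmf \<mu>) \<Longrightarrow> h x = g x + c"
    using pindex_unique[OF indexed_run[OF g] h(1)] by blast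
  have "indexed r k (\<lambda>y. g0 y - c) \<mu>'"
    using g0 run_index_add_const[OF indexed_run[OF g0], of "\<lambda>y. g0 y - c" "- c"] by (simp add: indexed_def)
  moreover have "matched r \<mu> g \<mu>' (\<lambda>y. g0 y - c)" using h(2) c by (auto simp: matched_def)
  ultimately show ?thesis by blast
qed

lemma pindex_Arg:
  assumes "pindex S k g" "x \<in> S"
  obtains n where "g (Arg (cis x)) = g x + n * (2 * int k + 1)"
proof -
  obtain n :: int where n: "Arg (cis x) = x + 2 * pi * of_int n" by (rule cis_Arg_cis_shift)
  show ?thesis using that[of n] pindex_shift[OF assms, of n] unfolding n by simp
qed

text \<open>A partial index is required of \<open>\<mu>\<close>, so that the estimates also apply
  when \<open>\<mu>\<close> lies in a lower stratum than \<open>\<mu>'\<close>.\<close>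

locale matched_pair =
  fixes r k \<mu> g \<mu>' g'
  assumes r: "0 \<le> r" "r < pi" and \<mu>: "\<mu> \<in> Pfin" and pindex: "pindex (lifts (set_pmf \<mu>)) k g"
    and ind': "indexed r k g' \<mu>'" and match: "matched r \<mu> g \<mu>' g'" and cov: "covers r \<mu> \<mu>'"
begin

abbreviation "\<rho> \<equiv> radius r"

lemma near_lifts:
  assumes "p \<in> set_pmf \<mu>" "q \<in> set_pmf \<mu>'" "dist_circle p q < \<rho>"
  obtains x y where "x \<in> lifts (set_pmf \<mu>)" "y \<in> lifts (set_pmf \<mu>')" "cis x = p" "cis y = q"
    "\<bar>x - y\<bar> = dist_circle p q" "g' y = g x" "x = Arg p"
proof -
  have x: "cis (Arg p) = p" using Pfin_D(2)[OF \<mu> assms(1)] cis_Arg_circle by blast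
  obtain y where y: "cis y = q" "\<bar>Arg p - y\<bar> \<le> pi" using ex_lift[OF Pfin_D(2)[OF indexed_Pfin[OF ind'] assms(2)]] .
  have d: "\<bar>Arg p - y\<bar> = dist_circle p q" using dist_circle_eqI[OF y(2)] x y by simp
  have "Arg p \<in> lifts (set_pmf \<mu>)" "y \<in> lifts (set_pmf \<mu>')" using x y assms by (auto simp: lifts_def)
  then show ?thesis using that[of "Arg p" y] x y d assms(3) match by (auto simp: matched_def)
qed

lemma near_index:
  assumes "p \<in> set_pmf \<mu>" "q \<in> set_pmf \<mu>'" "dist_circle p q < \<rho>"
  obtains n where "g' (Arg q) = g (Arg p) + n * (2 * int k + 1)"
proof -
  obtain x y where xy: "y \<in> lifts (set_pmf \<mu>')" "cis y = q" "g' y = g x" "x = Arg p"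
    by (rule near_lifts[OF assms])
  obtain n where "g' (Arg (cis y)) = g' y + n * (2 * int k + 1)" by (rule pindex_Arg[OF indexed_pindex[OF ind'] xy(1)])
  then show ?thesis using that xy by simp
qed

lemma near_dev:
  assumes "p \<in> set_pmf \<mu>" "q \<in> set_pmf \<mu>'" "dist_circle p q < \<rho>"
  shows "\<bar>dev k g p - dev k g' q\<bar> = dist_circle p q"
proof -
  obtain x y where xy: "x \<in> lifts (set_pmf \<mu>)" "y \<in> lifts (set_pmf \<mu>')" "cis x = p" "cis y = q"
    "\<bar>x - y\<bar> = dist_circle p q" "g' y = g x" by (rule near_lifts[OF assms])
  show ?thesis using dev_cis[OF pindex xy(1)] dev_cis[OF indexed_pindex[OF ind'] xy(2)] xy by simp
qed

text \<open>Near points belong to runs of the same index modulo full turns, so the two indicator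
  functions agree on near pairs.\<close>

lemma mass_diff:
  "\<bar>measure_pmf.expectation \<mu> (indicator {p. \<exists>n. g (Arg p) = i + n * (2 * int k + 1)})
     - pmf (collapse k g' \<mu>') (place k g' \<mu>' i)\<bar> \<le> 1 / \<rho> * wasserstein \<mu> \<mu>'"
proof -
  let ?A = "{p. \<exists>n. g (Arg p) = i + n * (2 * int k + 1)}" and ?B = "{p. \<exists>n. g' (Arg p) = i + n * (2 * int k + 1)}"
  have "p \<in> ?A \<longleftrightarrow> q \<in> ?B" if pq: "p \<in> set_pmf \<mu>" "q \<in> set_pmf \<mu>'" "dist_circle p q < \<rho>" for p q
  proof -
    obtain n where n: "g' (Arg q) = g (Arg p) + n * (2 * int k + 1)" by (rule near_index[OF pq])
    have "g (Arg p) = i + m * (2 * int k + 1) \<longleftrightarrow> g' (Arg q) = i + (m + n) * (2 * int k + 1)" for m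
      unfolding n by (simp add: algebra_simps)
    then have "p \<in> ?A \<Longrightarrow> q \<in> ?B" "q \<in> ?B \<Longrightarrow> p \<in> ?A"
      unfolding mem_Collect_eq by (metis, metis diff_add_cancel)
    then show ?thesis by blast
  qed
  then have "\<bar>measure_pmf.expectation \<mu> (indicator ?A) - measure_pmf.expectation \<mu>' (indicator ?B)\<bar> \<le> 0 + (0 + 1 / \<rho>) * wasserstein \<mu> \<mu>'"
    using radius_pos[OF r(2)]
    by (intro expectation_diff_le[OF \<mu> indexed_Pfin[OF ind']]) (auto simp: indicator_def)
  then show ?thesis by (simp add: pmf_collapse)
qed

end

text \<open>The lift \<open>y\<close> of \<open>q\<close> in the turn after \<open>p\<close> has no
  smaller index, so \<open>dev\<close> can have gained no more than the \<open>2 * pi\<close>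
  passed.\<close>

lemma dev_diff_le:
  assumes P: "pindex (lifts (set_pmf \<mu>)) k g" "\<mu> \<in> Pfin" and pq: "p \<in> set_pmf \<mu>" "q \<in> set_pmf \<mu>"
  shows "\<bar>dev k g p - dev k g q\<bar> \<le> 2 * pi"
proof -
  have less: "dev k g q - dev k g p \<le> 2 * pi" if pq: "p \<in> set_pmf \<mu>" "q \<in> set_pmf \<mu>" for p q
  proof -
    have p: "cis (Arg p) = p" using Pfin_D(2)[OF P(2) pq(1)] cis_Arg_circle by blast
    obtain y where y: "cis y = q" "\<bar>(Arg p + pi) - y\<bar> \<le> pi" using ex_lift[OF Pfin_D(2)[OF P(2) pq(2)]] .
    have S: "Arg p \<in> lifts (set_pmf \<mu>)" "y \<in> lifts (set_pmf \<mu>)" using p y pq by (auto simp: lifts_def)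
    have "Arg p \<le> y" using y(2) by linarith
    then have "g (Arg p) \<le> g y" using pindex_mono[OF P(1) S] by blast
    then have "step k * of_int (g (Arg p)) \<le> step k * of_int (g y)" using step_pos[of k] by simp
    moreover have "y - Arg p \<le> 2 * pi" using y(2) by linarith
    ultimately show ?thesis using dev_cis[OF P(1) S(1)] dev_cis[OF P(1) S(2)] p y(1) by simp
  qed
  from less[OF pq] less[OF pq(2,1)] show ?thesis by linarith
qed

context matched_pair
begin

text \<open>A detour through a point of \<open>\<mu>'\<close> close to \<open>p\<close>; any bound
  independent of \<open>\<mu>'\<close> would serve.\<close>

lemma far_dev:
  assumes "p \<in> set_pmf \<mu>" "q \<in> set_pmf \<mu>'"
  shows "\<bar>dev k g p - dev k g' q\<bar> \<le> 5 * pi"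
proof -
  obtain q0 where q0: "q0 \<in> set_pmf \<mu>'" "dist_circle p q0 < \<rho>" using cov assms(1) by (auto simp: covers_def)
  have "\<bar>dev k g p - dev k g' q0\<bar> < \<rho>" using near_dev[OF assms(1) q0] q0(2) by simp
  moreover have "\<bar>dev k g' q0 - dev k g' q\<bar> \<le> 2 * pi"
    by (rule dev_diff_le[OF indexed_pindex[OF ind'] indexed_Pfin[OF ind'] q0(1) assms(2)])
  moreover have "\<rho> \<le> pi" using r by (simp add: radius_def)
  ultimately show ?thesis using pi_gt_zero by linarith
qed

lemma center_diff: "\<bar>center k g \<mu> - center k g' \<mu>'\<bar> \<le> (1 + 5 * pi / \<rho>) * wasserstein \<mu> \<mu>'"
  using expectation_diff_le[OF \<mu> indexed_Pfin[OF ind'], of \<rho> "dev k g" "dev k g'" 0 1 "5 * pi"]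
    near_dev far_dev radius_pos[OF r(2)] by (simp add: center_def)

end

lemma matched_pairI:
  assumes "0 \<le> r" "r < pi" "indexed r k g \<mu>" "indexed r k g' \<mu>'" "matched r \<mu> g \<mu>' g'" "covers r \<mu> \<mu>'"
  shows "matched_pair r k \<mu> g \<mu>' g'"
  using assms indexed_Pfin indexed_pindex by unfold_locales blast+

lemma covers_close:
  assumes \<mu>: "\<mu> \<in> Pfin" and r: "r < pi"
  obtains \<epsilon> where "\<epsilon> > 0" "\<And>\<mu>'. \<mu>' \<in> Pfin \<Longrightarrow> wasserstein \<mu> \<mu>' < \<epsilon> \<Longrightarrow> covers r \<mu> \<mu>'"
proof -
  have fin: "finite (set_pmf \<mu>)" using Pfin_D[OF \<mu>] by blast
  let ?e = "radius r * low \<mu>"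
  have "?e > 0" using radius_pos[OF r] low_pos[OF fin] by simp
  moreover have "covers r \<mu> \<mu>'" if "\<mu>' \<in> Pfin" "wasserstein \<mu> \<mu>' < ?e" for \<mu>'
    unfolding covers_def
  proof
    fix p assume p: "p \<in> set_pmf \<mu>"
    have "?e \<le> radius r * pmf \<mu> p" using low_le[OF fin p] radius_pos[OF r] by simp
    then show "\<exists>q\<in>set_pmf \<mu>'. dist_circle p q < radius r"
      using wasserstein_covers[OF \<mu> that(1) p] that(2) by simp
  qed
  ultimately show ?thesis using that by blast
qed

text \<open>A stratum of higher index is left only through the loss of the mass of a whole arc.\<close>

lemma low_small:
  assumes r: "0 \<le> r" "r < pi" and VR: "\<mu> \<in> VR r" and notV: "\<mu> \<notin> V r k" and "\<epsilon> > 0"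
  obtains \<delta> where "\<delta> > 0"
    "\<And>\<mu>' g'. indexed r k g' \<mu>' \<Longrightarrow> wasserstein \<mu> \<mu>' < \<delta> \<Longrightarrow> low (collapse k g' \<mu>') < \<epsilon>"
proof -
  have P: "\<mu> \<in> Pfin" "spread r (lifts (set_pmf \<mu>))" using VR_iff[OF r] VR by auto
  obtain \<epsilon>' where e': "\<epsilon>' > 0" "\<And>\<mu>'. \<mu>' \<in> Pfin \<Longrightarrow> wasserstein \<mu> \<mu>' < \<epsilon>' \<Longrightarrow> covers r \<mu> \<mu>'"
    using covers_close[OF P(1) r(2)] by blast
  have rp: "radius r > 0" using radius_pos[OF r(2)] .
  have "low (collapse k g' \<mu>') < \<epsilon>" if g': "indexed r k g' \<mu>'" and W: "wasserstein \<mu> \<mu>' < min \<epsilon>' (radius r * \<epsilon>)" for \<mu>' g'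
  proof (rule ccontr)
    assume big: "\<not> low (collapse k g' \<mu>') < \<epsilon>"
    have cov: "covers r \<mu> \<mu>'" using e'(2)[OF indexed_Pfin[OF g']] W by simp
    obtain g where g: "pindex (lifts (set_pmf \<mu>)) k g" "matched r \<mu> g \<mu>' g'"
      by (rule matching_pindex[OF r P g' cov])
    interpret matched_pair r k \<mu> g \<mu>' g' using r P g' g cov by unfold_locales
    have "\<exists>x\<in>lifts (set_pmf \<mu>). g x = i" for i
    proof -
      let ?A = "{p. \<exists>n. g (Arg p) = i + n * (2 * int k + 1)}"
      have "\<epsilon> \<le> pmf (collapse k g' \<mu>') (place k g' \<mu>' i)"
        using big low_le[OF finite_collapse[OF g'] place_in_collapse[OF g', of i]] by simp
      moreover have "1 / \<rho> * wasserstein \<mu> \<mu>' < \<epsilon>" using W rp by (simp add: field_simps)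
      ultimately have "0 < measure_pmf.expectation \<mu> (indicat_real ?A)" using mass_diff[of i] by linarith
      then have "0 < measure_pmf.prob \<mu> ?A" by simp
      then have "set_pmf \<mu> \<inter> ?A \<noteq> {}" by (metis Int_commute measure_Int_set_pmf measure_empty less_irrefl)
      then obtain p n where p: "p \<in> set_pmf \<mu>" "g (Arg p) = i + n * (2 * int k + 1)" by blast
      have A: "Arg p \<in> lifts (set_pmf \<mu>)" using Pfin_D(2)[OF P(1) p(1)] Arg_lifts p(1) by blast
      show ?thesis
        using periodic_shift[OF periodic_lifts A, of "- n"] pindex_shift[OF g(1) A, of "- n"] p(2)
        by (intro bexI[of _ "Arg p + 2 * pi * of_int (- n)"]) simp_all
    qed
    then have "indexed r k g \<mu>" using P g(1) by (simp add: indexed_def run_index_def)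
    then show False using notV V_iff_indexed[OF r] by blast
  qed
  then show ?thesis using that[of "min \<epsilon>' (radius r * \<epsilon>)"] e'(1) rp \<open>\<epsilon> > 0\<close> by simp
qed

text \<open>The total mass that thinning removes from each arc is \<open>s * low f\<close>, up to normalisation.\<close>

lemma thinning_variation:
  assumes fin: "finite (set_pmf f)" and s: "0 \<le> s" "s \<le> 1" "real (card (set_pmf f)) * s * low f \<le> 1 / 2"
  shows "measure_pmf.expectation f (\<lambda>z. \<bar>1 - thinning s f z\<bar>) \<le> 4 * real (card (set_pmf f)) * low f"
proof -
  let ?N = "real (card (set_pmf f))" and ?l = "low f"
  let ?D = "1 - ?N * s * ?l"
  have D: "1 / 2 \<le> ?D" using s by simp
  have l: "0 < ?l" using low_pos[OF fin] .
  have "pmf f z * \<bar>1 - thinning s f z\<bar> \<le> 2 * ?l + 2 * ?N * ?l * pmf f z" if z: "z \<in> set_pmf f" for z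
  proof -
    have pz: "0 < pmf f z" using z by (simp add: pmf_positive)
    have "?D / ?D = 1" using D by simp
    then have "1 - thinning s f z = (?D - (1 - s * ?l / pmf f z)) / ?D"
      unfolding thinning_def diff_divide_distrib[of ?D] by (simp only:)
    also have "?D - (1 - s * ?l / pmf f z) = s * ?l / pmf f z - ?N * s * ?l" by linarith
    finally have "1 - thinning s f z = (s * ?l / pmf f z - ?N * s * ?l) / ?D" .
    then have "\<bar>1 - thinning s f z\<bar> = \<bar>s * ?l / pmf f z - ?N * s * ?l\<bar> / ?D" using D by simp
    also have "\<dots> \<le> \<bar>s * ?l / pmf f z - ?N * s * ?l\<bar> / (1 / 2)" using D by (intro divide_left_mono) auto
    also have "\<dots> = 2 * \<bar>s * ?l / pmf f z - ?N * s * ?l\<bar>" by simp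
    also have "\<dots> \<le> 2 * (s * ?l / pmf f z + ?N * s * ?l)"
    proof (rule mult_left_mono)
      have gen: "\<bar>a - b\<bar> \<le> a + b" if "0 \<le> a" "0 \<le> b" for a b :: real using that by linarith
      show "\<bar>s * ?l / pmf f z - ?N * s * ?l\<bar> \<le> s * ?l / pmf f z + ?N * s * ?l"
        by (rule gen) (use s(1) l pz in simp_all)
    qed simp
    also have "\<dots> \<le> 2 * (1 * ?l / pmf f z + ?N * 1 * ?l)"
      using s l pz by (intro mult_left_mono add_mono divide_right_mono mult_right_mono) auto
    finally have "pmf f z * \<bar>1 - thinning s f z\<bar> \<le> pmf f z * (2 * (1 * ?l / pmf f z + ?N * 1 * ?l))"
      using pz by (intro mult_left_mono) auto
    also have "\<dots> = 2 * ?l + 2 * ?N * ?l * pmf f z" using pz by (simp add: field_simps)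
    finally show ?thesis .
  qed
  then have "measure_pmf.expectation f (\<lambda>z. \<bar>1 - thinning s f z\<bar>) \<le> (\<Sum>z\<in>set_pmf f. 2 * ?l + 2 * ?N * ?l * pmf f z)"
    unfolding expectation_finite[OF fin] by (intro sum_mono)
  also have "\<dots> = 4 * ?N * ?l"
    using sum_pmf_eq_1[OF fin order_refl] by (simp add: sum.distrib sum_distrib_left[symmetric])
  finally show ?thesis .
qed

lemma transport_plan_diagonal:
  assumes "\<mu> \<in> Pfin" shows "transport_plan \<mu> \<mu> (\<lambda>p q. if p = q then pmf \<mu> p else 0)"
  using Pfin_D[OF assms] by (auto simp: transport_plan_def sum.delta)

text \<open>This controls the moves where the stratum approaches lower ones: without sliding they
  tend to the identity as the least arc mass tends to zero. Of the factor \<open>12 * pi\<close>,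
  two thirds come from the rotation and one third from the redistributed mass.\<close>

lemma move_near_identity:
  assumes r: "0 \<le> r" "r < pi" and g: "indexed r k g \<mu>" and s: "thinnable k (collapse k g \<mu>) s"
  shows "wasserstein \<mu> (move k g \<mu> s 0) \<le> 12 * pi * real (2 * k + 1) * low (collapse k g \<mu>)"
proof -
  let ?f = "collapse k g \<mu>" and ?A = "set_pmf \<mu>"
  let ?w = "\<lambda>p. thinning s ?f (spot k g \<mu> p)" and ?d = "center k g \<mu> - center k g (thin k g \<mu> s)"
  let ?h = "\<lambda>p. cis (Arg p + ?d)"
  note \<mu> = indexed_Pfin[OF g] and fin = indexed_finite[OF g] and dw = density_thin(1)[OF g s]
  have d1: "density \<mu> (\<lambda>p. 1)" using fin by (simp add: density_def sum_pmf_eq_1)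
  have one: "reweight \<mu> (\<lambda>p. 1) = \<mu>" by (rule pmf_eqI) (simp add: pmf_reweight[OF d1])
  have sum1: "(\<Sum>p\<in>?A. pmf \<mu> p) = 1" using sum_pmf_eq_1[OF fin order_refl] .
  have sumw: "(\<Sum>p\<in>?A. pmf \<mu> p * ?w p) = 1" using dw by (simp add: density_def)
  have "(\<Sum>p\<in>?A. pmf \<mu> p * \<bar>1 - ?w p\<bar>) = measure_pmf.expectation ?f (\<lambda>z. \<bar>1 - thinning s ?f z\<bar>)"
    by (simp add: collapse_def expectation_finite[OF fin])
  also have "\<dots> \<le> 4 * real (2 * k + 1) * low ?f"
    using thinning_variation[OF finite_collapse[OF g], of s] s card_collapse[OF g] by (simp add: thinnable_def)
  finally have var: "(\<Sum>p\<in>?A. pmf \<mu> p * \<bar>1 - ?w p\<bar>) \<le> 4 * real (2 * k + 1) * low ?f" .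
  obtain p0 where p0: "p0 \<in> ?A" using set_pmf_not_empty[of \<mu>] by blast
  have "?d = (\<Sum>p\<in>?A. pmf \<mu> p * (1 - ?w p) * dev k g p)"
    unfolding center_def thin_def expectation_reweight[OF dw] expectation_finite[OF fin] sum_subtractf[symmetric]
    by (intro sum.cong refl) (simp add: algebra_simps)
  \<comment> \<open>The weights \<open>pmf \<mu> p * (1 - ?w p)\<close> add up to zero, so
    \<open>dev\<close> may be taken relative to \<open>p0\<close>, where it is bounded by
    \<open>2 * pi\<close>.\<close>
  also have "\<dots> = (\<Sum>p\<in>?A. pmf \<mu> p * (1 - ?w p) * (dev k g p - dev k g p0))
      + (\<Sum>p\<in>?A. pmf \<mu> p * (1 - ?w p)) * dev k g p0"
    unfolding sum_distrib_right sum.distrib[symmetric] by (intro sum.cong refl) (simp add: algebra_simps)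
  also have "(\<Sum>p\<in>?A. pmf \<mu> p * (1 - ?w p)) = 0" using sum1 sumw by (simp add: right_diff_distrib sum_subtractf)
  finally have "\<bar>?d\<bar> = \<bar>\<Sum>p\<in>?A. pmf \<mu> p * (1 - ?w p) * (dev k g p - dev k g p0)\<bar>" by simp
  also have "\<dots> \<le> (\<Sum>p\<in>?A. \<bar>pmf \<mu> p * (1 - ?w p) * (dev k g p - dev k g p0)\<bar>)" by (rule sum_abs)
  also have "\<dots> \<le> (\<Sum>p\<in>?A. (pmf \<mu> p * \<bar>1 - ?w p\<bar>) * (2 * pi))"
    using dev_diff_le[OF indexed_pindex[OF g] \<mu> _ p0]
    by (intro sum_mono) (simp add: abs_mult mult_left_mono)
  also have "\<dots> \<le> (4 * real (2 * k + 1) * low ?f) * (2 * pi)"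
    unfolding sum_distrib_right[symmetric] using var by (intro mult_right_mono) auto
  finally have d: "\<bar>?d\<bar> \<le> 2 * pi * (4 * real (2 * k + 1) * low ?f)" by (simp add: mult.commute)
  have mv: "move k g \<mu> s 0 = map_pmf ?h (reweight \<mu> ?w)"
    by (simp add: move_def push_def glide_def thin_def)
  have "wasserstein (map_pmf (\<lambda>p. p) (reweight \<mu> (\<lambda>p. 1))) (map_pmf ?h (reweight \<mu> ?w))
    \<le> (\<Sum>p\<in>?A. \<Sum>q\<in>?A. (if p = q then pmf \<mu> p else 0) * (1 * dist_circle p (?h q) + pi * \<bar>1 - ?w q\<bar>))"
    using Pfin_D[OF \<mu>] by (intro wasserstein_reweight_le[OF \<mu> \<mu> transport_plan_diagonal[OF \<mu>] d1 dw]) auto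
  also have "\<dots> = (\<Sum>p\<in>?A. pmf \<mu> p * (dist_circle p (?h p) + pi * \<bar>1 - ?w p\<bar>))"
  proof (rule sum.cong[OF refl])
    fix p assume p: "p \<in> ?A"
    have "(\<Sum>q\<in>?A. (if p = q then pmf \<mu> p else 0) * (1 * dist_circle p (?h q) + pi * \<bar>1 - ?w q\<bar>))
        = (\<Sum>q\<in>?A. if p = q then pmf \<mu> p * (dist_circle p (?h q) + pi * \<bar>1 - ?w q\<bar>) else 0)"
      by (intro sum.cong refl) simp
    then show "(\<Sum>q\<in>?A. (if p = q then pmf \<mu> p else 0) * (1 * dist_circle p (?h q) + pi * \<bar>1 - ?w q\<bar>))
        = pmf \<mu> p * (dist_circle p (?h p) + pi * \<bar>1 - ?w p\<bar>)" using fin p by (simp add: sum.delta)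
  qed
  also have "\<dots> \<le> (\<Sum>p\<in>?A. pmf \<mu> p * (\<bar>?d\<bar> + pi * \<bar>1 - ?w p\<bar>))"
  proof (intro sum_mono mult_left_mono add_right_mono)
    fix p assume "p \<in> ?A"
    then have "cis (Arg p) = p" using Pfin_D(2)[OF \<mu>] cis_Arg_circle by blast
    then show "dist_circle p (?h p) \<le> \<bar>?d\<bar>" using dist_circle_le[of "Arg p" p "Arg p + ?d" "?h p"] by simp
  qed simp
  also have "\<dots> = (\<Sum>p\<in>?A. pmf \<mu> p) * \<bar>?d\<bar> + pi * (\<Sum>p\<in>?A. pmf \<mu> p * \<bar>1 - ?w p\<bar>)"
    by (simp add: distrib_left sum.distrib sum_distrib_left sum_distrib_right mult.left_commute)
  also have "\<dots> \<le> 2 * pi * (4 * real (2 * k + 1) * low ?f) + pi * (4 * real (2 * k + 1) * low ?f)"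
    unfolding sum1 using d var by (intro add_mono mult_left_mono) auto
  finally show ?thesis unfolding mv one by (simp add: algebra_simps)
qed

section \<open>Limits along a filter within one stratum\<close>

lemma tendsto_of_bound:
  fixes X :: "'a \<Rightarrow> real"
  assumes "eventually (\<lambda>z. \<bar>X z - l\<bar> \<le> b z) \<Phi>" "(b \<longlongrightarrow> 0) \<Phi>"
  shows "(X \<longlongrightarrow> l) \<Phi>"
proof -
  have "((\<lambda>z. X z - l) \<longlongrightarrow> 0) \<Phi>" by (rule Lim_null_comparison[OF _ assms(2)]) (use assms(1) in simp)
  then show ?thesis using LIM_zero_iff by blast
qed

lemma tendsto_Min:
  fixes X :: "'i \<Rightarrow> 'a \<Rightarrow> real"
  assumes "finite A" "A \<noteq> {}" "\<And>i. i \<in> A \<Longrightarrow> (X i \<longlongrightarrow> l i) \<Phi>"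
  shows "((\<lambda>z. Min ((\<lambda>i. X i z) ` A)) \<longlongrightarrow> Min (l ` A)) \<Phi>"
  using assms
proof (induction A rule: finite_ne_induct)
  case (insert i A)
  have "((\<lambda>z. min (X i z) (Min ((\<lambda>i. X i z) ` A))) \<longlongrightarrow> min (l i) (Min (l ` A))) \<Phi>"
    using insert by (intro tendsto_min) auto
  then show ?case using insert by simp
qed simp

text \<open>A general filter serves measures and pairs of time and measure alike. \<open>G z\<close>
  is matched with \<open>g\<close>, so the formulas for both measures can be compared run by
  run.\<close>

locale converging =
  fixes r k \<mu> g and \<Phi> :: "'a filter" and M :: "'a \<Rightarrow> complex pmf" and G
  assumes r: "0 \<le> r" "r < pi" and ind: "indexed r k g \<mu>"
    and conv: "((\<lambda>z. wasserstein \<mu> (M z)) \<longlongrightarrow> 0) \<Phi>"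
    and near: "eventually (\<lambda>z. indexed r k (G z) (M z) \<and> matched r \<mu> g (M z) (G z) \<and> covers r \<mu> (M z)) \<Phi>"
begin

abbreviation "f0 \<equiv> collapse k g \<mu>"
abbreviation "f z \<equiv> collapse k (G z) (M z)"

lemma conv_mult: "((\<lambda>z. c * wasserstein \<mu> (M z)) \<longlongrightarrow> 0) \<Phi>"
  using tendsto_mult_left[OF conv, of c] by simp

lemma pair: "eventually (\<lambda>z. matched_pair r k \<mu> g (M z) (G z)) \<Phi>"
  using near by eventually_elim (use matched_pairI[OF r ind] in blast)

lemma near_indexed: "eventually (\<lambda>z. indexed r k (G z) (M z)) \<Phi>"
  using near by eventually_elim blast

lemma mass_lim: "((\<lambda>z. pmf (f z) (place k (G z) (M z) i)) \<longlongrightarrow> pmf f0 (place k g \<mu> i)) \<Phi>"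
proof (rule tendsto_of_bound[OF _ conv_mult])
  show "eventually (\<lambda>z. \<bar>pmf (f z) (place k (G z) (M z) i) - pmf f0 (place k g \<mu> i)\<bar> \<le> 1 / radius r * wasserstein \<mu> (M z)) \<Phi>"
    using pair
  proof eventually_elim
    case (elim z)
    from matched_pair.mass_diff[OF this, of i] show ?case
      unfolding pmf_collapse[symmetric] by (simp add: abs_minus_commute)
  qed
qed

lemma low_collapse: "indexed r k h \<nu> \<Longrightarrow> low (collapse k h \<nu>) = Min ((\<lambda>i. pmf (collapse k h \<nu>) (place k h \<nu> (int i))) ` {..2 * k})"
  unfolding low_def by (simp add: set_collapse image_image)

lemma low_lim: "((\<lambda>z. low (f z)) \<longlongrightarrow> low f0) \<Phi>"
proof (rule Lim_transform_eventually)
  show "((\<lambda>z. Min ((\<lambda>i. pmf (f z) (place k (G z) (M z) (int i))) ` {..2 * k})) \<longlongrightarrow> low f0) \<Phi>"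
    unfolding low_collapse[OF ind] by (rule tendsto_Min) (auto intro: mass_lim)
  show "eventually (\<lambda>z. Min ((\<lambda>i. pmf (f z) (place k (G z) (M z) (int i))) ` {..2 * k}) = low (f z)) \<Phi>"
    using near_indexed by eventually_elim (simp add: low_collapse)
qed

lemma center_lim: "((\<lambda>z. center k (G z) (M z)) \<longlongrightarrow> center k g \<mu>) \<Phi>"
proof (rule tendsto_of_bound[OF _ conv_mult])
  show "eventually (\<lambda>z. \<bar>center k (G z) (M z) - center k g \<mu>\<bar> \<le> (1 + 5 * pi / radius r) * wasserstein \<mu> (M z)) \<Phi>"
    using pair
  proof eventually_elim
    case (elim z)
    from matched_pair.center_diff[OF this] show ?case by (simp add: abs_minus_commute)
  qed
qed

end

locale converging_move = converging +
  fixes s t :: "'a \<Rightarrow> real" and s0 t0 :: real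
  assumes s: "(s \<longlongrightarrow> s0) \<Phi>" and t: "(t \<longlongrightarrow> t0) \<Phi>" and s0: "thinnable k (collapse k g \<mu>) s0"
    and sz: "eventually (\<lambda>z. thinnable k (collapse k (G z) (M z)) (s z)) \<Phi>"
    and tz: "eventually (\<lambda>z. 0 \<le> t z \<and> t z \<le> 1) \<Phi>" and t0: "0 \<le> t0" "t0 \<le> 1"
begin

abbreviation "w0 p \<equiv> thinning s0 f0 (spot k g \<mu> p)"
abbreviation "w z p \<equiv> thinning (s z) (f z) (spot k (G z) (M z) p)"
abbreviation "m0 \<equiv> center k g \<mu>"
abbreviation "m z \<equiv> center k (G z) (M z)"
abbreviation "n0 \<equiv> center k g (thin k g \<mu> s0)"
abbreviation "n z \<equiv> center k (G z) (thin k (G z) (M z) (s z))"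

text \<open>Thinning factors depend on the arc only, so finitely many terms bound their difference
  on all near pairs at once.\<close>

definition gap :: "'a \<Rightarrow> real" where
  "gap z = (\<Sum>i\<le>2 * k. \<bar>thinning (s z) (f z) (place k (G z) (M z) (int i)) - thinning s0 f0 (place k g \<mu> (int i))\<bar>)"

lemma thinning_lim:
  "((\<lambda>z. thinning (s z) (f z) (place k (G z) (M z) i)) \<longlongrightarrow> thinning s0 f0 (place k g \<mu> i)) \<Phi>"
proof (rule Lim_transform_eventually)
  let ?N = "real (2 * k + 1)"
  have "?N * s0 * low f0 \<le> 1 / 2" using s0 by (simp add: thinnable_def)
  then have "1 - ?N * s0 * low f0 \<noteq> 0" by linarith
  moreover have "pmf f0 (place k g \<mu> i) \<noteq> 0" using place_in_collapse[OF ind] by (simp add: set_pmf_iff)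
  ultimately show "((\<lambda>z. (1 - s z * low (f z) / pmf (f z) (place k (G z) (M z) i)) / (1 - ?N * s z * low (f z)))
      \<longlongrightarrow> thinning s0 f0 (place k g \<mu> i)) \<Phi>"
    unfolding thinning_def card_collapse[OF ind]
    by (intro tendsto_divide tendsto_diff tendsto_mult tendsto_const s low_lim mass_lim)
  show "eventually (\<lambda>z. (1 - s z * low (f z) / pmf (f z) (place k (G z) (M z) i)) / (1 - ?N * s z * low (f z))
      = thinning (s z) (f z) (place k (G z) (M z) i)) \<Phi>"
    using near_indexed by eventually_elim (simp only: thinning_def card_collapse)
qed

lemma gap_lim: "(gap \<longlongrightarrow> 0) \<Phi>"
proof -
  have "((\<lambda>z. \<Sum>i\<le>2 * k. \<bar>thinning (s z) (f z) (place k (G z) (M z) (int i)) - thinning s0 f0 (place k g \<mu> (int i))\<bar>)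
      \<longlongrightarrow> (\<Sum>i\<le>2 * k. \<bar>thinning s0 f0 (place k g \<mu> (int i)) - thinning s0 f0 (place k g \<mu> (int i))\<bar>)) \<Phi>"
    by (intro tendsto_intros thinning_lim)
  then show ?thesis unfolding gap_def by simp
qed

lemma gap_nonneg: "0 \<le> gap z" unfolding gap_def by (intro sum_nonneg) simp

lemma near_thin:
  assumes pr: "matched_pair r k \<mu> g (M z) (G z)"
    and pq: "p \<in> set_pmf \<mu>" "q \<in> set_pmf (M z)" "dist_circle p q < radius r"
  shows "\<bar>w0 p - w z q\<bar> \<le> gap z"
proof -
  have "place k g \<mu> (g (Arg p)) \<in> range (place k g \<mu>)" by blast
  then obtain i where i: "i \<le> 2 * k" "place k g \<mu> (g (Arg p)) = place k g \<mu> (int i)"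
    unfolding range_place by auto
  obtain n where n: "G z (Arg q) = g (Arg p) + n * (2 * int k + 1)"
    by (rule matched_pair.near_index[OF pr pq])
  obtain n' where n': "g (Arg p) = int i + n' * (2 * int k + 1)" using i(2) place_eq_iff by blast
  have "G z (Arg q) = int i + (n + n') * (2 * int k + 1)" unfolding n n' by (simp add: algebra_simps)
  then have "spot k (G z) (M z) q = place k (G z) (M z) (int i)" unfolding spot_place place_eq_iff by blast
  moreover have "spot k g \<mu> p = place k g \<mu> (int i)" using i(2) by (simp add: spot_place)
  moreover have "\<bar>thinning (s z) (f z) (place k (G z) (M z) (int i)) - thinning s0 f0 (place k g \<mu> (int i))\<bar> \<le> gap z"
    unfolding gap_def
    by (rule member_le_sum[where f = "\<lambda>i. \<bar>thinning (s z) (f z) (place k (G z) (M z) (int i)) - thinning s0 f0 (place k g \<mu> (int i))\<bar>"])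
      (use i(1) in auto)
  ultimately show ?thesis by (simp add: abs_minus_commute)
qed

lemma thinning_range:
  assumes "indexed r k h \<nu>" "thinnable k (collapse k h \<nu>) c" "p \<in> set_pmf \<nu>"
  shows "0 \<le> thinning c (collapse k h \<nu>) (spot k h \<nu> p)" "thinning c (collapse k h \<nu>) (spot k h \<nu> p) \<le> 2"
proof -
  have "spot k h \<nu> p \<in> set_pmf (collapse k h \<nu>)" using assms(3) by (simp add: collapse_def)
  from thinning_nonneg[OF finite_collapse[OF assms(1)] _ _ _ this, of c]
  show "0 \<le> thinning c (collapse k h \<nu>) (spot k h \<nu> p)" "thinning c (collapse k h \<nu>) (spot k h \<nu> p) \<le> 2"
    using assms(2) card_collapse[OF assms(1)] by (auto simp: thinnable_def)
qed

lemma center_thin: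
  assumes "indexed r k h \<nu>" "thinnable k (collapse k h \<nu>) c"
  shows "center k h (thin k h \<nu> c) = measure_pmf.expectation \<nu> (\<lambda>p. thinning c (collapse k h \<nu>) (spot k h \<nu> p) * dev k h p)"
  unfolding center_def thin_def expectation_reweight[OF density_thin(1)[OF assms]] expectation_finite[OF indexed_finite[OF assms(1)]]
  by (simp add: mult.assoc)

lemma dev_bound:
  obtains D where "0 \<le> D" "\<And>p. p \<in> set_pmf \<mu> \<Longrightarrow> \<bar>dev k g p\<bar> \<le> D"
proof (rule that)
  have fin: "finite (set_pmf \<mu>)" using indexed_finite[OF ind] .
  show "0 \<le> (\<Sum>p\<in>set_pmf \<mu>. \<bar>dev k g p\<bar>)" by (intro sum_nonneg) simp
  show "\<bar>dev k g p\<bar> \<le> (\<Sum>p\<in>set_pmf \<mu>. \<bar>dev k g p\<bar>)" if "p \<in> set_pmf \<mu>" for p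
    using member_le_sum[OF that, of "\<lambda>p. \<bar>dev k g p\<bar>"] fin by simp
qed

text \<open>The center of a thinned measure is the mean of the density times \<open>dev\<close>. On
  near pairs the density changes by at most \<open>gap z\<close> and \<open>dev\<close> by the
  distance of the points.\<close>

lemma center_thin_lim: "(n \<longlongrightarrow> n0) \<Phi>"
proof -
  obtain D where D: "0 \<le> D" "\<And>p. p \<in> set_pmf \<mu> \<Longrightarrow> \<bar>dev k g p\<bar> \<le> D" using dev_bound by blast
  \<comment> \<open>\<open>C\<close> bounds \<open>dev\<close> on both measures, on
    \<open>M z\<close> by comparison with \<open>\<mu>\<close> through
    \<open>far_dev\<close>.\<close>
  define C where "C = D + 5 * pi"
  have C: "0 < C" "D \<le> C" using D(1) by (simp_all add: C_def add_nonneg_pos)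
  have bd: "((\<lambda>z. gap z * C + (2 + 4 * C / radius r) * wasserstein \<mu> (M z)) \<longlongrightarrow> 0) \<Phi>"
    using tendsto_add[OF tendsto_mult_right[OF gap_lim, of C] conv_mult] by simp
  have "eventually (\<lambda>z. \<bar>n z - n0\<bar> \<le> gap z * C + (2 + 4 * C / radius r) * wasserstein \<mu> (M z)) \<Phi>"
    using near_indexed pair sz
  proof eventually_elim
    case (elim z)
    have dz: "\<bar>dev k (G z) q\<bar> \<le> C" if "q \<in> set_pmf (M z)" for q
    proof -
      obtain p where p: "p \<in> set_pmf \<mu>" using set_pmf_not_empty[of \<mu>] by blast
      show ?thesis using matched_pair.far_dev[OF elim(2) p that] D(2)[OF p] by (simp add: C_def)
    qed
    have "\<bar>measure_pmf.expectation \<mu> (\<lambda>p. w0 p * dev k g p) - measure_pmf.expectation (M z) (\<lambda>p. w z p * dev k (G z) p)\<bar>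
        \<le> gap z * C + (2 + 4 * C / radius r) * wasserstein \<mu> (M z)"
    proof (rule expectation_diff_le[OF indexed_Pfin[OF ind] indexed_Pfin[OF elim(1)]])
      fix p q assume pq: "p \<in> set_pmf \<mu>" "q \<in> set_pmf (M z)"
      note w = thinning_range[OF ind s0 pq(1)] thinning_range[OF elim(1,3) pq(2)]
      have a: "\<bar>w0 p * dev k g p\<bar> \<le> 2 * C"
        unfolding abs_mult using w D(2)[OF pq(1)] C by (intro mult_mono) auto
      have b: "\<bar>w z q * dev k (G z) q\<bar> \<le> 2 * C"
        unfolding abs_mult using w dz[OF pq(2)] by (intro mult_mono) auto
      show "\<bar>w0 p * dev k g p - w z q * dev k (G z) q\<bar> \<le> 4 * C" using a b by linarith
      assume d: "dist_circle p q < radius r"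
      have "w0 p * dev k g p - w z q * dev k (G z) q
          = w0 p * (dev k g p - dev k (G z) q) + (w0 p - w z q) * dev k (G z) q" by (simp add: algebra_simps)
      also have "\<bar>\<dots>\<bar> \<le> \<bar>w0 p\<bar> * \<bar>dev k g p - dev k (G z) q\<bar> + \<bar>w0 p - w z q\<bar> * \<bar>dev k (G z) q\<bar>"
        unfolding abs_mult[symmetric] by (rule abs_triangle_ineq)
      also have "\<dots> \<le> 2 * dist_circle p q + gap z * C"
      proof (intro add_mono mult_mono)
        show "\<bar>dev k g p - dev k (G z) q\<bar> \<le> dist_circle p q"
          using matched_pair.near_dev[OF elim(2) pq d] by simp
        show "\<bar>w0 p - w z q\<bar> \<le> gap z" by (rule near_thin[OF elim(2) pq d])
      qed (use w dz[OF pq(2)] gap_nonneg in auto)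
      finally show "\<bar>w0 p * dev k g p - w z q * dev k (G z) q\<bar> \<le> gap z * C + 2 * dist_circle p q" by simp
    qed (use radius_pos[OF r(2)] C gap_nonneg in auto)
    then show ?case unfolding center_thin[OF ind s0] center_thin[OF elim(1,3)] by (simp add: abs_minus_commute)
  qed
  then show ?thesis by (rule tendsto_of_bound[OF _ bd])
qed

text \<open>On near pairs the glides differ by the distance of the points plus the differences of
  centers and times. In the final bound, \<open>2\<close> bounds the densities and \<open>pi\<close>
  the distances.\<close>

lemma move_lim: "((\<lambda>z. wasserstein (move k g \<mu> s0 t0) (move k (G z) (M z) (s z) (t z))) \<longlongrightarrow> 0) \<Phi>"
proof -
  obtain D where D: "0 \<le> D" "\<And>p. p \<in> set_pmf \<mu> \<Longrightarrow> \<bar>dev k g p\<bar> \<le> D" using dev_bound by blast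
  define B where "B = D + \<bar>n0\<bar>"
  define e where "e z = \<bar>m0 - m z\<bar> + \<bar>n0 - n z\<bar> + \<bar>m0 - m z\<bar> + \<bar>t0 - t z\<bar> * B" for z
  have e0: "0 \<le> e z" for z using D(1) by (simp add: e_def B_def)
  have "(e \<longlongrightarrow> \<bar>m0 - m0\<bar> + \<bar>n0 - n0\<bar> + \<bar>m0 - m0\<bar> + \<bar>t0 - t0\<bar> * B) \<Phi>"
    unfolding e_def by (intro tendsto_intros center_lim center_thin_lim t)
  then have elim0: "(e \<longlongrightarrow> 0) \<Phi>" by simp
  let ?b = "\<lambda>z. (2 * e z + pi * gap z) + (2 + 2 * pi * 2 / radius r) * wasserstein \<mu> (M z)"
  have "(?b \<longlongrightarrow> (2 * 0 + pi * 0) + 0) \<Phi>"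
    by (intro tendsto_add tendsto_mult tendsto_const elim0 gap_lim conv_mult)
  then have bd: "(?b \<longlongrightarrow> 0) \<Phi>" by simp
  have "eventually (\<lambda>z. \<bar>wasserstein (move k g \<mu> s0 t0) (move k (G z) (M z) (s z) (t z)) - 0\<bar> \<le> ?b z) \<Phi>"
    using near_indexed pair sz tz
  proof eventually_elim
    case (elim z)
    let ?ha = "\<lambda>p. cis (glide k g \<mu> s0 t0 (Arg p))" and ?h = "\<lambda>p. cis (glide k (G z) (M z) (s z) (t z) (Arg p))"
    have pi': "pindex (lifts (set_pmf (M z))) k (G z)" using indexed_pindex[OF elim(1)] .
    have "wasserstein (map_pmf ?ha (reweight \<mu> w0)) (map_pmf ?h (reweight (M z) (w z))) \<le> ?b z"
    proof (rule wasserstein_reweight_estimate[OF indexed_Pfin[OF ind] indexed_Pfin[OF elim(1)]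
          density_thin(1)[OF ind s0] density_thin(1)[OF elim(1,3)]])
      fix p q assume pq: "p \<in> set_pmf \<mu>" "q \<in> set_pmf (M z)" "dist_circle p q < radius r"
      obtain x y where xy: "x \<in> lifts (set_pmf \<mu>)" "y \<in> lifts (set_pmf (M z))" "cis x = p" "cis y = q"
        "\<bar>x - y\<bar> = dist_circle p q" "G z y = g x" "x = Arg p" by (rule matched_pair.near_lifts[OF elim(2) pq])
      have "\<forall>x\<in>lifts (set_pmf (M z)). glide k (G z) (M z) (s z) (t z) (x + 2 * pi) = glide k (G z) (M z) (s z) (t z) x + 2 * pi"
        using short_map_turn[OF short_map_glide[OF r elim(1)]] elim(4) by blast
      from push_cis[OF periodic_lifts this xy(2)]
      have hq: "?h q = cis (glide k (G z) (M z) (s z) (t z) y)" using xy(4) by simp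
      \<comment> \<open>Both slides are compared at the time \<open>t z\<close>; the change of time
        contributes the slope of \<open>glide\<close>, which is
        \<open>n0 - dev k g p\<close>.\<close>
      have eq: "glide k g \<mu> s0 t0 x - glide k (G z) (M z) (s z) (t z) y
          = (1 - t z) * ((x - y) + (m0 - m z) - (n0 - n z)) + t z * (m0 - m z) - (t0 - t z) * (dev k g p - n0)"
        unfolding glide_def xy(6) dev_def xy(7) by (simp add: algebra_simps)
      have "\<bar>glide k g \<mu> s0 t0 x - glide k (G z) (M z) (s z) (t z) y\<bar> \<le> (1 - t z) * (\<bar>x - y\<bar> + \<bar>m0 - m z\<bar> + \<bar>n0 - n z\<bar>) + t z * \<bar>m0 - m z\<bar> + \<bar>t0 - t z\<bar> * \<bar>dev k g p - n0\<bar>"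
      proof -
        have "\<bar>(1 - t z) * ((x - y) + (m0 - m z) - (n0 - n z))\<bar> \<le> (1 - t z) * (\<bar>x - y\<bar> + \<bar>m0 - m z\<bar> + \<bar>n0 - n z\<bar>)"
          unfolding abs_mult using elim(4) by (intro mult_mono) auto
        moreover have tri: "\<bar>a + b - c\<bar> \<le> a' + \<bar>b\<bar> + \<bar>c\<bar>" if "\<bar>a\<bar> \<le> a'" for a b c a' :: real
          using that by linarith
        ultimately have "\<bar>(1 - t z) * ((x - y) + (m0 - m z) - (n0 - n z)) + t z * (m0 - m z) - (t0 - t z) * (dev k g p - n0)\<bar>
            \<le> (1 - t z) * (\<bar>x - y\<bar> + \<bar>m0 - m z\<bar> + \<bar>n0 - n z\<bar>) + \<bar>t z * (m0 - m z)\<bar> + \<bar>(t0 - t z) * (dev k g p - n0)\<bar>"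
          by blast
        also have "\<bar>t z * (m0 - m z)\<bar> = t z * \<bar>m0 - m z\<bar>" using elim(4) by (simp add: abs_mult)
        also have "\<bar>(t0 - t z) * (dev k g p - n0)\<bar> = \<bar>t0 - t z\<bar> * \<bar>dev k g p - n0\<bar>" by (rule abs_mult)
        finally show ?thesis unfolding eq .
      qed
      also have "\<dots> \<le> 1 * (\<bar>x - y\<bar> + \<bar>m0 - m z\<bar> + \<bar>n0 - n z\<bar>) + 1 * \<bar>m0 - m z\<bar> + \<bar>t0 - t z\<bar> * B"
      proof -
        have "\<bar>dev k g p - n0\<bar> \<le> B" using D(2)[OF pq(1)] unfolding B_def by linarith
        then show ?thesis
          using elim(4) by (intro add_mono[OF add_mono] mult_right_mono mult_left_mono) simp_all
      qed
      finally have gl: "\<bar>glide k g \<mu> s0 t0 x - glide k (G z) (M z) (s z) (t z) y\<bar> \<le> e z + dist_circle p q"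
        using xy(5) by (simp add: e_def)
      have "dist_circle (?ha p) (?h q) \<le> \<bar>glide k g \<mu> s0 t0 x - glide k (G z) (M z) (s z) (t z) y\<bar>"
      proof (rule dist_circle_le)
        show "cis (glide k g \<mu> s0 t0 x) = ?ha p" unfolding xy(7) ..
        show "cis (glide k (G z) (M z) (s z) (t z) y) = ?h q" by (rule hq[symmetric])
      qed
      with gl have d: "dist_circle (?ha p) (?h q) \<le> e z + dist_circle p q" by linarith
      have d0: "0 \<le> dist_circle (?ha p) (?h q)" by (rule dist_circle_nonneg) auto
      note w = thinning_range[OF ind s0 pq(1)]
      have "w0 p * dist_circle (?ha p) (?h q) \<le> 2 * (e z + dist_circle p q)"
        using w d d0 by (intro mult_mono) auto
      moreover have "pi * \<bar>w0 p - w z q\<bar> \<le> pi * gap z" using near_thin[OF elim(2) pq] by (intro mult_left_mono) auto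
      ultimately have "w0 p * dist_circle (?ha p) (?h q) + pi * \<bar>w0 p - w z q\<bar> \<le> 2 * (e z + dist_circle p q) + pi * gap z"
        by (rule add_mono)
      also have "\<dots> = (2 * e z + pi * gap z) + 2 * dist_circle p q" by simp
      finally show "w0 p * dist_circle (?ha p) (?h q) + pi * \<bar>w0 p - w z q\<bar> \<le> (2 * e z + pi * gap z) + 2 * dist_circle p q" .
    next
      show "p \<in> set_pmf \<mu> \<Longrightarrow> w0 p \<le> 2" for p using thinning_range(2)[OF ind s0] .
      show "q \<in> set_pmf (M z) \<Longrightarrow> w z q \<le> 2" for q using thinning_range(2)[OF elim(1,3)] .
      show "0 \<le> 2 * e z + pi * gap z" using e0 gap_nonneg by simp
    qed (use radius_pos[OF r(2)] in auto)
    then show ?case unfolding move_def push_def thin_def using wasserstein_nonneg by simp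
  qed
  then show ?thesis by (rule tendsto_of_bound[OF _ bd])
qed

end

subsection \<open>Continuity of the moves on a stratum\<close>

definition idx :: "real \<Rightarrow> nat \<Rightarrow> complex pmf \<Rightarrow> real \<Rightarrow> int" where
  "idx r k \<mu> = (SOME g. indexed r k g \<mu>)"

definition Move :: "real \<Rightarrow> nat \<Rightarrow> complex pmf \<Rightarrow> real \<Rightarrow> real \<Rightarrow> complex pmf" where
  "Move r k \<mu> s t = move k (idx r k \<mu>) \<mu> s t"

lemma indexed_idx:
  assumes "0 \<le> r" "r < pi" "\<mu> \<in> V r k" shows "indexed r k (idx r k \<mu>) \<mu>"
  using someI_ex[of "\<lambda>g. indexed r k g \<mu>"] V_iff_indexed[OF assms(1,2)] assms(3) unfolding idx_def by blast

lemma F_tilde_idx: "0 \<le> r \<Longrightarrow> r < pi \<Longrightarrow> \<mu> \<in> V r k \<Longrightarrow> F_tilde r k \<mu> 1 = collapse k (idx r k \<mu>) \<mu>"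
  using F_tilde_indexed indexed_idx by blast

text \<open>The level is lower semicontinuous: an index of a nearby measure pulls back to a partial
  index of \<open>\<mu>\<close>.\<close>

lemma stratum_open:
  assumes r: "0 \<le> r" "r < pi" and \<mu>: "\<mu> \<in> V r k"
  obtains \<delta> where "\<delta> > 0" "\<And>\<mu>' l. \<mu>' \<in> V r l \<Longrightarrow> wasserstein \<mu> \<mu>' < \<delta> \<Longrightarrow> k \<le> l \<and> covers r \<mu> \<mu>'"
proof -
  note g = indexed_idx[OF r \<mu>]
  obtain \<delta> where d: "\<delta> > 0" "\<And>\<mu>'. \<mu>' \<in> Pfin \<Longrightarrow> wasserstein \<mu> \<mu>' < \<delta> \<Longrightarrow> covers r \<mu> \<mu>'"
    using covers_close[OF indexed_Pfin[OF g] r(2)] by blast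
  have "k \<le> l \<and> covers r \<mu> \<mu>'" if "\<mu>' \<in> V r l" "wasserstein \<mu> \<mu>' < \<delta>" for \<mu>' l
  proof -
    note g' = indexed_idx[OF r that(1)]
    have cov: "covers r \<mu> \<mu>'" using d(2)[OF indexed_Pfin[OF g'] that(2)] .
    obtain h where "pindex (lifts (set_pmf \<mu>)) l h"
      using matching_pindex[OF r indexed_Pfin[OF g] indexed_spread[OF g] g' cov] by blast
    then show ?thesis using pindex_level_le[OF indexed_run[OF g] _ order_refl] cov by blast
  qed
  then show ?thesis using that d(1) by blast
qed

lemma eventually_matched:
  assumes r: "0 \<le> r" "r < pi" and \<mu>: "\<mu> \<in> V r k"
    and conv: "((\<lambda>z. wasserstein \<mu> (M z)) \<longlongrightarrow> 0) \<Phi>" and ev: "eventually (\<lambda>z. M z \<in> V r k) \<Phi>"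
  obtains G where "converging r k \<mu> (idx r k \<mu>) \<Phi> M G"
proof -
  note g = indexed_idx[OF r \<mu>]
  obtain \<delta> where d: "\<delta> > 0" "\<And>\<mu>' l. \<mu>' \<in> V r l \<Longrightarrow> wasserstein \<mu> \<mu>' < \<delta> \<Longrightarrow> k \<le> l \<and> covers r \<mu> \<mu>'"
    using stratum_open[OF r \<mu>] by blast
  define G where "G z = (SOME g'. indexed r k g' (M z) \<and> matched r \<mu> (idx r k \<mu>) (M z) g')" for z
  have "eventually (\<lambda>z. wasserstein \<mu> (M z) < \<delta>) \<Phi>" using order_tendstoD(2)[OF conv d(1)] .
  then have "eventually (\<lambda>z. indexed r k (G z) (M z) \<and> matched r \<mu> (idx r k \<mu>) (M z) (G z) \<and> covers r \<mu> (M z)) \<Phi>"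
    using ev
  proof eventually_elim
    case (elim z)
    then have cov: "covers r \<mu> (M z)" using d(2) by blast
    from someI_ex[OF matching_index[OF r g elim(2) this]] cov show ?case unfolding G_def by blast
  qed
  then have "converging r k \<mu> (idx r k \<mu>) \<Phi> M G" using r g conv by unfold_locales
  then show ?thesis by (rule that)
qed

lemma low_F_tilde_lim:
  assumes r: "0 \<le> r" "r < pi" and \<mu>: "\<mu> \<in> V r k"
    and conv: "((\<lambda>z. wasserstein \<mu> (M z)) \<longlongrightarrow> 0) \<Phi>" and ev: "eventually (\<lambda>z. M z \<in> V r k) \<Phi>"
  shows "((\<lambda>z. low (F_tilde r k (M z) 1)) \<longlongrightarrow> low (F_tilde r k \<mu> 1)) \<Phi>"
proof -
  obtain G where "converging r k \<mu> (idx r k \<mu>) \<Phi> M G" by (rule eventually_matched[OF assms])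
  then interpret C: converging r k \<mu> "idx r k \<mu>" \<Phi> M G .
  show ?thesis
  proof (rule Lim_transform_eventually)
    show "((\<lambda>z. low (C.f z)) \<longlongrightarrow> low (F_tilde r k \<mu> 1)) \<Phi>"
      using C.low_lim unfolding F_tilde_idx[OF r \<mu>] .
    show "eventually (\<lambda>z. low (C.f z) = low (F_tilde r k (M z) 1)) \<Phi>"
      using C.near_indexed by eventually_elim (simp add: F_tilde_indexed[OF r])
  qed
qed

lemma Move_lim:
  assumes r: "0 \<le> r" "r < pi" and \<mu>: "\<mu> \<in> V r k"
    and conv: "((\<lambda>z. wasserstein \<mu> (M z)) \<longlongrightarrow> 0) \<Phi>" and ev: "eventually (\<lambda>z. M z \<in> V r k) \<Phi>"
    and st: "(s \<longlongrightarrow> s0) \<Phi>" "(t \<longlongrightarrow> t0) \<Phi>" "thinnable k (F_tilde r k \<mu> 1) s0" "0 \<le> t0" "t0 \<le> 1"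
    and sz: "eventually (\<lambda>z. thinnable k (F_tilde r k (M z) 1) (s z)) \<Phi>" and tz: "eventually (\<lambda>z. 0 \<le> t z \<and> t z \<le> 1) \<Phi>"
  shows "((\<lambda>z. wasserstein (Move r k \<mu> s0 t0) (Move r k (M z) (s z) (t z))) \<longlongrightarrow> 0) \<Phi>"
proof -
  obtain G where "converging r k \<mu> (idx r k \<mu>) \<Phi> M G" by (rule eventually_matched[OF r \<mu> conv ev])
  then interpret C: converging r k \<mu> "idx r k \<mu>" \<Phi> M G .
  interpret C: converging_move r k \<mu> "idx r k \<mu>" \<Phi> M G s t s0 t0
  proof
    show "eventually (\<lambda>z. thinnable k (C.f z) (s z)) \<Phi>"
      using C.near_indexed sz by eventually_elim (simp add: F_tilde_indexed[OF r])
  qed (use st tz F_tilde_idx[OF r \<mu>] in auto)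
  show ?thesis
  proof (rule Lim_transform_eventually[OF C.move_lim[folded Move_def]])
    show "eventually (\<lambda>z. wasserstein (Move r k \<mu> s0 t0) (move k (G z) (M z) (s z) (t z))
        = wasserstein (Move r k \<mu> s0 t0) (Move r k (M z) (s z) (t z))) \<Phi>"
      using C.near_indexed ev C.sz
    proof eventually_elim
      case (elim z)
      from move_index_independent[OF r elim(1) indexed_idx[OF r elim(2)] elim(3)]
      show ?case by (simp add: Move_def)
    qed
  qed
qed

subsection \<open>Homotopies compatible with an equivalence relation\<close>

text \<open>\<open>f\<close> factors through the quotient as \<open>g \<circ> ?q\<close>, which the
  given homotopy joins to \<open>id\<close>. As this homotopy respects \<open>R\<close>, it also
  descends to the quotient, which settles the other composition.\<close>

lemma quotient_homotopy_equivalence: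
  assumes R: "equiv (topspace X) R"
    and hom: "homotopic_with (\<lambda>h. \<forall>x y. (x, y) \<in> R \<longrightarrow> (h x, h y) \<in> R) X X id f"
    and f: "\<And>x y. (x, y) \<in> R \<Longrightarrow> f x = f y"
  shows "X homotopy_equivalent_space quotient_topology X R"
proof -
  let ?Q = "quotient_topology X R" and ?q = "\<lambda>x. R `` {x}" and ?I = "top_of_set {0..1::real}"
  have q: "quotient_map X ?Q ?q" by (rule quotient_map_quotient_topology)
  have qc: "continuous_map X ?Q ?q" using q by (rule quotient_imp_continuous_map)
  have qs: "?q ` topspace X = topspace ?Q" using q by (rule quotient_imp_surjective_map)
  have eq: "?q x = ?q y \<longleftrightarrow> (x, y) \<in> R" if "x \<in> topspace X" "y \<in> topspace X" for x y
    using eq_equiv_class_iff[OF R that] .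
  have eqR: "?q x = ?q y" if "(x, y) \<in> R" for x y using equiv_class_eq[OF R that] .
  have fc: "continuous_map X X f" using homotopic_with_imp_continuous_maps[OF hom] by blast
  obtain g where g: "continuous_map ?Q X g" "\<And>x. x \<in> topspace X \<Longrightarrow> g (?q x) = f x"
    using quotient_map_lift_exists[OF q fc] f eq by metis
  obtain H where H: "continuous_map (prod_topology ?I X) X H" "\<And>x. H (0, x) = id x" "\<And>x. H (1, x) = f x"
    "\<And>t x y. t \<in> {0..1} \<Longrightarrow> (x, y) \<in> R \<Longrightarrow> (H (t, x), H (t, y)) \<in> R"
    using hom unfolding homotopic_with_def by blast
  have "homotopic_with (\<lambda>_. True) X X id f"
    by (rule homotopic_with_mono[OF hom]) simp
  then have "homotopic_with (\<lambda>_. True) X X f id" by (rule homotopic_with_symD)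
  then have gq: "homotopic_with (\<lambda>_. True) X X (g \<circ> ?q) id"
    by (rule homotopic_with_eq) (use g(2) in auto)
  have lc: "locally_compact_space ?I"
    by (intro compact_imp_locally_compact_space) (simp add: compact_space_subtopology)
  have "Hausdorff_space ?I" by (intro Hausdorff_space_subtopology) simp
  define J where "J = (\<lambda>(t :: real, x). (t, ?q x))"
  define P where "P = ?q \<circ> H"
  \<comment> \<open>Local compactness of the interval makes its product with the quotient map a
    quotient map again; this lets the homotopy descend.\<close>
  have iq: "quotient_map (prod_topology ?I X) (prod_topology ?I ?Q) J"
    unfolding J_def by (intro quotient_map_prod_right lc q disjI1) fact
  have qH: "continuous_map (prod_topology ?I X) ?Q P"
    unfolding P_def using H(1) qc by (rule continuous_map_compose)
  obtain K where K: "continuous_map (prod_topology ?I ?Q) ?Q K"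
    "\<And>z. z \<in> topspace (prod_topology ?I X) \<Longrightarrow> K (J z) = P z"
  proof (rule quotient_map_lift_exists[OF iq qH])
    fix z z' assume zz: "z \<in> topspace (prod_topology ?I X)" "z' \<in> topspace (prod_topology ?I X)" "J z = J z'"
    obtain t x where z: "z = (t, x)" by (cases z)
    obtain t' y where z': "z' = (t', y)" by (cases z')
    have "t \<in> {0..1}" "x \<in> topspace X" "y \<in> topspace X" "t' = t" "?q x = ?q y"
      using zz unfolding z z' J_def by auto
    then have "(H (t, x), H (t, y)) \<in> R" using H(4) eq by blast
    from eqR[OF this] show "P z = P z'" unfolding z z' P_def comp_def \<open>t' = t\<close> .
  next
    fix K assume "continuous_map (prod_topology ?I ?Q) ?Q K"
      "\<And>z. z \<in> topspace (prod_topology ?I X) \<Longrightarrow> K (J z) = P z"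
    then show thesis by (rule that)
  qed
  have Kt: "K (t, ?q x) = ?q (H (t, x))" if "t \<in> {0..1}" "x \<in> topspace X" for t x
    using K(2)[of "(t, x)"] that by (simp add: J_def P_def)
  have "homotopic_with (\<lambda>_. True) ?Q ?Q id (?q \<circ> g)"
    unfolding homotopic_with[of ?Q "\<lambda>_. True", simplified]
  proof (intro exI[of _ K] conjI ballI K(1))
    fix y assume "y \<in> topspace ?Q"
    then obtain x where x: "x \<in> topspace X" "y = ?q x" using qs by blast
    show "K (0, y) = id y" "K (1, y) = (?q \<circ> g) y" using Kt[of 0 x] Kt[of 1 x] x H(2,3) g(2) by auto
  qed
  then have "homotopic_with (\<lambda>_. True) ?Q ?Q (?q \<circ> g) id" by (rule homotopic_with_symD)
  then show ?thesis unfolding homotopy_equivalent_space_def using qc g(1) gq by blast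
qed

subsection \<open>Continuity in terms of the Wasserstein distance\<close>

lemma tendsto_nhdsin:
  fixes f :: "'a \<Rightarrow> 'b :: topological_space"
  assumes "continuous_map X euclidean f" "x \<in> topspace X"
  shows "(f \<longlongrightarrow> f x) (nhdsin X x)"
proof (rule topological_tendstoI)
  fix S :: "'b set" assume S: "open S" "f x \<in> S"
  have "openin X {z \<in> topspace X. f z \<in> S}" using assms(1) S(1) by (auto simp: continuous_map_def)
  then show "eventually (\<lambda>z. f z \<in> S) (nhdsin X x)"
    unfolding eventually_nhdsin using assms(2) S(2) by auto
qed

lemma continuous_map_realI:
  fixes f :: "'a \<Rightarrow> real"
  assumes "\<And>x. x \<in> topspace X \<Longrightarrow> (f \<longlongrightarrow> f x) (nhdsin X x)"
  shows "continuous_map X euclideanreal f"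
  unfolding continuous_map_eq_topcontinuous_at topcontinuous_at_def
proof (intro ballI conjI allI impI)
  fix x U assume x: "x \<in> topspace X" and U: "openin euclideanreal U \<and> f x \<in> U"
  then have "eventually (\<lambda>z. f z \<in> U) (nhdsin X x)" using topological_tendstoD[OF assms[OF x]] by auto
  then show "\<exists>W. openin X W \<and> x \<in> W \<and> (\<forall>y\<in>W. f y \<in> U)" using x unfolding eventually_nhdsin by auto
qed auto

lemma topspace_Pfin: "topspace Pfin_topology = Pfin"
  by (simp add: Pfin_topology_def Metric_space.topspace_mtopology[OF Metric_space_wasserstein])

lemma continuous_map_PfinI:
  assumes "\<And>x. x \<in> topspace X \<Longrightarrow> f x \<in> Pfin"
    and "\<And>x. x \<in> topspace X \<Longrightarrow> ((\<lambda>z. wasserstein (f x) (f z)) \<longlongrightarrow> 0) (nhdsin X x)"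
  shows "continuous_map X Pfin_topology f"
  unfolding Pfin_topology_def Metric_space.continuous_map_to_metric[OF Metric_space_wasserstein]
proof (intro ballI allI impI)
  fix x and \<epsilon> :: real assume x: "x \<in> topspace X" "0 < \<epsilon>"
  from order_tendstoD(2)[OF assms(2)[OF x(1)] x(2)]
  obtain U where U: "openin X U" "x \<in> U" "\<And>z. z \<in> U \<Longrightarrow> wasserstein (f x) (f z) < \<epsilon>"
    unfolding eventually_nhdsin using x(1) by blast
  have "f z \<in> Metric_space.mball Pfin wasserstein (f x) \<epsilon>" if "z \<in> U" for z
    using assms(1) x(1) openin_subset[OF U(1)] U(3)[OF that] that
    by (auto simp: Metric_space.in_mball[OF Metric_space_wasserstein])
  then show "\<exists>U. openin X U \<and> x \<in> U \<and> (\<forall>y\<in>U. f y \<in> Metric_space.mball Pfin wasserstein (f x) \<epsilon>)"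
    using U by blast
qed

lemma wasserstein_nhdsin:
  assumes f: "continuous_map X Pfin_topology f" and x: "x \<in> topspace X"
  shows "((\<lambda>z. wasserstein (f x) (f z)) \<longlongrightarrow> 0) (nhdsin X x)"
proof (rule order_tendstoI)
  fix \<epsilon> :: real assume "\<epsilon> < 0"
  then show "eventually (\<lambda>z. \<epsilon> < wasserstein (f x) (f z)) (nhdsin X x)"
    by (intro always_eventually allI) (rule less_le_trans[OF _ wasserstein_nonneg])
next
  fix \<epsilon> :: real assume "0 < \<epsilon>"
  with f[unfolded Pfin_topology_def Metric_space.continuous_map_to_metric[OF Metric_space_wasserstein]] x
  have "\<exists>U. openin X U \<and> x \<in> U \<and> (\<forall>z\<in>U. f z \<in> Metric_space.mball Pfin wasserstein (f x) \<epsilon>)"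
    by simp
  then show "eventually (\<lambda>z. wasserstein (f x) (f z) < \<epsilon>) (nhdsin X x)"
    unfolding eventually_nhdsin Metric_space.in_mball[OF Metric_space_wasserstein] by blast
qed

lemma eventually_nhdsin_topspace: "eventually (\<lambda>z. z \<in> topspace X) (nhdsin X x)"
  unfolding eventually_nhdsin by auto

subsection \<open>Collapsing the strata one after the other\<close>

definition W :: "real \<Rightarrow> nat \<Rightarrow> complex pmf set" where
  "W r n = (\<Union>k<n. V r k)"

abbreviation XW :: "real \<Rightarrow> nat \<Rightarrow> complex pmf topology" where
  "XW r n \<equiv> subtopology Pfin_topology (W r n)"

text \<open>Restricting \<open>\<mu>\<close> to \<open>W r n\<close> makes the property depend only
  on the values of \<open>h\<close> on the space, as the characterisation of
  \<open>homotopic_with\<close> requires.\<close>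

definition class_preserving :: "real \<Rightarrow> nat \<Rightarrow> (complex pmf \<Rightarrow> complex pmf) \<Rightarrow> bool" where
  "class_preserving r n h \<longleftrightarrow> (\<forall>\<mu> \<nu>. \<mu> \<in> W r n \<longrightarrow> (\<mu>, \<nu>) \<in> collapse_rel r \<longrightarrow> (h \<mu>, h \<nu>) \<in> collapse_rel r)"

lemma V_Pfin: "\<mu> \<in> V r k \<Longrightarrow> \<mu> \<in> Pfin" by (simp add: V_def VR_def)

lemma W_Pfin: "W r n \<subseteq> Pfin" using V_Pfin by (auto simp: W_def)

lemma topspace_XW: "topspace (XW r n) = W r n"
  using W_Pfin by (auto simp: topspace_Pfin)

lemma W_Suc: "W r (Suc n) = W r n \<union> V r n" by (auto simp: W_def lessThan_Suc)

lemma W_mono: "W r n \<subseteq> W r (Suc n)" by (auto simp: W_Suc)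

lemma collapse_rel_V:
  assumes "(\<mu>, \<nu>) \<in> collapse_rel r" "\<mu> \<in> V r k" shows "\<nu> \<in> V r k" "F_tilde r k \<mu> 1 = F_tilde r k \<nu> 1"
  using assms V_disjoint unfolding collapse_rel_def by blast+

lemma collapse_rel_W:
  assumes "(\<mu>, \<nu>) \<in> collapse_rel r" shows "\<mu> \<in> W r n \<longleftrightarrow> \<nu> \<in> W r n"
  using assms V_disjoint unfolding collapse_rel_def W_def by blast

lemma class_preserving_cong:
  assumes "\<And>\<mu>. \<mu> \<in> topspace (XW r n) \<Longrightarrow> h \<mu> = h' \<mu>" shows "class_preserving r n h \<longleftrightarrow> class_preserving r n h'"
  using assms collapse_rel_W unfolding class_preserving_def topspace_XW by metis

text \<open>Equal to \<open>1\<close> up to \<open>(a - 1) / 4\<close> and to \<open>0\<close> from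
  \<open>a / 4\<close> on. The values \<open>2\<close>, \<open>3\<close>, \<open>4\<close> of
  \<open>a\<close> give three adjacent intervals, in which sliding sets in, the inductive homotopy
  fades and thinning fades.\<close>

definition ramp :: "real \<Rightarrow> real \<Rightarrow> real" where
  "ramp a v = max 0 (min 1 (a - 4 * v))"

lemma ramp_bounds: "0 \<le> ramp a v" "ramp a v \<le> 1" by (auto simp: ramp_def)

locale stratum =
  fixes r :: real and n :: nat
  assumes r: "0 \<le> r" "r < pi"
begin

text \<open>The factor is chosen such that thinning can be completed as long as the height is at most \<open>1\<close>.
  It is completed up to height \<open>3 / 4\<close>, and sliding from height \<open>1 / 2\<close> on.\<close>

definition height :: "complex pmf \<Rightarrow> real" where
  "height \<mu> = (if \<mu> \<in> V r n then 2 * real (2 * n + 1) * low (F_tilde r n \<mu> 1) else 0)"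

definition thin_time :: "real \<Rightarrow> complex pmf \<Rightarrow> real" where
  "thin_time \<tau> \<mu> = \<tau> * ramp 4 (height \<mu>)"

definition slide_time :: "real \<Rightarrow> complex pmf \<Rightarrow> real" where
  "slide_time \<tau> \<mu> = \<tau> * (1 - ramp 2 (height \<mu>))"

definition shrink :: "real \<times> complex pmf \<Rightarrow> complex pmf" where
  "shrink = (\<lambda>(\<tau>, \<mu>). if \<mu> \<in> V r n then Move r n \<mu> (thin_time \<tau> \<mu>) (slide_time \<tau> \<mu>) else \<mu>)"

abbreviation "X \<equiv> XW r (Suc n)"
abbreviation "IX \<equiv> prod_topology (top_of_set {0..1::real}) X"

lemma low_F_tilde_pos: "\<mu> \<in> V r n \<Longrightarrow> 0 < low (F_tilde r n \<mu> 1)"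
  using F_tilde_idx[OF r] finite_collapse[OF indexed_idx[OF r]] low_pos by metis

lemma height_nonneg: "0 \<le> height \<mu>"
  using low_F_tilde_pos by (simp add: height_def less_imp_le)

lemma height_pos_iff: "0 < height \<mu> \<longleftrightarrow> \<mu> \<in> V r n"
  using low_F_tilde_pos by (simp add: height_def)

lemma height_cong: "(\<mu>, \<nu>) \<in> collapse_rel r \<Longrightarrow> height \<mu> = height \<nu>"
proof (cases "\<mu> \<in> V r n")
  case True
  assume "(\<mu>, \<nu>) \<in> collapse_rel r"
  from collapse_rel_V[OF this True] show ?thesis using True by (simp add: height_def)
next
  case False
  assume "(\<mu>, \<nu>) \<in> collapse_rel r"
  then have "(\<nu>, \<mu>) \<in> collapse_rel r" using equiv_collapse_rel[OF r] by (auto simp: equiv_def dest: symD)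
  then have "\<nu> \<notin> V r n" using collapse_rel_V(1) False by blast
  then show ?thesis using False by (simp add: height_def)
qed

lemma thinnable_time:
  assumes "\<mu> \<in> V r n" "0 \<le> \<tau>" "\<tau> \<le> 1"
  shows "thinnable n (F_tilde r n \<mu> 1) (thin_time \<tau> \<mu>)"
proof -
  have t: "0 \<le> thin_time \<tau> \<mu>" "thin_time \<tau> \<mu> \<le> 1"
    using assms ramp_bounds[of 4 "height \<mu>"] by (auto simp: thin_time_def mult_le_one)
  have "thin_time \<tau> \<mu> * height \<mu> \<le> 1"
  proof (cases "height \<mu> \<le> 1")
    case True then show ?thesis using t height_nonneg by (simp add: mult_le_one)
  next
    case False then show ?thesis by (simp add: thin_time_def ramp_def)
  qed
  then show ?thesis using t assms(1) by (simp add: thinnable_def height_def algebra_simps)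
qed

lemma slide_bounds:
  assumes "0 \<le> \<tau>" "\<tau> \<le> 1" shows "0 \<le> slide_time \<tau> \<mu> \<and> slide_time \<tau> \<mu> \<le> 1"
  using assms ramp_bounds[of 2 "height \<mu>"] by (auto simp: slide_time_def mult_le_one)

lemma topspace_IX: "topspace IX = {0..1} \<times> W r (Suc n)"
  unfolding topspace_prod_topology topspace_XW by simp

text \<open>The top stratum is open: levels nearby are at least \<open>n\<close>, and in
  \<open>W r (Suc n)\<close> they are at most \<open>n\<close>.\<close>

lemma near_stratum:
  assumes "continuous_map Y X f" "y \<in> topspace Y" "f y \<in> V r n"
  shows "eventually (\<lambda>z. f z \<in> V r n) (nhdsin Y y)"
proof -
  obtain \<delta> where d: "\<delta> > 0" "\<And>\<mu>' l. \<mu>' \<in> V r l \<Longrightarrow> wasserstein (f y) \<mu>' < \<delta> \<Longrightarrow> n \<le> l \<and> covers r (f y) \<mu>'"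
    using stratum_open[OF r assms(3)] by blast
  have "continuous_map Y Pfin_topology f" using assms(1) by (rule continuous_map_into_fulltopology)
  from order_tendstoD(2)[OF wasserstein_nhdsin[OF this assms(2)] d(1)] eventually_nhdsin_topspace
  show ?thesis
  proof eventually_elim
    case (elim z)
    have "f z \<in> topspace X" using continuous_map_image_subset_topspace[OF assms(1)] elim(2) by blast
    then have "f z \<in> W r (Suc n)" unfolding topspace_XW .
    then obtain l where l: "l < Suc n" "f z \<in> V r l" by (auto simp: W_def)
    then have "n = l" using d(2)[OF l(2) elim(1)] by simp
    then show ?case using l by simp
  qed
qed

text \<open>Within the stratum the arc masses converge; at a measure of lower level
  \<open>low_small\<close> makes the heights nearby tend to zero.\<close>

lemma continuous_height: "continuous_map X euclideanreal height"
proof (rule continuous_map_realI)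
  fix \<mu> assume \<mu>: "\<mu> \<in> topspace X"
  have id: "continuous_map X X (\<lambda>\<nu>. \<nu>)" by simp
  have conv: "((\<lambda>\<nu>. wasserstein \<mu> \<nu>) \<longlongrightarrow> 0) (nhdsin X \<mu>)"
    by (rule wasserstein_nhdsin[OF continuous_map_into_fulltopology[OF id] \<mu>])
  show "(height \<longlongrightarrow> height \<mu>) (nhdsin X \<mu>)"
  proof (cases "\<mu> \<in> V r n")
    case True
    have ev: "eventually (\<lambda>\<nu>. \<nu> \<in> V r n) (nhdsin X \<mu>)" by (rule near_stratum[OF id \<mu> True])
    have "((\<lambda>\<nu>. 2 * real (2 * n + 1) * low (F_tilde r n \<nu> 1)) \<longlongrightarrow> 2 * real (2 * n + 1) * low (F_tilde r n \<mu> 1)) (nhdsin X \<mu>)"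
      by (intro tendsto_mult tendsto_const low_F_tilde_lim[OF r True conv ev])
    moreover have "eventually (\<lambda>\<nu>. 2 * real (2 * n + 1) * low (F_tilde r n \<nu> 1) = height \<nu>) (nhdsin X \<mu>)"
      using ev by eventually_elim (simp add: height_def)
    ultimately have "(height \<longlongrightarrow> 2 * real (2 * n + 1) * low (F_tilde r n \<mu> 1)) (nhdsin X \<mu>)"
      by (rule Lim_transform_eventually)
    then show ?thesis using True by (simp add: height_def)
  next
    case False
    have VR: "\<mu> \<in> VR r" using \<mu> unfolding topspace_XW by (auto simp: W_def V_def)
    have "(height \<longlongrightarrow> 0) (nhdsin X \<mu>)"
    proof (rule order_tendstoI)
      fix \<epsilon> :: real assume "\<epsilon> < 0"
      then show "eventually (\<lambda>\<nu>. \<epsilon> < height \<nu>) (nhdsin X \<mu>)"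
        by (intro always_eventually allI) (rule less_le_trans[OF _ height_nonneg])
    next
      fix \<epsilon> :: real assume e: "0 < \<epsilon>"
      then have e': "0 < \<epsilon> / (2 * real (2 * n + 1))" by simp
      obtain \<delta> where d: "\<delta> > 0" "\<And>\<mu>' g'. indexed r n g' \<mu>' \<Longrightarrow> wasserstein \<mu> \<mu>' < \<delta>
          \<Longrightarrow> low (collapse n g' \<mu>') < \<epsilon> / (2 * real (2 * n + 1))"
        using low_small[OF r VR False e'] by blast
      from order_tendstoD(2)[OF conv d(1)]
      show "eventually (\<lambda>\<nu>. height \<nu> < \<epsilon>) (nhdsin X \<mu>)"
      proof eventually_elim
        case (elim \<nu>)
        show ?case
        proof (cases "\<nu> \<in> V r n")
          case True
          then have "low (F_tilde r n \<nu> 1) < \<epsilon> / (2 * real (2 * n + 1))"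
            using d(2)[OF indexed_idx[OF r True] elim] F_tilde_idx[OF r True] by simp
          then show ?thesis using True by (simp add: height_def field_simps)
        qed (use e in \<open>simp add: height_def\<close>)
      qed
    qed
    then show ?thesis using False by (simp add: height_def)
  qed
qed

lemma continuous_height_snd: "continuous_map IX euclideanreal (\<lambda>z. height (snd z))"
  using continuous_map_compose[OF continuous_map_snd continuous_height] by (simp add: comp_def)

text \<open>The measure in the last relation is the completed slide at the same thinning time. It
  depends only on the collapse and thus serves as a common representative.\<close>

lemma shrink_level:
  assumes "\<mu> \<in> V r n" "0 \<le> \<tau>" "\<tau> \<le> 1"
  obtains l where "l \<le> n" "thin_time \<tau> \<mu> = 1 \<longrightarrow> l < n" "shrink (\<tau>, \<mu>) \<in> V r l"
    "(shrink (\<tau>, \<mu>), reweight (F_tilde r n \<mu> 1) (thinning (thin_time \<tau> \<mu>) (F_tilde r n \<mu> 1))) \<in> collapse_rel r"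
proof -
  note g = indexed_idx[OF r assms(1)]
  have s: "thinnable n (collapse n (idx r n \<mu>) \<mu>) (thin_time \<tau> \<mu>)"
    using thinnable_time[OF assms] F_tilde_idx[OF r assms(1)] by simp
  obtain l where l: "l \<le> n" "thin_time \<tau> \<mu> = 1 \<Longrightarrow> l < n"
    "\<And>t. 0 \<le> t \<Longrightarrow> t \<le> 1 \<Longrightarrow> move n (idx r n \<mu>) \<mu> (thin_time \<tau> \<mu>) t \<in> V r l"
    "\<And>t. 0 \<le> t \<Longrightarrow> t \<le> 1 \<Longrightarrow> (move n (idx r n \<mu>) \<mu> (thin_time \<tau> \<mu>) t, move n (idx r n \<mu>) \<mu> (thin_time \<tau> \<mu>) 1) \<in> collapse_rel r"
    using move_level[OF r g s] by blast
  note sl = slide_bounds[OF assms(2,3), of \<mu>]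
  have "shrink (\<tau>, \<mu>) = move n (idx r n \<mu>) \<mu> (thin_time \<tau> \<mu>) (slide_time \<tau> \<mu>)"
    using assms(1) by (simp add: shrink_def Move_def)
  then show ?thesis
    using that[of l] l sl move_one[OF g s] F_tilde_idx[OF r assms(1)] by simp
qed

lemma shrink_W:
  assumes "\<mu> \<in> W r (Suc n)" "0 \<le> \<tau>" "\<tau> \<le> 1" shows "shrink (\<tau>, \<mu>) \<in> W r (Suc n)"
proof (cases "\<mu> \<in> V r n")
  case True
  then obtain l where "l \<le> n" "shrink (\<tau>, \<mu>) \<in> V r l" by (rule shrink_level[OF _ assms(2,3)])
  then show ?thesis by (auto simp: W_def)
qed (use assms(1) in \<open>simp add: shrink_def\<close>)

text \<open>In \<open>V r 0\<close> the single arc has mass one and the height is \<open>2\<close>,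
  so nothing is claimed about measures that have no lower stratum to go to.\<close>

lemma shrink_one_W:
  assumes "\<mu> \<in> W r (Suc n)" "height \<mu> \<le> 3 / 4" shows "shrink (1, \<mu>) \<in> W r n"
proof (cases "\<mu> \<in> V r n")
  case True
  have "thin_time 1 \<mu> = 1" using assms(2) by (simp add: thin_time_def ramp_def)
  moreover obtain l where "thin_time 1 \<mu> = 1 \<longrightarrow> l < n" "shrink (1, \<mu>) \<in> V r l"
    by (rule shrink_level[OF True, of 1]) simp_all
  ultimately show ?thesis by (auto simp: W_def)
qed (use assms(1) in \<open>simp add: shrink_def W_Suc\<close>)

lemma shrink_zero: "shrink (0, \<mu>) = \<mu>"
  using move_zero[OF indexed_idx[OF r]] by (simp add: shrink_def thin_time_def slide_time_def Move_def)

text \<open>The height is the same throughout a class, hence so is the thinning time, and both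
  images are equivalent to the same completed slide.\<close>

lemma shrink_preserves:
  assumes "0 \<le> \<tau>" "\<tau> \<le> 1" and rel: "(\<mu>, \<nu>) \<in> collapse_rel r"
  shows "(shrink (\<tau>, \<mu>), shrink (\<tau>, \<nu>)) \<in> collapse_rel r"
proof (cases "\<mu> \<in> V r n")
  case True
  note \<nu> = collapse_rel_V[OF rel True]
  let ?m = "reweight (F_tilde r n \<mu> 1) (thinning (thin_time \<tau> \<mu>) (F_tilde r n \<mu> 1))"
  have t: "thin_time \<tau> \<nu> = thin_time \<tau> \<mu>" using height_cong[OF rel] by (simp add: thin_time_def)
  have "(shrink (\<tau>, \<mu>), ?m) \<in> collapse_rel r" by (rule shrink_level[OF True assms(1,2)])
  moreover have "(shrink (\<tau>, \<nu>), ?m) \<in> collapse_rel r"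
    using shrink_level[OF \<nu>(1) assms(1,2)] unfolding t \<nu>(2) by blast
  ultimately show ?thesis
    using equiv_collapse_rel[OF r] unfolding equiv_def by (meson symD transD)
next
  case False
  then have "\<nu> \<notin> V r n" using height_cong[OF rel] height_pos_iff by metis
  then show ?thesis using False rel by (simp add: shrink_def)
qed

lemma shrink_one_collapses:
  assumes rel: "(\<mu>, \<nu>) \<in> collapse_rel r" and h: "1 / 2 \<le> height \<mu>"
  shows "shrink (1, \<mu>) = shrink (1, \<nu>)"
proof -
  have \<mu>: "\<mu> \<in> V r n" using h height_pos_iff[of \<mu>] by simp
  note \<nu> = collapse_rel_V[OF rel \<mu>]
  have hh: "height \<nu> = height \<mu>" using height_cong[OF rel] by simp
  have eq: "shrink (1, \<rho>) = reweight (F_tilde r n \<rho> 1) (thinning (thin_time 1 \<rho>) (F_tilde r n \<rho> 1))"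
    if \<rho>: "\<rho> \<in> V r n" "1 / 2 \<le> height \<rho>" for \<rho>
  proof -
    have "slide_time 1 \<rho> = 1" using \<rho>(2) by (simp add: slide_time_def ramp_def)
    moreover have "thinnable n (collapse n (idx r n \<rho>) \<rho>) (thin_time 1 \<rho>)"
      using thinnable_time[OF \<rho>(1), of 1] F_tilde_idx[OF r \<rho>(1)] by simp
    ultimately show ?thesis
      using move_one[OF indexed_idx[OF r \<rho>(1)]] \<rho>(1) F_tilde_idx[OF r \<rho>(1)] by (simp add: shrink_def Move_def)
  qed
  show ?thesis using eq[OF \<mu> h] eq[OF \<nu>(1)] h \<nu>(2) hh by (simp add: thin_time_def)
qed

text \<open>At a measure outside the top stratum, heights nearby are below \<open>1 / 4\<close>,
  where no sliding takes place and the moves differ from the identity by at most a multiple of the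
  height.\<close>

lemma continuous_shrink: "continuous_map IX X shrink"
proof (rule continuous_map_into_subtopology)
  show "shrink \<in> topspace IX \<rightarrow> W r (Suc n)" using shrink_W unfolding topspace_IX by auto
  show "continuous_map IX Pfin_topology shrink"
  proof (rule continuous_map_PfinI)
    fix z assume "z \<in> topspace IX"
    then show "shrink z \<in> Pfin" using shrink_W W_Pfin unfolding topspace_IX by fastforce
  next
    fix z assume z: "z \<in> topspace IX"
    obtain \<tau> \<mu> where zz: "z = (\<tau>, \<mu>)" by (cases z)
    have \<tau>: "0 \<le> \<tau>" "\<tau> \<le> 1" and \<mu>: "\<mu> \<in> W r (Suc n)" using z unfolding zz topspace_IX by auto
    let ?N = "nhdsin IX z"
    have sndc: "continuous_map IX X snd" by (rule continuous_map_snd)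
    have conv: "((\<lambda>y. wasserstein \<mu> (snd y)) \<longlongrightarrow> 0) ?N"
      using wasserstein_nhdsin[OF continuous_map_into_fulltopology[OF sndc] z] by (simp add: zz)
    have "continuous_map IX euclideanreal fst" using continuous_map_fst continuous_map_into_fulltopology by blast
    from tendsto_nhdsin[OF this z] have fl: "(fst \<longlongrightarrow> \<tau>) ?N" by (simp add: zz)
    have hl: "((\<lambda>y. height (snd y)) \<longlongrightarrow> height \<mu>) ?N"
      using tendsto_nhdsin[OF continuous_height_snd z] by (simp add: zz)
    have top: "eventually (\<lambda>y. y \<in> topspace IX) ?N" by (rule eventually_nhdsin_topspace)
    show "((\<lambda>y. wasserstein (shrink z) (shrink y)) \<longlongrightarrow> 0) ?N"
    proof (cases "\<mu> \<in> V r n")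
      case True
      have ev: "eventually (\<lambda>y. snd y \<in> V r n) ?N" by (rule near_stratum[OF sndc z]) (simp add: zz True)
      have "((\<lambda>y. wasserstein (Move r n \<mu> (thin_time \<tau> \<mu>) (slide_time \<tau> \<mu>))
          (Move r n (snd y) (thin_time (fst y) (snd y)) (slide_time (fst y) (snd y)))) \<longlongrightarrow> 0) ?N"
      proof (rule Move_lim[OF r True conv ev])
        show "((\<lambda>y. thin_time (fst y) (snd y)) \<longlongrightarrow> thin_time \<tau> \<mu>) ?N"
          unfolding thin_time_def ramp_def by (intro tendsto_intros fl hl)
        show "((\<lambda>y. slide_time (fst y) (snd y)) \<longlongrightarrow> slide_time \<tau> \<mu>) ?N"
          unfolding slide_time_def ramp_def by (intro tendsto_intros fl hl)
        show "eventually (\<lambda>y. thinnable n (F_tilde r n (snd y) 1) (thin_time (fst y) (snd y))) ?N"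
          using ev top by eventually_elim (use thinnable_time in \<open>auto simp: topspace_IX\<close>)
        show "eventually (\<lambda>y. 0 \<le> slide_time (fst y) (snd y) \<and> slide_time (fst y) (snd y) \<le> 1) ?N"
          using top by eventually_elim (use slide_bounds in \<open>auto simp: topspace_IX\<close>)
      qed (use thinnable_time[OF True \<tau>] slide_bounds[OF \<tau>] in auto)
      moreover have "eventually (\<lambda>y. wasserstein (Move r n \<mu> (thin_time \<tau> \<mu>) (slide_time \<tau> \<mu>))
          (Move r n (snd y) (thin_time (fst y) (snd y)) (slide_time (fst y) (snd y))) = wasserstein (shrink z) (shrink y)) ?N"
        using ev by eventually_elim (auto simp: shrink_def zz True split_beta)
      ultimately show ?thesis by (rule Lim_transform_eventually)
    next
      case False
      then have h0: "height \<mu> = 0" and sz: "shrink z = \<mu>" by (simp_all add: height_def shrink_def zz)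
      have small: "eventually (\<lambda>y. height (snd y) < 1 / 4) ?N" using order_tendstoD(2)[OF hl, of "1 / 4"] h0 by simp
      \<comment> \<open>\<open>6 * pi * height\<close> is the bound of
        \<open>move_near_identity\<close>, as the height contains a factor \<open>2\<close>.\<close>
      have "((\<lambda>y. wasserstein \<mu> (snd y) + 6 * pi * height (snd y)) \<longlongrightarrow> 0 + 6 * pi * height \<mu>) ?N"
        by (intro tendsto_intros conv hl)
      then have lim: "((\<lambda>y. wasserstein \<mu> (snd y) + 6 * pi * height (snd y)) \<longlongrightarrow> 0) ?N" by (simp add: h0)
      have "eventually (\<lambda>y. \<bar>wasserstein (shrink z) (shrink y) - 0\<bar> \<le> wasserstein \<mu> (snd y) + 6 * pi * height (snd y)) ?N"
        using small top
      proof eventually_elim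
        case (elim y)
        obtain \<sigma> \<nu> where y: "y = (\<sigma>, \<nu>)" by (cases y)
        have \<sigma>: "0 \<le> \<sigma>" "\<sigma> \<le> 1" and \<nu>: "\<nu> \<in> W r (Suc n)" using elim(2) unfolding y topspace_IX by auto
        have "wasserstein \<nu> (shrink y) \<le> 6 * pi * height \<nu>"
        proof (cases "\<nu> \<in> V r n")
          case True
          have "slide_time \<sigma> \<nu> = 0" using elim(1) by (simp add: y slide_time_def ramp_def)
          then have "shrink y = move n (idx r n \<nu>) \<nu> (thin_time \<sigma> \<nu>) 0" using True by (simp add: y shrink_def Move_def)
          moreover have "thinnable n (collapse n (idx r n \<nu>) \<nu>) (thin_time \<sigma> \<nu>)"
            using thinnable_time[OF True \<sigma>] F_tilde_idx[OF r True] by simp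
          ultimately show ?thesis
            using move_near_identity[OF r indexed_idx[OF r True]] True F_tilde_idx[OF r True]
            by (simp add: height_def algebra_simps)
        next
          case False
          moreover have "\<nu> \<in> Pfin" using \<nu> W_Pfin by blast
          ultimately show ?thesis by (simp add: y shrink_def height_def wasserstein_refl)
        qed
        moreover have "wasserstein \<mu> (shrink y) \<le> wasserstein \<mu> \<nu> + wasserstein \<nu> (shrink y)"
          using \<mu> \<nu> shrink_W[OF \<nu> \<sigma>] W_Pfin y by (intro wasserstein_triangle) blast+
        ultimately show ?case unfolding sz using wasserstein_nonneg[of \<mu> "shrink y"] by (simp add: y)
      qed
      then show ?thesis by (rule tendsto_of_bound[OF _ lim])
    qed
  qed
qed

text \<open>There are two reasons for the end map to be constant on classes: from height
  \<open>1 / 2\<close> on \<open>shrink\<close> has already identified the class, and below it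
  \<open>ramp 3\<close> equals \<open>1\<close>, so that the end map \<open>h\<close> is
  reached.\<close>

lemma homotopy_step:
  assumes IH: "homotopic_with (class_preserving r n) (XW r n) (XW r n) id h"
    and h: "\<And>\<mu> \<nu>. \<mu> \<in> W r n \<Longrightarrow> (\<mu>, \<nu>) \<in> collapse_rel r \<Longrightarrow> h \<mu> = h \<nu>"
  obtains h' where "homotopic_with (class_preserving r (Suc n)) X X id h'"
    "\<And>\<mu> \<nu>. \<mu> \<in> W r (Suc n) \<Longrightarrow> (\<mu>, \<nu>) \<in> collapse_rel r \<Longrightarrow> h' \<mu> = h' \<nu>"
proof -
  let ?I = "top_of_set {0..1::real}"
  obtain H where H: "continuous_map (prod_topology ?I (XW r n)) (XW r n) H" "\<And>\<mu>. H (0, \<mu>) = id \<mu>" "\<And>\<mu>. H (1, \<mu>) = h \<mu>"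
    "\<And>\<tau>. \<tau> \<in> {0..1} \<Longrightarrow> class_preserving r n (\<lambda>\<mu>. H (\<tau>, \<mu>))"
    using IH unfolding homotopic_with_def by blast
  define K where "K = (\<lambda>z. if height (snd z) \<le> 3 / 4
    then H (fst z * ramp 3 (height (snd z)), shrink (1, snd z)) else shrink (1, snd z))"
  have rc: "homotopic_with (class_preserving r (Suc n)) X X f g \<longleftrightarrow>
      (\<exists>h. continuous_map IX X h \<and> (\<forall>x\<in>topspace X. h (0, x) = f x) \<and> (\<forall>x\<in>topspace X. h (1, x) = g x) \<and>
        (\<forall>t\<in>{0..1}. class_preserving r (Suc n) (\<lambda>x. h (t, x))))" for f g
    by (rule homotopic_with) (rule class_preserving_cong)
  have one: "continuous_map X X (\<lambda>\<mu>. shrink (1, \<mu>))"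
  proof -
    have "continuous_map X IX (\<lambda>\<mu>. (1, \<mu>))" by (simp add: continuous_map_pairedI)
    from continuous_map_compose[OF this continuous_shrink] show ?thesis by (simp add: comp_def)
  qed
  have one_snd: "continuous_map IX X (\<lambda>z. shrink (1, snd z))"
    using continuous_map_compose[OF continuous_map_snd one] by (simp add: comp_def)
  have K: "continuous_map IX X K"
    unfolding K_def
  proof (rule continuous_map_cases_le)
    show "continuous_map IX euclideanreal (\<lambda>z. height (snd z))" by (rule continuous_height_snd)
    show "continuous_map IX euclideanreal (\<lambda>z. 3 / 4)" by simp
    show "continuous_map (subtopology IX {z \<in> topspace IX. 3 / 4 \<le> height (snd z)}) X (\<lambda>z. shrink (1, snd z))"
      using one_snd by (rule continuous_map_from_subtopology)
    \<comment> \<open>At height \<open>3 / 4\<close> the formulas agree, because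
      \<open>ramp 3\<close> vanishes there and \<open>H\<close> starts at the identity.\<close>
    show "H (fst z * ramp 3 (height (snd z)), shrink (1, snd z)) = shrink (1, snd z)" if "height (snd z) = 3 / 4" for z
      using H(2) that by (simp add: ramp_def)
    let ?L = "{z \<in> topspace IX. height (snd z) \<le> 3 / 4}"
    have "continuous_map (subtopology IX ?L) (prod_topology ?I (XW r n)) (\<lambda>z. (fst z * ramp 3 (height (snd z)), shrink (1, snd z)))"
    proof (rule continuous_map_pairedI)
      have "continuous_map IX euclideanreal (\<lambda>z. fst z * ramp 3 (height (snd z)))"
        unfolding ramp_def
        using continuous_map_into_fulltopology[OF continuous_map_fst] continuous_height_snd
        by (intro continuous_intros) auto
      then show "continuous_map (subtopology IX ?L) ?I (\<lambda>z. fst z * ramp 3 (height (snd z)))"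
        using ramp_bounds
        by (intro continuous_map_into_subtopology continuous_map_from_subtopology) (auto simp: topspace_IX mult_le_one)
      have "continuous_map (subtopology IX ?L) Pfin_topology (\<lambda>z. shrink (1, snd z))"
        using continuous_map_into_fulltopology[OF one_snd] by (rule continuous_map_from_subtopology)
      then show "continuous_map (subtopology IX ?L) (XW r n) (\<lambda>z. shrink (1, snd z))"
        using shrink_one_W by (intro continuous_map_into_subtopology) (auto simp: topspace_IX)
    qed
    from continuous_map_compose[OF this H(1)]
    have "continuous_map (subtopology IX ?L) (XW r n) (\<lambda>z. H (fst z * ramp 3 (height (snd z)), shrink (1, snd z)))"
      by (simp add: comp_def)
    then show "continuous_map (subtopology IX ?L) X (\<lambda>z. H (fst z * ramp 3 (height (snd z)), shrink (1, snd z)))"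
      using W_mono[of r n] unfolding continuous_map_in_subtopology by blast
  qed
  have "homotopic_with (class_preserving r (Suc n)) X X id (\<lambda>\<mu>. shrink (1, \<mu>))"
    unfolding rc
  proof (intro exI[of _ shrink] conjI ballI)
    show "continuous_map IX X shrink" by (rule continuous_shrink)
    show "class_preserving r (Suc n) (\<lambda>x. shrink (t, x))" if "t \<in> {0..1}" for t
      unfolding class_preserving_def using shrink_preserves that by auto
  qed (simp_all add: shrink_zero)
  moreover have "homotopic_with (class_preserving r (Suc n)) X X (\<lambda>\<mu>. shrink (1, \<mu>)) (\<lambda>\<mu>. K (1, \<mu>))"
    unfolding rc
  proof (intro exI[of _ K] conjI ballI)
    show "continuous_map IX X K" by (rule K)
    show "K (0, \<mu>) = shrink (1, \<mu>)" for \<mu> using H(2) by (simp add: K_def)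
    fix t :: real assume t: "t \<in> {0..1}"
    show "class_preserving r (Suc n) (\<lambda>\<mu>. K (t, \<mu>))"
      unfolding class_preserving_def
    proof (intro allI impI)
      fix \<mu> \<nu> assume \<mu>: "\<mu> \<in> W r (Suc n)" and rel: "(\<mu>, \<nu>) \<in> collapse_rel r"
      have rel1: "(shrink (1, \<mu>), shrink (1, \<nu>)) \<in> collapse_rel r" using shrink_preserves[OF _ _ rel] by simp
      note hh = height_cong[OF rel]
      show "(K (t, \<mu>), K (t, \<nu>)) \<in> collapse_rel r"
      proof (cases "height \<mu> \<le> 3 / 4")
        case True
        have "t * ramp 3 (height \<mu>) \<in> {0..1}" using t ramp_bounds[of 3 "height \<mu>"] by (auto simp: mult_le_one)
        from H(4)[OF this] have "(H (t * ramp 3 (height \<mu>), shrink (1, \<mu>)), H (t * ramp 3 (height \<mu>), shrink (1, \<nu>))) \<in> collapse_rel r"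
          unfolding class_preserving_def using shrink_one_W[OF \<mu> True] rel1 by blast
        then show ?thesis using True hh by (simp add: K_def)
      next
        case False then show ?thesis using rel1 hh by (simp add: K_def)
      qed
    qed
  qed simp
  ultimately have hom: "homotopic_with (class_preserving r (Suc n)) X X id (\<lambda>\<mu>. K (1, \<mu>))"
    by (rule homotopic_with_trans)
  show ?thesis
  proof (rule that[OF hom])
    fix \<mu> \<nu> assume \<mu>: "\<mu> \<in> W r (Suc n)" and rel: "(\<mu>, \<nu>) \<in> collapse_rel r"
    note hh = height_cong[OF rel]
    show "K (1, \<mu>) = K (1, \<nu>)"
    proof (cases "1 / 2 \<le> height \<mu>")
      case True
      then show ?thesis using shrink_one_collapses[OF rel] hh by (simp add: K_def)
    next
      case False
      then have "ramp 3 (height \<mu>) = 1" by (simp add: ramp_def)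
      moreover have "h (shrink (1, \<mu>)) = h (shrink (1, \<nu>))"
        using h[OF shrink_one_W[OF \<mu>]] shrink_preserves[OF _ _ rel, of 1] False by simp
      ultimately show ?thesis using False hh H(3) by (simp add: K_def)
    qed
  qed
qed

end

lemma collapsing_homotopy:
  assumes r: "0 \<le> r" "r < pi"
  shows "\<exists>h. homotopic_with (class_preserving r n) (XW r n) (XW r n) id h \<and>
    (\<forall>\<mu> \<nu>. \<mu> \<in> W r n \<longrightarrow> (\<mu>, \<nu>) \<in> collapse_rel r \<longrightarrow> h \<mu> = h \<nu>)"
proof (induction n)
  case 0
  \<comment> \<open>\<open>W r 0\<close> is empty.\<close>
  have "homotopic_with (class_preserving r 0) (XW r 0) (XW r 0) id id"
    unfolding homotopic_with_refl by (simp add: class_preserving_def)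
  then show ?case by (intro exI[of _ id] conjI, assumption) (simp add: W_def)
next
  case (Suc n)
  interpret stratum r n by unfold_locales (use r in auto)
  obtain h where h: "homotopic_with (class_preserving r n) (XW r n) (XW r n) id h"
    "\<And>\<mu> \<nu>. \<mu> \<in> W r n \<Longrightarrow> (\<mu>, \<nu>) \<in> collapse_rel r \<Longrightarrow> h \<mu> = h \<nu>" using Suc by blast
  show ?case using homotopy_step[OF h] by metis
qed

text \<open>By \<open>level_bound\<close>, \<open>2 * pi * k \<le> r * (2 * k + 1)\<close>, which
  for \<open>r < pi\<close> bounds the level by \<open>r / (2 * (pi - r))\<close>.\<close>

lemma VR_eq_W:
  assumes r: "0 \<le> r" "r < pi"
  obtains n where "VR r = W r n"
proof -
  let ?n = "Suc (nat \<lceil>r / (2 * (pi - r))\<rceil>)"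
  have "VR r \<subseteq> W r ?n"
  proof
    fix \<mu> assume "\<mu> \<in> VR r"
    then obtain k where k: "\<mu> \<in> V r k" using VR_cover[OF r] by blast
    note g = indexed_idx[OF r k]
    have "2 * pi * real k \<le> r * (2 * real k + 1)"
    proof -
      have pos: "0 < 2 * real k + 1" by simp
      have "step k * real k \<le> r" by (rule level_bound[OF indexed_run[OF g] indexed_spread[OF g]])
      then have "(step k * real k) * (2 * real k + 1) \<le> r * (2 * real k + 1)" using pos by (intro mult_right_mono) auto
      then show ?thesis using step_turn[of k] by (simp only: mult.assoc mult.commute mult.left_commute)
    qed
    then have "real k * (2 * (pi - r)) \<le> r" by (simp add: algebra_simps)
    then have "real k \<le> r / (2 * (pi - r))" using r by (simp add: pos_le_divide_eq)
    then have "k < ?n" by linarith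
    then show "\<mu> \<in> W r ?n" using k by (auto simp: W_def)
  qed
  moreover have "W r ?n \<subseteq> VR r" by (auto simp: W_def V_def)
  ultimately show ?thesis using that by blast
qed

theorem theorem1:
  fixes r :: real
  assumes "0 \<le> r" and "r < pi"
  shows "equiv (VR r) (collapse_rel r) \<and>
    VR_topology r homotopy_equivalent_space quotient_topology (VR_topology r) (collapse_rel r)"
proof
  show equiv: "equiv (VR r) (collapse_rel r)" by (rule equiv_collapse_rel[OF assms])
  obtain n where n: "VR r = W r n" using VR_eq_W[OF assms] .
  obtain h where h: "homotopic_with (class_preserving r n) (XW r n) (XW r n) id h"
    "\<And>\<mu> \<nu>. \<mu> \<in> W r n \<Longrightarrow> (\<mu>, \<nu>) \<in> collapse_rel r \<Longrightarrow> h \<mu> = h \<nu>"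
    using collapsing_homotopy[OF assms] by blast
  have top: "topspace (VR_topology r) = VR r" unfolding VR_topology_def n by (rule topspace_XW)
  have mem: "\<mu> \<in> W r n" if "(\<mu>, \<nu>) \<in> collapse_rel r" for \<mu> \<nu>
    using that unfolding n[symmetric] by (auto simp: collapse_rel_def V_def)
  show "VR_topology r homotopy_equivalent_space quotient_topology (VR_topology r) (collapse_rel r)"
  proof (rule quotient_homotopy_equivalence)
    show "equiv (topspace (VR_topology r)) (collapse_rel r)" unfolding top by (rule equiv)
    show "homotopic_with (\<lambda>h. \<forall>\<mu> \<nu>. (\<mu>, \<nu>) \<in> collapse_rel r \<longrightarrow> (h \<mu>, h \<nu>) \<in> collapse_rel r) (VR_topology r) (VR_topology r) id h"
      unfolding VR_topology_def n
      by (rule homotopic_with_mono[OF h(1)]) (use mem in \<open>auto simp: class_preserving_def\<close>)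
    show "h \<mu> = h \<nu>" if "(\<mu>, \<nu>) \<in> collapse_rel r" for \<mu> \<nu> using h(2)[OF mem[OF that] that] .
  qed
qed

end
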